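(* Let $\varphi:\mathbb{R}^n\to\overline{\mathbb{R}}$ be finite at $\bar x\in\mathbb{R}^n$ and have the composite representation $\varphi=g\circ\Phi$ around $\bar x$. Let $\bar v\in\partial\varphi(\bar x)$ and $\bar\lambda\in\Lambda(\bar x,\bar v)$. If the second-order qualification condition (SOQC) holds at $(\bar x,\bar\lambda)$, then the following properties are equivalent: (a) there exists a neighborhood $U$ of $(\bar x,\bar v)$ such that for any $(x,v)\in U\cap\mathrm{gph}\,\partial\varphi$, $\varphi$ is strictly twice epi-differentiable at $x$ for $v$; (b) $\bar v\in\mathrm{ri}\,\partial\varphi(\bar x)$.
   Context: $\overline{\mathbb{R}}=[-\infty,\infty]$; $\mathrm{ri}$ denotes relative interior. "$\varphi$ has the composite representation around $\bar x$" means: there are a neighborhood $O$ of $\bar x$, a mapping $\Phi:\mathbb{R}^n\to\mathbb{R}^m$ twice continuously differentiable around $\bar x$, and a polyhedral function $g:\mathbb{R}^m\to\overline{\mathbb{R}}$ (proper, with $\mathrm{epi}\,g$ a polyhedral convex set) such that $\varphi(x)=g(\Phi(x))$ for all $x\in O$. $\nabla\Phi(x)$ is the Jacobian and $\nabla\Phi(x)^*$ its transpose. Tangent cone: $T_\Omega(\bar x)=\limsup_{t\searrow0}(\Omega-\bar x)/t$. Regular normal cone: $\widehat N_\Omega(\bar x)=T_\Omega(\bar x)^*$ (polar cone). Limiting normal cone $N_\Omega(\bar x)$: all limits of $v^k\in\widehat N_\Omega(x^k)$ with $x^k\to\bar x$, $x^k\in\Omega$. Subdifferential: $\partial f(\bar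 x)=\{v : (v,-1)\in N_{\mathrm{epi} f}(\bar x,f(\bar x))\}$. Coderivative of $F$: $w\in D^*F(\bar x,\bar y)(u)\iff(w,-u)\in N_{\mathrm{gph}F}(\bar x,\bar y)$. Multipliers: $\Lambda(x,v)=\{\lambda\in\mathbb{R}^m : \nabla\Phi(x)^*\lambda=v,\ \lambda\in\partial g(\Phi(x))\}$. SOQC at $(\bar x,\bar\lambda)$: $D^*(\partial g)(\Phi(\bar x),\bar\lambda)(0)\cap\ker\nabla\Phi(\bar x)^*=\{0\}$. Second-order difference quotients: $\Delta_t^2f(x,v)(w)=\dfrac{f(x+tw)-f(x)-t\langle v,w\rangle}{\frac12t^2}$. Functions $f^k$ epi-converge to $f$ if $\mathrm{epi}\,f^k\to\mathrm{epi}\,f$ in the sense of set convergence (inner limit = outer limit, Painlevé–Kuratowski). $f$ is strictly twice epi-differentiable at $\bar x$ for $\bar v\in\partial f(\bar x)$ if the functions $\Delta_t^2f(x,v)$ epi-converge to some (one and the same) function as $t\searrow0$ and $(x,v)\to(\bar x,\bar v)$ with $f(x)\to f(\bar x)$ and $(x,v)\in\mathrm{gph}\,\partial f$. *)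

theory Defs
  imports "HOL-Analysis.Analysis"
begin

section \<open>Set convergence\<close>

text \<open>Outer and inner limits (Painleve--Kuratowski) of a family of sets along a filter, in the
  neighbourhood form: a point belongs to the outer limit if each of its neighbourhoods
  is hit frequently, and to the inner limit if each is hit eventually. For countably generated
  filters, such as all those used below, these are the usual sequential limits.\<close>

definition outer_limit :: "'i filter \<Rightarrow> ('i \<Rightarrow> 'a::topological_space set) \<Rightarrow> 'a set" where
  "outer_limit F C = {w. \<forall>V. open V \<longrightarrow> w \<in> V \<longrightarrow> (\<exists>\<^sub>F i in F. C i \<inter> V \<noteq> {})}"

definition inner_limit :: "'i filter \<Rightarrow> ('i \<Rightarrow> 'a::topological_space set) \<Rightarrow> 'a set" where
  "inner_limit F C = {w. \<forall>V. open V \<longrightarrow> w \<in> V \<longrightarrow> (\<forall>\<^sub>F i in F. C i \<inter> V \<noteq> {})}"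

definition set_converges :: "'i filter \<Rightarrow> ('i \<Rightarrow> 'a::topological_space set) \<Rightarrow> 'a set \<Rightarrow> bool" where
  "set_converges F C L \<longleftrightarrow> inner_limit F C = L \<and> outer_limit F C = L"

text \<open>The library's \<open>epigraph\<close> is for real-valued functions only.\<close>

definition epi :: "('a \<Rightarrow> ereal) \<Rightarrow> ('a \<times> real) set" where
  "epi f = {(x, r). f x \<le> ereal r}"

definition epi_converges ::
    "'i filter \<Rightarrow> ('i \<Rightarrow> 'a::topological_space \<Rightarrow> ereal) \<Rightarrow> ('a \<Rightarrow> ereal) \<Rightarrow> bool" where
  "epi_converges F fs f \<longleftrightarrow> set_converges F (\<lambda>i. epi (fs i)) (epi f)"


section \<open>Variational geometry\<close>

definition tangent_cone :: "'a::euclidean_space set \<Rightarrow> 'a \<Rightarrow> 'a set" where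
  "tangent_cone S x = outer_limit (at_right (0::real)) (\<lambda>t. (\<lambda>y. (y - x) /\<^sub>R t) ` S)"

definition polar_cone :: "'a::euclidean_space set \<Rightarrow> 'a set" where
  "polar_cone K = {v. \<forall>w\<in>K. v \<bullet> w \<le> 0}"

definition regular_normal_cone :: "'a::euclidean_space set \<Rightarrow> 'a \<Rightarrow> 'a set" where
  "regular_normal_cone S x = polar_cone (tangent_cone S x)"

definition limiting_normal_cone :: "'a::euclidean_space set \<Rightarrow> 'a \<Rightarrow> 'a set" where
  "limiting_normal_cone S x =
     {v. \<exists>xs vs. (\<forall>k::nat. xs k \<in> S \<and> vs k \<in> regular_normal_cone S (xs k)) \<and>
         xs \<longlonglongrightarrow> x \<and> vs \<longlonglongrightarrow> v}"

definition gph :: "('a \<Rightarrow> 'b set) \<Rightarrow> ('a \<times> 'b) set" where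
  "gph F = {(x, y). y \<in> F x}"

text \<open>The subdifferential is empty at points where the function is not finite.\<close>

definition subdifferential :: "('a::euclidean_space \<Rightarrow> ereal) \<Rightarrow> 'a \<Rightarrow> 'a set" where
  "subdifferential f x =
     {v. \<bar>f x\<bar> \<noteq> \<infinity> \<and> (v, - 1) \<in> limiting_normal_cone (epi f) (x, real_of_ereal (f x))}"

definition coderivative ::
    "('a::euclidean_space \<Rightarrow> 'b::euclidean_space set) \<Rightarrow> 'a \<Rightarrow> 'b \<Rightarrow> 'b \<Rightarrow> 'a set" where
  "coderivative F x y u = {w. (w, - u) \<in> limiting_normal_cone (gph F) (x, y)}"


section \<open>Strict twice epi-differentiability\<close>

definition second_order_quotient ::
    "('a::euclidean_space \<Rightarrow> ereal) \<Rightarrow> real \<Rightarrow> 'a \<Rightarrow> 'a \<Rightarrow> 'a \<Rightarrow> ereal" where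
  "second_order_quotient f t x v w =
     (f (x + t *\<^sub>R w) - f x - ereal (t * (v \<bullet> w))) / ereal (t\<^sup>2 / 2)"

text \<open>The filter expresses \<open>(x, v) \<rightarrow> (xbar, vbar)\<close> within \<open>gph (subdifferential f)\<close> and with
  \<open>f x \<rightarrow> f xbar\<close>; the pair \<open>(xbar, vbar)\<close> itself is allowed as a value of \<open>(x, v)\<close>.\<close>

definition subgradient_filter ::
    "('a::euclidean_space \<Rightarrow> ereal) \<Rightarrow> 'a \<Rightarrow> 'a \<Rightarrow> ('a \<times> 'a) filter" where
  "subgradient_filter f xbar vbar =
     inf (inf (nhds (xbar, vbar)) (principal (gph (subdifferential f))))
         (filtercomap (\<lambda>(x, v). f x) (nhds (f xbar)))"

definition strictly_twice_epi_differentiable ::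
    "('a::euclidean_space \<Rightarrow> ereal) \<Rightarrow> 'a \<Rightarrow> 'a \<Rightarrow> bool" where
  "strictly_twice_epi_differentiable f xbar vbar \<longleftrightarrow>
     vbar \<in> subdifferential f xbar \<and>
     (\<exists>h. epi_converges (at_right 0 \<times>\<^sub>F subgradient_filter f xbar vbar)
            (\<lambda>(t, x, v). second_order_quotient f t x v) h)"


section \<open>Composite representation\<close>

definition polyhedral_function :: "('a::euclidean_space \<Rightarrow> ereal) \<Rightarrow> bool" where
  "polyhedral_function g \<longleftrightarrow>
     (\<forall>y. g y \<noteq> -\<infinity>) \<and> (\<exists>y. g y \<noteq> \<infinity>) \<and> polyhedron (epi g)"

definition twice_cont_differentiable_around ::
    "('a::euclidean_space \<Rightarrow> 'b::euclidean_space) \<Rightarrow> 'a \<Rightarrow> bool" where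
  "twice_cont_differentiable_around \<Phi> xbar \<longleftrightarrow>
     (\<exists>V (D :: 'a \<Rightarrow> 'a \<Rightarrow>\<^sub>L 'b) (D2 :: 'a \<Rightarrow> 'a \<Rightarrow>\<^sub>L 'a \<Rightarrow>\<^sub>L 'b). open V \<and> xbar \<in> V \<and>
        (\<forall>x\<in>V. (\<Phi> has_derivative blinfun_apply (D x)) (at x) \<and>
               (D has_derivative blinfun_apply (D2 x)) (at x)) \<and>
        continuous_on V D2)"

definition composite_representation ::
    "('a::euclidean_space \<Rightarrow> ereal) \<Rightarrow> ('b::euclidean_space \<Rightarrow> ereal) \<Rightarrow> ('a \<Rightarrow> 'b) \<Rightarrow> 'a \<Rightarrow> bool" where
  "composite_representation \<phi> g \<Phi> xbar \<longleftrightarrow>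
     twice_cont_differentiable_around \<Phi> xbar \<and> polyhedral_function g \<and>
     (\<forall>\<^sub>F x in nhds xbar. \<phi> x = g (\<Phi> x))"

definition multipliers ::
    "(real^'m \<Rightarrow> ereal) \<Rightarrow> (real^'n \<Rightarrow> real^'m) \<Rightarrow> real^'n \<Rightarrow> real^'n \<Rightarrow> (real^'m) set" where
  "multipliers g \<Phi> x v =
     {l. transpose (jacobian \<Phi> (at x)) *v l = v \<and> l \<in> subdifferential g (\<Phi> x)}"

definition SOQC ::
    "(real^'m \<Rightarrow> ereal) \<Rightarrow> (real^'n \<Rightarrow> real^'m) \<Rightarrow> real^'n \<Rightarrow> real^'m \<Rightarrow> bool" where
  "SOQC g \<Phi> xbar lbar \<longleftrightarrow>
     coderivative (subdifferential g) (\<Phi> xbar) lbar 0 \<inter>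
       {w. transpose (jacobian \<Phi> (at xbar)) *v w = 0} = {0}"

end

theory Submission
  imports Defs
begin

text \<open>Let \<open>L\<close> be the subspace parallel to the affine hull of the subdifferential \<open>C\<close> of \<open>g\<close> at \<open>\<Phi> xbar\<close>
  and \<open>P\<close> the orthogonal projection onto \<open>L\<close>. The coderivative in SOQC contains \<open>L\<close>, so SOQC makes
  the adjoint Jacobian injective on \<open>L\<close>; equivalently \<open>P \<circ> \<Phi>\<close> is a submersion, hence metrically
  regular, near \<open>xbar\<close>. Near \<open>\<Phi> xbar\<close> the function \<open>g\<close> is conic and is affine along the orthogonal
  complement of \<open>L\<close>; this gives the chain rule for the subdifferential of \<open>\<phi>\<close> and shows that \<open>vbar\<close> is in
  the relative interior iff the multiplier \<open>lbar\<close> is.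

  If \<open>lbar\<close> is in the relative interior of \<open>C\<close>, nearby points \<open>(x, v)\<close> of the graph satisfy
  \<open>P (\<Phi> x) = P (\<Phi> xbar)\<close>, and at such points \<open>g\<close> grows at a linear rate in \<open>P\<close>. The second-order
  quotients then epi-converge to the Hessian form of \<open>\<lambda>x. lbar \<bullet> \<Phi> x\<close> restricted to the kernel of the
  derivative of \<open>P \<circ> \<Phi>\<close>. If \<open>lbar\<close> is a relative boundary point, the limit of the quotients at the fixed
  pair \<open>(xbar, vbar)\<close> is finite in some direction outside that kernel, whereas for subgradients with relative
  interior multipliers the limit is infinite there, so no common limit exists.\<close>

section \<open>Normal cones of convex sets\<close>

text \<open>Lower and upper estimates of the quotients are not symmetric. Lower ones are subgradient
  inequalities of \<open>g\<close> and hold at every point. Upper ones need the moved point to lie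
  in the domain of \<open>g\<close>, although \<open>g\<close> may be infinite arbitrarily close to
  it. Therefore a straight path \<open>x + t w\<close> is corrected first: metric regularity makes
  the \<open>L\<close>-component of \<Phi> take a prescribed value exactly, at the price of a
  displacement of order o(t), which leaves the limiting direction unchanged. The remaining component
  is orthogonal to \<open>L\<close>, where \<open>g\<close> is affine. One estimate controls all
  multipliers: \<open>c * norm l <= norm (Dadj x l)\<close> for \<open>l\<close> in
  \<open>L\<close>, with the same \<open>c\<close> for all \<open>x\<close> near
  \<open>xbar\<close>. It gives boundedness when normals pass to a limit, and convergence to
  \<open>lbar\<close> along the graph. The latter makes (b) stable: at nearby graph points the
  subdifferential of \<open>g\<close> is still \<open>C\<close> and the multiplier is still
  relatively interior, so the pointwise result applies there too. In the other direction, strictness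
  at \<open>(xbar, vbar)\<close> alone is exploited.\<close>

lemma tangent_cone_iff_seq:
  "w \<in> tangent_cone S x \<longleftrightarrow>
     (\<exists>t ws. (\<forall>k::nat. t k > (0::real) \<and> x + t k *\<^sub>R ws k \<in> S) \<and> t \<longlonglongrightarrow> 0 \<and> ws \<longlonglongrightarrow> w)"
proof
  assume w: "w \<in> tangent_cone S x"
  have "\<exists>t u. 0 < t \<and> t < inverse (Suc k) \<and> dist u w < inverse (Suc k) \<and> x + t *\<^sub>R u \<in> S" for k
  proof -
    let ?e = "inverse (real (Suc k))"
    have "\<exists>\<^sub>F t in at_right 0. (\<lambda>y. (y - x) /\<^sub>R t) ` S \<inter> ball w ?e \<noteq> {}"
      using w unfolding tangent_cone_def outer_limit_def by simp
    moreover have "\<forall>\<^sub>F t in at_right (0::real). 0 < t \<and> t < ?e"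
      by (rule eventually_at_rightI[of 0 ?e]) auto
    ultimately have "\<exists>\<^sub>F t in at_right 0. (0 < t \<and> t < ?e) \<and>
        (\<lambda>y. (y - x) /\<^sub>R t) ` S \<inter> ball w ?e \<noteq> {}"
      by (rule frequently_eventually_conj)
    then obtain t y where t: "0 < t" "t < ?e" "y \<in> S" "dist w ((y - x) /\<^sub>R t) < ?e"
      by (force dest: frequently_ex)
    then have "x + t *\<^sub>R ((y - x) /\<^sub>R t) \<in> S" by simp
    with t show ?thesis by (metis dist_commute)
  qed
  then obtain t ws where tw: "\<And>k. 0 < t k \<and> t k < inverse (Suc k) \<and>
      dist (ws k) w < inverse (Suc k) \<and> x + t k *\<^sub>R ws k \<in> S"
    by metis
  have "t \<longlonglongrightarrow> 0"
    by (rule tendsto_sandwich[OF _ _ tendsto_const LIMSEQ_inverse_real_of_nat])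
       (use tw in \<open>auto intro!: always_eventually less_imp_le\<close>)
  moreover have "(\<lambda>k. dist (ws k) w) \<longlonglongrightarrow> 0"
    by (rule tendsto_sandwich[OF _ _ tendsto_const LIMSEQ_inverse_real_of_nat])
       (use tw in \<open>auto intro!: always_eventually less_imp_le\<close>)
  ultimately show "\<exists>t ws. (\<forall>k::nat. t k > (0::real) \<and> x + t k *\<^sub>R ws k \<in> S) \<and> t \<longlonglongrightarrow> 0 \<and> ws \<longlonglongrightarrow> w"
    using tw tendsto_dist_iff by blast
next
  assume "\<exists>t ws. (\<forall>k::nat. t k > (0::real) \<and> x + t k *\<^sub>R ws k \<in> S) \<and> t \<longlonglongrightarrow> 0 \<and> ws \<longlonglongrightarrow> w"
  then obtain t ws where tw: "\<And>k::nat. t k > (0::real)" "\<And>k. x + t k *\<^sub>R ws k \<in> S"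
    and t: "t \<longlonglongrightarrow> 0" and ws: "ws \<longlonglongrightarrow> w" by blast
  show "w \<in> tangent_cone S x"
    unfolding tangent_cone_def outer_limit_def
  proof safe
    fix V assume V: "open V" "w \<in> V"
    show "\<exists>\<^sub>F t in at_right 0. (\<lambda>y. (y - x) /\<^sub>R t) ` S \<inter> V \<noteq> {}"
      unfolding frequently_def
    proof
      assume ev: "\<forall>\<^sub>F t in at_right 0. \<not> (\<lambda>y. (y - x) /\<^sub>R t) ` S \<inter> V \<noteq> {}"
      have "filterlim t (at_right 0) sequentially"
        using t tw(1) by (intro tendsto_imp_filterlim_at_right) auto
      then have "\<forall>\<^sub>F k in sequentially. \<not> (\<lambda>y. (y - x) /\<^sub>R t k) ` S \<inter> V \<noteq> {}"
        by (rule eventually_compose_filterlim[OF ev])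
      moreover have "\<forall>\<^sub>F k in sequentially. ws k \<in> V"
        using ws V by (simp add: topological_tendstoD)
      ultimately have "\<forall>\<^sub>F k in sequentially. False"
      proof eventually_elim
        case (elim k)
        have "ws k = ((x + t k *\<^sub>R ws k) - x) /\<^sub>R t k" using tw(1)[of k] by simp
        then have "ws k \<in> (\<lambda>y. (y - x) /\<^sub>R t k) ` S" using tw(2)[of k] by blast
        with elim show False by blast
      qed
      then show False by simp
    qed
  qed
qed

text \<open>The means of exhibiting tangents later on: a curve defined for all small
  \<open>t\<close> is hit eventually, which is stronger than the frequent hits that the outer limit
  asks for.\<close>

lemma tangent_cone_curveI:
  fixes c :: "real \<Rightarrow> 'a::euclidean_space"
  assumes c: "\<forall>\<^sub>F t in at_right 0. c t \<in> S"
    and lim: "((\<lambda>t. (c t - x) /\<^sub>R t) \<longlongrightarrow> w) (at_right 0)"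
  shows "w \<in> tangent_cone S x"
  unfolding tangent_cone_def outer_limit_def
proof safe
  fix V assume V: "open V" "w \<in> V"
  have "\<forall>\<^sub>F t in at_right 0. (c t - x) /\<^sub>R t \<in> V"
    using lim V by (rule topological_tendstoD)
  with c have "\<forall>\<^sub>F t in at_right 0. (\<lambda>y. (y - x) /\<^sub>R t) ` S \<inter> V \<noteq> {}"
    by eventually_elim blast
  then show "\<exists>\<^sub>F t in at_right 0. (\<lambda>y. (y - x) /\<^sub>R t) ` S \<inter> V \<noteq> {}"
    by (rule eventually_frequently[rotated]) simp
qed

lemma tangent_cone_convexI:
  assumes "convex S" "x \<in> S" "y \<in> S"
  shows "y - x \<in> tangent_cone S x"
proof (rule tangent_cone_curveI[where c = "\<lambda>t. x + t *\<^sub>R (y - x)"])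
  have "\<forall>\<^sub>F t in at_right (0::real). 0 < t \<and> t < 1"
    by (rule eventually_at_rightI[of 0 1]) auto
  then show "\<forall>\<^sub>F t in at_right 0. x + t *\<^sub>R (y - x) \<in> S"
  proof eventually_elim
    case (elim t)
    have "x + t *\<^sub>R (y - x) = (1 - t) *\<^sub>R x + t *\<^sub>R y" by (simp add: algebra_simps)
    then show ?case using convexD_alt[OF assms, of t] elim by simp
  qed
  have "\<forall>\<^sub>F t in at_right (0::real). y - x = (x + t *\<^sub>R (y - x) - x) /\<^sub>R t"
    by (rule eventually_at_rightI[of 0 1]) auto
  then show "((\<lambda>t. (x + t *\<^sub>R (y - x) - x) /\<^sub>R t) \<longlongrightarrow> y - x) (at_right 0)"
    by (rule Lim_transform_eventually[OF tendsto_const])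
qed

lemma limiting_normal_cone_constI:
  assumes "x \<in> S" "p \<in> regular_normal_cone S x"
  shows "p \<in> limiting_normal_cone S x"
  unfolding limiting_normal_cone_def
  by (rule CollectI, rule exI[of _ "\<lambda>_. x"], rule exI[of _ "\<lambda>_. p"]) (use assms in simp)

text \<open>At a nearby point \<open>xs k\<close> the vector \<open>y - xs k\<close> is tangent, so
  a regular normal satisfies the inequality there, and the inequality is closed under limits.
  Conversely, the global inequality bounds all difference quotients at \<open>x\<close>, so
  \<open>p\<close> is already a regular normal at \<open>x\<close> itself.\<close>

lemma limiting_normal_cone_convex:
  assumes "convex S" "x \<in> S"
  shows "p \<in> limiting_normal_cone S x \<longleftrightarrow> (\<forall>y\<in>S. p \<bullet> (y - x) \<le> 0)"
proof
  assume "p \<in> limiting_normal_cone S x"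
  then obtain xs vs where xv: "\<And>k. xs k \<in> S" "\<And>k. vs k \<in> regular_normal_cone S (xs k)"
    "xs \<longlonglongrightarrow> x" "vs \<longlonglongrightarrow> p"
    unfolding limiting_normal_cone_def by auto
  show "\<forall>y\<in>S. p \<bullet> (y - x) \<le> 0"
  proof
    fix y assume "y \<in> S"
    then have "vs k \<bullet> (y - xs k) \<le> 0" for k
      using xv(2)[of k] tangent_cone_convexI[OF assms(1) xv(1)[of k], of y]
      by (simp add: regular_normal_cone_def polar_cone_def)
    moreover have "(\<lambda>k. vs k \<bullet> (y - xs k)) \<longlonglongrightarrow> p \<bullet> (y - x)"
      using xv by (intro tendsto_intros)
    ultimately show "p \<bullet> (y - x) \<le> 0"
      by (meson LIMSEQ_le_const2)
  qed
next
  assume p: "\<forall>y\<in>S. p \<bullet> (y - x) \<le> 0"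
  have "p \<in> regular_normal_cone S x"
    unfolding regular_normal_cone_def polar_cone_def
  proof safe
    fix w assume "w \<in> tangent_cone S x"
    then obtain t ws where tw: "\<And>k::nat. t k > (0::real)" "\<And>k. x + t k *\<^sub>R ws k \<in> S" "ws \<longlonglongrightarrow> w"
      unfolding tangent_cone_iff_seq by blast
    have "p \<bullet> ws k \<le> 0" for k
      using p[rule_format, OF tw(2)[of k]] tw(1)[of k] by (simp add: mult_le_0_iff)
    moreover have "(\<lambda>k. p \<bullet> ws k) \<longlonglongrightarrow> p \<bullet> w" using tw by (intro tendsto_intros)
    ultimately show "p \<bullet> w \<le> 0" by (meson LIMSEQ_le_const2)
  qed
  then show "p \<in> limiting_normal_cone S x"
    using limiting_normal_cone_constI[OF assms(2)] by blast
qed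

lemma subdifferential_imp_finite: "v \<in> subdifferential f x \<Longrightarrow> \<exists>a. f x = ereal a"
  by (auto simp: subdifferential_def)

lemma regular_normal_imp_subdifferential:
  assumes "f x = ereal a" "(v, - 1) \<in> regular_normal_cone (epi f) (x, a)"
  shows "v \<in> subdifferential f x"
  using assms limiting_normal_cone_constI[of "(x, a)" "epi f" "(v, - 1)"]
  by (simp add: subdifferential_def epi_def)

section \<open>Subgradients of polyhedral functions\<close>

text \<open>This is the normal inequality for \<open>(l, - 1)\<close> on the convex epigraph.
  Quantifying over real upper bounds \<open>r\<close> in place of the value \<open>g y\<close> keeps
  all later arithmetic in the reals.\<close>

lemma polyhedral_subdifferential_iff:
  assumes "polyhedral_function g"
  shows "l \<in> subdifferential g z \<longleftrightarrow>
    (\<exists>a. g z = ereal a \<and> (\<forall>y r. g y \<le> ereal r \<longrightarrow> a + l \<bullet> (y - z) \<le> r))"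
proof -
  have c: "convex (epi g)"
    using assms by (simp add: polyhedral_function_def polyhedron_imp_convex)
  have "(l, - 1) \<in> limiting_normal_cone (epi g) (z, a) \<longleftrightarrow>
      (\<forall>y r. g y \<le> ereal r \<longrightarrow> a + l \<bullet> (y - z) \<le> r)" if "g z = ereal a" for a
  proof -
    have "(z, a) \<in> epi g" using that by (simp add: epi_def)
    then show ?thesis
      unfolding limiting_normal_cone_convex[OF c \<open>(z, a) \<in> epi g\<close>]
      by (auto simp: epi_def algebra_simps)
  qed
  then show ?thesis by (auto simp: subdifferential_def)
qed

lemma polyhedral_subgradientD:
  assumes "polyhedral_function g" "l \<in> subdifferential g z" "g z = ereal a" "g y \<le> ereal r"
  shows "a + l \<bullet> (y - z) \<le> r"
  using assms polyhedral_subdifferential_iff[OF assms(1), of l z] by auto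

lemma polyhedral_subgradientI:
  assumes "polyhedral_function g" "g z = ereal a" "\<And>y r. g y \<le> ereal r \<Longrightarrow> a + l \<bullet> (y - z) \<le> r"
  shows "l \<in> subdifferential g z"
  using assms polyhedral_subdifferential_iff[OF assms(1), of l z] by auto

text \<open>Differences of all pairs are used, not translates by a fixed element, so that two
  multipliers can be compared without choosing a base point.\<close>

definition direction_space :: "'a::euclidean_space set \<Rightarrow> 'a set" where
  "direction_space C = span {a - b | a b. a \<in> C \<and> b \<in> C}"

lemma subspace_direction_space [simp]: "subspace (direction_space C)"
  by (simp add: direction_space_def)

lemma diff_in_direction_space: "a \<in> C \<Longrightarrow> b \<in> C \<Longrightarrow> a - b \<in> direction_space C"
  unfolding direction_space_def by (rule span_base) auto

lemma affine_hull_direction_space: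
  assumes "c \<in> C"
  shows "affine hull C = (\<lambda>x. c + x) ` direction_space C"
proof -
  have "span ((\<lambda>x. - c + x) ` C) = direction_space C"
  proof (rule antisym)
    show "span ((\<lambda>x. - c + x) ` C) \<subseteq> direction_space C"
    proof (rule span_minimal)
      show "(\<lambda>x. - c + x) ` C \<subseteq> direction_space C"
        using diff_in_direction_space[OF _ assms] by (auto simp: image_subset_iff)
    qed simp
    show "direction_space C \<subseteq> span ((\<lambda>x. - c + x) ` C)"
      unfolding direction_space_def
    proof (rule span_minimal, safe)
      fix a b assume "a \<in> C" "b \<in> C"
      then have "(- c + a) - (- c + b) \<in> span ((\<lambda>x. - c + x) ` C)"
        by (intro span_diff span_base) auto
      then show "a - b \<in> span ((\<lambda>x. - c + x) ` C)" by simp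
    qed
  qed
  then show ?thesis using affine_hull_span_gen[OF hull_inc[OF assms]] by simp
qed

lemma rel_interior_direction_space:
  "c \<in> rel_interior C \<longleftrightarrow>
     c \<in> C \<and> (\<exists>e>0. \<forall>l\<in>direction_space C. norm l \<le> e \<longrightarrow> c + l \<in> C)"
proof (cases "c \<in> C")
  case True
  have "cball c e \<inter> (\<lambda>x. c + x) ` direction_space C \<subseteq> C \<longleftrightarrow>
      (\<forall>l\<in>direction_space C. norm l \<le> e \<longrightarrow> c + l \<in> C)" for e
    by (auto simp: subset_iff dist_norm)
  then show ?thesis
    unfolding mem_rel_interior_cball affine_hull_direction_space[OF True] by simp
qed (use rel_interior_subset in blast)

section \<open>Local structure of polyhedral functions and their subdifferentials\<close>

lemma polyhedral_subdifferential_convex: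
  assumes "polyhedral_function g"
  shows "convex (subdifferential g z)"
proof (rule convexI)
  fix l m and u v :: real
  assume lm: "l \<in> subdifferential g z" "m \<in> subdifferential g z" and uv: "0 \<le> u" "0 \<le> v" "u + v = 1"
  obtain a where a: "g z = ereal a" using subdifferential_imp_finite[OF lm(1)] by blast
  have "a + (u *\<^sub>R l + v *\<^sub>R m) \<bullet> (y - z) \<le> r" if r: "g y \<le> ereal r" for y r
  proof -
    have "a + l \<bullet> (y - z) \<le> r" "a + m \<bullet> (y - z) \<le> r"
      by (rule polyhedral_subgradientD[OF assms lm(1) a r] polyhedral_subgradientD[OF assms lm(2) a r])+
    then have "u * (a + l \<bullet> (y - z)) + v * (a + m \<bullet> (y - z)) \<le> u * r + v * r"
      using uv by (intro add_mono mult_left_mono) auto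
    moreover have "u * (a + l \<bullet> (y - z)) + v * (a + m \<bullet> (y - z)) =
        (u + v) * a + (u *\<^sub>R l + v *\<^sub>R m) \<bullet> (y - z)"
      by (simp add: algebra_simps)
    moreover have "u * r + v * r = (u + v) * r" by (simp add: algebra_simps)
    ultimately show ?thesis using uv by simp
  qed
  then show "u *\<^sub>R l + v *\<^sub>R m \<in> subdifferential g z"
    by (rule polyhedral_subgradientI[OF assms a])
qed

text \<open>\<open>A\<close> collects the normals of the epigraph constraints that are active at
  \<open>(z, a)\<close>; the inactive ones hold strictly in a ball around that point. The last
  conclusion restricts \<open>y\<close> but not \<open>r\<close>: the subgradient \<open>l\<close>
  keeps \<open>r\<close> from being far below \<open>a\<close>, and an \<open>r\<close> above
  \<open>a\<close> may be lowered to \<open>a\<close> when checking inactive constraints, because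
  last coordinates of normals are nonpositive.\<close>

lemma polyhedral_local_halfspaces:
  fixes g :: "'a::euclidean_space \<Rightarrow> ereal"
  assumes g: "polyhedral_function g" and a: "g z = ereal a" and l: "l \<in> subdifferential g z"
  obtains \<delta> and A :: "('a \<times> real) set" where "\<delta> > 0"
    "\<And>b q. (b, q) \<in> A \<Longrightarrow> q \<le> 0"
    "\<And>b q y r. (b, q) \<in> A \<Longrightarrow> g y \<le> ereal r \<Longrightarrow> b \<bullet> (y - z) + q * (r - a) \<le> 0"
    "\<And>y r. dist y z < \<delta> \<Longrightarrow> \<forall>(b, q)\<in>A. b \<bullet> (y - z) + q * (r - a) \<le> 0 \<Longrightarrow> g y \<le> ereal r"
proof -
  have "polyhedron (epi g)" using g by (simp add: polyhedral_function_def)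
  then obtain F where F: "finite F" "epi g = \<Inter>F"
    and half: "\<forall>h\<in>F. \<exists>n \<beta>. n \<noteq> 0 \<and> h = {x. n \<bullet> x \<le> \<beta>}"
    unfolding polyhedron_def by (elim exE conjE)
  have "\<forall>h\<in>F. \<exists>p. h = {x. fst p \<bullet> x \<le> (snd p :: real)}"
  proof
    fix h assume "h \<in> F"
    from bspec[OF half this] obtain n \<beta> where "h = {x. n \<bullet> x \<le> \<beta>}" by (elim exE conjE)
    then show "\<exists>p. h = {x. fst p \<bullet> x \<le> (snd p :: real)}"
      by (intro exI[of _ "(n, \<beta>)"]) simp
  qed
  from bchoice[OF this] obtain p where p: "\<forall>h\<in>F. h = {x. fst (p h) \<bullet> x \<le> (snd (p h) :: real)}" ..
  define n where "n = fst \<circ> p"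
  define \<beta> where "\<beta> = snd \<circ> p"
  have h: "x \<in> h \<longleftrightarrow> n h \<bullet> x \<le> \<beta> h" if "h \<in> F" for h x
    using bspec[OF p that] unfolding n_def \<beta>_def comp_def by (metis (no_types, lifting) mem_Collect_eq)
  have E: "g y \<le> ereal r \<longleftrightarrow> (\<forall>h\<in>F. n h \<bullet> (y, r) \<le> \<beta> h)" for y r
  proof -
    have "g y \<le> ereal r \<longleftrightarrow> (y, r) \<in> \<Inter>F" using F(2) by (auto simp: epi_def)
    also have "\<dots> \<longleftrightarrow> (\<forall>h\<in>F. n h \<bullet> (y, r) \<le> \<beta> h)" using h by blast
    finally show ?thesis .
  qed
  define e0 where "e0 = (z, a)"
  have e0: "n h \<bullet> e0 \<le> \<beta> h" if "h \<in> F" for h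
    using E[of z a] a that by (auto simp: e0_def)
  have up: "snd (n h) \<le> 0" if hF: "h \<in> F" for h
  proof (rule ccontr)
    assume neg: "\<not> snd (n h) \<le> 0"
    \<comment> \<open>Raising \<open>a\<close> by this amount stays in the epigraph but would
      violate the constraint \<open>h\<close> by exactly 1.\<close>
    define s where "s = (\<beta> h - n h \<bullet> e0 + 1) / snd (n h)"
    have s: "s \<ge> 0" "s * snd (n h) = \<beta> h - n h \<bullet> e0 + 1" using neg e0[OF hF] by (auto simp: s_def)
    then have "g z \<le> ereal (a + s)" using a by simp
    then have "n h \<bullet> (z, a + s) \<le> \<beta> h" using E hF by blast
    then show False using s by (simp add: e0_def inner_prod_def algebra_simps)
  qed
  define A where "A = n ` {h \<in> F. n h \<bullet> e0 = \<beta> h}"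
  have "\<forall>\<^sub>F e in nhds e0. \<forall>h \<in> {h \<in> F. n h \<bullet> e0 < \<beta> h}. n h \<bullet> e < \<beta> h"
  proof (subst eventually_ball_finite_distrib)
    show "finite {h \<in> F. n h \<bullet> e0 < \<beta> h}" using F(1) by simp
    show "\<forall>h\<in>{h \<in> F. n h \<bullet> e0 < \<beta> h}. \<forall>\<^sub>F e in nhds e0. n h \<bullet> e < \<beta> h"
    proof safe
      fix h assume "n h \<bullet> e0 < \<beta> h"
      moreover have "((\<lambda>e. n h \<bullet> e) \<longlongrightarrow> n h \<bullet> e0) (nhds e0)"
        by (intro tendsto_intros filterlim_ident)
      ultimately show "\<forall>\<^sub>F e in nhds e0. n h \<bullet> e < \<beta> h"
        by (simp add: order_tendstoD(2))
    qed
  qed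
  then obtain d where d: "d > 0" "\<And>e h. dist e e0 < d \<Longrightarrow> h \<in> F \<Longrightarrow> n h \<bullet> e0 < \<beta> h \<Longrightarrow> n h \<bullet> e < \<beta> h"
    unfolding eventually_nhds_metric by blast
  have act: "n h \<bullet> (y, r) \<le> \<beta> h" if "h \<in> F" "n h \<bullet> e0 = \<beta> h"
    "\<And>b q. (b, q) \<in> A \<Longrightarrow> b \<bullet> (y - z) + q * (r - a) \<le> 0" for h y r
  proof -
    have "(fst (n h), snd (n h)) \<in> A" using that by (auto simp: A_def)
    from that(3)[OF this] that(2) show ?thesis
      by (simp add: e0_def inner_prod_def algebra_simps)
  qed
  have near: "g y \<le> ereal r" if "dist (y, r) e0 < d"
    "\<And>b q. (b, q) \<in> A \<Longrightarrow> b \<bullet> (y - z) + q * (r - a) \<le> 0" for y r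
    unfolding E
  proof
    fix h assume hF: "h \<in> F"
    show "n h \<bullet> (y, r) \<le> \<beta> h"
    proof (cases "n h \<bullet> e0 = \<beta> h")
      case True
      then show ?thesis using act hF that(2) by blast
    next
      case False
      then show ?thesis using d(2)[OF that(1) hF] e0[OF hF] by simp
    qed
  qed
  \<comment> \<open>The factor \<open>1 + norm l\<close> leaves room for both
    \<open>dist y z\<close> and the displacement of \<open>r'\<close> from \<open>a\<close>, which
    is at most \<open>norm l * dist y z\<close>.\<close>
  define \<delta> where "\<delta> = d / 2 / (1 + norm l)"
  have \<delta>: "\<delta> > 0" using d(1) by (simp add: \<delta>_def divide_pos_pos add_pos_nonneg)
  have l1: "1 + norm l > 0" by (simp add: add_pos_nonneg)
  show ?thesis
  proof (rule that[of \<delta> A])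
    show "\<delta> > 0" by fact
    show "q \<le> 0" if "(b, q) \<in> A" for b q
    proof -
      obtain h where "h \<in> F" "(b, q) = n h" using \<open>(b, q) \<in> A\<close> unfolding A_def by blast
      then show ?thesis using up[of h] by (metis snd_conv)
    qed
    show "b \<bullet> (y - z) + q * (r - a) \<le> 0" if bq: "(b, q) \<in> A" and yr: "g y \<le> ereal r" for b q y r
    proof -
      obtain h where hh: "h \<in> F" "(b, q) = n h" "n h \<bullet> e0 = \<beta> h" using bq by (auto simp: A_def)
      then have "n h \<bullet> (y, r) \<le> \<beta> h" using yr E by blast
      then show ?thesis using hh(3) unfolding hh(2)[symmetric] by (simp add: e0_def algebra_simps)
    qed
    show "g y \<le> ereal r" if y: "dist y z < \<delta>"
      and yrA: "\<forall>(b, q)\<in>A. b \<bullet> (y - z) + q * (r - a) \<le> 0" for y r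
    proof -
      have yr: "b \<bullet> (y - z) + q * (r - a) \<le> 0" if "(b, q) \<in> A" for b q
        using yrA that by blast
      \<comment> \<open>The active constraints are homogeneous around \<open>(z, a)\<close>: scaling
        the displacement by \<open>s\<close> moves it into the ball where they describe the
        epigraph, and the subgradient inequality obtained there scales back.\<close>
      have lower: "a + l \<bullet> (y - z) \<le> r"
      proof -
        let ?u = "(y - z, r - a)"
        define s where "s = d / 2 / (1 + norm ?u)"
        have u1: "1 + norm ?u > 0" by (simp add: add_pos_nonneg)
        have s: "s > 0" using d(1) u1 by (simp add: s_def)
        have "d / 2 / (1 + N) * N \<le> d / 2" if "N \<ge> 0" for N :: real
          using d(1) that by (simp add: field_simps)
        from this[OF norm_ge_zero[of ?u]] have "s * norm ?u \<le> d / 2"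
          unfolding s_def .
        then have "norm (s *\<^sub>R ?u) \<le> d / 2"
          by (simp only: norm_scaleR abs_of_pos[OF s])
        then have "dist (z + s *\<^sub>R (y - z), a + s * (r - a)) e0 < d"
          using d(1) by (simp add: e0_def dist_norm)
        moreover have "b \<bullet> (z + s *\<^sub>R (y - z) - z) + q * (a + s * (r - a) - a) \<le> 0" if "(b, q) \<in> A" for b q
        proof -
          have "s * (b \<bullet> (y - z) + q * (r - a)) \<le> 0"
            using yr[OF that] s by (simp add: mult_le_0_iff)
          then show ?thesis by (simp add: algebra_simps)
        qed
        ultimately have "g (z + s *\<^sub>R (y - z)) \<le> ereal (a + s * (r - a))" by (rule near)
        then have "a + l \<bullet> (z + s *\<^sub>R (y - z) - z) \<le> a + s * (r - a)"
          by (rule polyhedral_subgradientD[OF g l a])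
        then have "s * (l \<bullet> (y - z)) \<le> s * (r - a)" by simp
        then have "l \<bullet> (y - z) \<le> r - a" using s by (simp only: mult_le_cancel_left_pos)
        then show ?thesis by simp
      qed
      have dd: "(1 + norm l) * dist y z < d / 2"
        using y l1 by (simp add: \<delta>_def field_simps)
      have "\<bar>l \<bullet> (y - z)\<bar> \<le> norm l * dist y z"
        by (simp add: Cauchy_Schwarz_ineq2 dist_norm)
      with lower have lo: "r \<ge> a - norm l * dist y z" by linarith
      define r' where "r' = min r a"
      have "dist (y, r') e0 \<le> dist y z + dist r' a"
        unfolding e0_def dist_Pair_Pair by (rule sqrt_sum_squares_le_sum) auto
      moreover have "dist r' a \<le> norm l * dist y z"
        using lo by (auto simp: r'_def dist_real_def min_def)
      ultimately have "dist (y, r') e0 < d"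
        using dd d(1) by (simp add: algebra_simps)
      show ?thesis unfolding E
      proof
        fix h assume hF: "h \<in> F"
        show "n h \<bullet> (y, r) \<le> \<beta> h"
        proof (cases "n h \<bullet> e0 = \<beta> h")
          case True
          then show ?thesis using act hF yr by blast
        next
          case False
          then have "n h \<bullet> (y, r') < \<beta> h"
            using d(2)[OF \<open>dist (y, r') e0 < d\<close> hF] e0[OF hF] by simp
          moreover have "snd (n h) * r \<le> snd (n h) * r'"
            using up[OF hF] by (intro mult_left_mono_neg) (auto simp: r'_def)
          ultimately show ?thesis by (simp add: inner_prod_def)
        qed
      qed
    qed
  qed
qed

text \<open>Homogeneity of the active constraints gives the conic statement. For the other two,
  adding the inequality of an active normal \<open>(b, q)\<close> to that of \<open>l\<close> and
  rescaling shows that \<open>(l + b) /\<^sub>R (1 - q)\<close> is a subgradient. Hence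
  \<open>b + q *\<^sub>R l\<close> is a positive multiple of a difference of subgradients: it
  vanishes on vectors orthogonal to the direction space, and it is nonpositive at every
  \<open>u\<close> for which \<open>l\<close> maximizes the inner product over the
  subdifferential.\<close>

lemma polyhedral_local_structure:
  fixes g :: "'a::euclidean_space \<Rightarrow> ereal"
  assumes g: "polyhedral_function g" and a: "g z = ereal a" and l: "l \<in> subdifferential g z"
  obtains \<delta> where "\<delta> > 0"
    "\<And>w r s. s \<ge> 0 \<Longrightarrow> norm (s *\<^sub>R w) < \<delta> \<Longrightarrow> g (z + w) \<le> ereal (a + r) \<Longrightarrow>
       g (z + s *\<^sub>R w) \<le> ereal (a + s * r)"
    "\<And>y n r. \<forall>m\<in>direction_space (subdifferential g z). m \<bullet> n = 0 \<Longrightarrow>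
       norm (y + n - z) < \<delta> \<Longrightarrow> g y \<le> ereal r \<Longrightarrow> g (y + n) \<le> ereal (r + l \<bullet> n)"
    "\<And>u. \<forall>m\<in>subdifferential g z. m \<bullet> u \<le> l \<bullet> u \<Longrightarrow> norm u < \<delta> \<Longrightarrow>
       g (z + u) \<le> ereal (a + l \<bullet> u)"
proof -
  let ?C = "subdifferential g z"
  obtain \<delta> and A :: "('a \<times> real) set" where \<delta>: "\<delta> > 0"
    and neg: "\<And>b q. (b, q) \<in> A \<Longrightarrow> q \<le> 0"
    and le: "\<And>b q y r. (b, q) \<in> A \<Longrightarrow> g y \<le> ereal r \<Longrightarrow> b \<bullet> (y - z) + q * (r - a) \<le> 0"
    and ge: "\<And>y r. dist y z < \<delta> \<Longrightarrow> \<forall>(b, q)\<in>A. b \<bullet> (y - z) + q * (r - a) \<le> 0 \<Longrightarrow> g y \<le> ereal r"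
    by (rule polyhedral_local_halfspaces[OF g a l]) (rule that)
  have sub: "(l + b) /\<^sub>R (1 - q) \<in> ?C" if bq: "(b, q) \<in> A" for b q
  proof -
    have q: "1 - q > 0" using neg[OF bq] by simp
    have "a + ((l + b) /\<^sub>R (1 - q)) \<bullet> (y - z) \<le> r" if yr: "g y \<le> ereal r" for y r
    proof -
      have "a + l \<bullet> (y - z) \<le> r"
        by (rule polyhedral_subgradientD[OF g l a yr])
      with le[OF bq yr] have "(l + b) \<bullet> (y - z) \<le> (1 - q) * (r - a)"
        by (simp add: algebra_simps)
      then have "((l + b) \<bullet> (y - z)) / (1 - q) \<le> r - a"
        using q by (simp add: pos_divide_le_eq mult.commute)
      then show ?thesis by (simp add: divide_inverse_commute)
    qed
    then show ?thesis by (rule polyhedral_subgradientI[OF g a])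
  qed
  have key: "b + q *\<^sub>R l = (1 - q) *\<^sub>R ((l + b) /\<^sub>R (1 - q) - l)" if bq: "(b, q) \<in> A" for b q
  proof -
    have "1 - q \<noteq> 0" using neg[OF bq] by simp
    then have "(1 - q) *\<^sub>R ((l + b) /\<^sub>R (1 - q) - l) = (l + b) - (1 - q) *\<^sub>R l"
      by (simp add: scaleR_right_diff_distrib del: scaleR_right_distrib)
    then show ?thesis by (simp add: scaleR_left_diff_distrib)
  qed
  show ?thesis
  proof (rule that[OF \<delta>])
    show "g (z + s *\<^sub>R w) \<le> ereal (a + s * r)"
      if "s \<ge> 0" "norm (s *\<^sub>R w) < \<delta>" "g (z + w) \<le> ereal (a + r)" for w r s
    proof (rule ge)
      show "dist (z + s *\<^sub>R w) z < \<delta>" using that by (simp add: dist_norm)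
      have "b \<bullet> (z + s *\<^sub>R w - z) + q * (a + s * r - a) \<le> 0" if bq: "(b, q) \<in> A" for b q
      proof -
        have "b \<bullet> w + q * r \<le> 0" using le[OF bq \<open>g (z + w) \<le> ereal (a + r)\<close>] by simp
        then have "s * (b \<bullet> w + q * r) \<le> 0" using \<open>s \<ge> 0\<close> by (rule mult_nonneg_nonpos[rotated])
        then show ?thesis by (simp add: algebra_simps)
      qed
      then show "\<forall>(b, q)\<in>A. b \<bullet> (z + s *\<^sub>R w - z) + q * (a + s * r - a) \<le> 0" by blast
    qed
    show "g (y + n) \<le> ereal (r + l \<bullet> n)"
      if n: "\<forall>m\<in>direction_space ?C. m \<bullet> n = 0" and "norm (y + n - z) < \<delta>"
        and yr: "g y \<le> ereal r" for y n r
    proof (rule ge)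
      show "dist (y + n) z < \<delta>" using that by (simp add: dist_norm)
      have "b \<bullet> (y + n - z) + q * (r + l \<bullet> n - a) \<le> 0" if bq: "(b, q) \<in> A" for b q
      proof -
        have "((l + b) /\<^sub>R (1 - q) - l) \<bullet> n = 0"
          using n diff_in_direction_space[OF sub[OF bq] l] by blast
        then have "(b + q *\<^sub>R l) \<bullet> n = 0" unfolding key[OF bq] by simp
        with le[OF bq yr] show ?thesis by (simp add: algebra_simps)
      qed
      then show "\<forall>(b, q)\<in>A. b \<bullet> (y + n - z) + q * (r + l \<bullet> n - a) \<le> 0" by blast
    qed
    show "g (z + u) \<le> ereal (a + l \<bullet> u)"
      if u: "\<forall>m\<in>?C. m \<bullet> u \<le> l \<bullet> u" and "norm u < \<delta>" for u
    proof (rule ge)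
      show "dist (z + u) z < \<delta>" using that by (simp add: dist_norm)
      have "b \<bullet> (z + u - z) + q * (a + l \<bullet> u - a) \<le> 0" if bq: "(b, q) \<in> A" for b q
      proof -
        have "(b + q *\<^sub>R l) \<bullet> u = (1 - q) * (((l + b) /\<^sub>R (1 - q) - l) \<bullet> u)"
          unfolding key[OF bq] by simp
        also have "\<dots> \<le> 0"
          using bspec[OF u sub[OF bq]] neg[OF bq] by (intro mult_nonneg_nonpos) (auto simp: inner_diff_left)
        finally show ?thesis by (simp add: algebra_simps)
      qed
      then show "\<forall>(b, q)\<in>A. b \<bullet> (z + u - z) + q * (a + l \<bullet> u - a) \<le> 0" by blast
    qed
  qed
qed

text \<open>Since \<open>g\<close> is conic near \<open>z\<close>, it is controlled at twice the
  displacement of \<open>y\<close>. The inequality of a subgradient \<open>m\<close> at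
  \<open>y\<close>, tested at that doubled point and at \<open>z\<close>, forces \<open>g z\<close>
  to lie on the affine minorant with slope \<open>m\<close>, which therefore supports
  \<open>g\<close> at \<open>z\<close> as well. The doubling is why the radius is halved.\<close>

lemma polyhedral_subdifferential_mono:
  fixes g :: "'a::euclidean_space \<Rightarrow> ereal"
  assumes g: "polyhedral_function g" and l: "l \<in> subdifferential g z"
  obtains \<delta> where "\<delta> > 0"
    "\<And>y. dist y z < \<delta> \<Longrightarrow> subdifferential g y \<subseteq> subdifferential g z"
proof -
  obtain a where a: "g z = ereal a" using subdifferential_imp_finite[OF l] by blast
  obtain \<delta> where \<delta>: "\<delta> > 0"
    and cone: "\<And>w r s. s \<ge> 0 \<Longrightarrow> norm (s *\<^sub>R w) < \<delta> \<Longrightarrow> g (z + w) \<le> ereal (a + r) \<Longrightarrow>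
       g (z + s *\<^sub>R w) \<le> ereal (a + s * r)"
    by (rule polyhedral_local_structure[OF g a l]) (rule that)
  have "m \<in> subdifferential g z" if y: "dist y z < \<delta> / 2" and m: "m \<in> subdifferential g y" for y m
  proof -
    obtain b where b: "g y = ereal b" using subdifferential_imp_finite[OF m] by blast
    have sg: "b + m \<bullet> (x - y) \<le> r" if "g x \<le> ereal r" for x r
      by (rule polyhedral_subgradientD[OF g m b that])
    have "g (z + 2 *\<^sub>R (y - z)) \<le> ereal (a + 2 * (b - a))"
      using y b by (intro cone) (auto simp: dist_norm)
    then have "b + m \<bullet> (z + 2 *\<^sub>R (y - z) - y) \<le> a + 2 * (b - a)" by (rule sg)
    moreover have "z + 2 *\<^sub>R (y - z) - y = y - z" by (simp add: algebra_simps scaleR_2)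
    ultimately have 1: "a + m \<bullet> (y - z) \<le> b" by simp
    have 2: "a = b + m \<bullet> (z - y)"
      using sg[of z a] a 1 by (simp add: algebra_simps)
    have "a + m \<bullet> (x - z) \<le> r" if "g x \<le> ereal r" for x r
      using sg[OF that] 2 by (simp add: algebra_simps)
    then show ?thesis by (rule polyhedral_subgradientI[OF g a])
  qed
  then show ?thesis using that[of "\<delta> / 2"] \<delta> by auto
qed

text \<open>Monotonicity of the subdifferential makes \<open>l\<close> a maximizer of the inner
  product with \<open>y - z\<close> over the subdifferential at \<open>z\<close>. A relatively
  interior maximizer can be moved by a small multiple of \<open>k\<close> both ways, so the linear
  form vanishes on \<open>k\<close>.\<close>

lemma polyhedral_rel_interior_orthogonal:
  assumes g: "polyhedral_function g" and l: "l \<in> rel_interior (subdifferential g z)"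
    and y: "l \<in> subdifferential g y" and k: "k \<in> direction_space (subdifferential g z)"
  shows "k \<bullet> (y - z) = 0"
proof -
  let ?C = "subdifferential g z"
  obtain b where b: "g y = ereal b" using subdifferential_imp_finite[OF y] by blast
  obtain e where e: "e > 0" "\<And>k. k \<in> direction_space ?C \<Longrightarrow> norm k \<le> e \<Longrightarrow> l + k \<in> ?C"
    and lC: "l \<in> ?C"
    using l unfolding rel_interior_direction_space by blast
  obtain a where a: "g z = ereal a" using subdifferential_imp_finite[OF lC] by blast
  have mono: "m \<bullet> (y - z) \<le> l \<bullet> (y - z)" if "m \<in> ?C" for m
  proof -
    have "a + m \<bullet> (y - z) \<le> b"
      by (rule polyhedral_subgradientD[OF g that a]) (simp add: b)
    moreover have "b + l \<bullet> (z - y) \<le> a"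
      by (rule polyhedral_subgradientD[OF g y b]) (simp add: a)
    ultimately show ?thesis by (simp add: algebra_simps)
  qed
  define s where "s = e / (1 + norm k)"
  have s: "s > 0" "norm (s *\<^sub>R k) \<le> e"
    using e(1) by (auto simp: s_def divide_simps add_pos_nonneg algebra_simps)
  have "l + s *\<^sub>R k \<in> ?C" "l + (- s) *\<^sub>R k \<in> ?C"
    by (rule e(2); use s k in \<open>simp add: subspace_scale subspace_neg\<close>)+
  from this[THEN mono] have "s * (k \<bullet> (y - z)) \<le> 0" "s * (k \<bullet> (y - z)) \<ge> 0"
    by (auto simp: inner_add_left inner_diff_left)
  then show ?thesis using s(1) by (simp add: mult_le_0_iff zero_le_mult_iff) 
qed

text \<open>One radius has to serve all elements of \<open>C\<close> near \<open>c\<close>, because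
  the multipliers vary along the filter when the quotients are bounded from below.\<close>

lemma rel_interior_uniform:
  fixes C :: "'a::euclidean_space set"
  assumes "c \<in> rel_interior C"
  obtains e where "e > 0"
    "\<And>d l. d \<in> C \<Longrightarrow> norm (d - c) \<le> e \<Longrightarrow> l \<in> direction_space C \<Longrightarrow> norm l \<le> e \<Longrightarrow> d + l \<in> C"
proof -
  obtain e where e: "e > 0" "\<And>l. l \<in> direction_space C \<Longrightarrow> norm l \<le> e \<Longrightarrow> c + l \<in> C" and c: "c \<in> C"
    using assms unfolding rel_interior_direction_space by blast
  have "d + l \<in> C" if d: "d \<in> C" "norm (d - c) \<le> e / 2" and l: "l \<in> direction_space C" "norm l \<le> e / 2" for d l
  proof -
    have "norm (d - c + l) \<le> e" using norm_triangle_ineq[of "d - c" l] d(2) l(2) by linarith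
    moreover have "d - c + l \<in> direction_space C"
      by (intro subspace_add subspace_direction_space diff_in_direction_space d c l)
    ultimately have "c + (d - c + l) \<in> C" by (intro e)
    then show ?thesis by simp
  qed
  then show ?thesis using that[of "e / 2"] e(1) by auto
qed

lemma rel_interior_near:
  fixes C :: "'a::euclidean_space set"
  assumes "c \<in> rel_interior C"
  obtains e where "e > 0" "\<And>d. d \<in> C \<Longrightarrow> norm (d - c) \<le> e \<Longrightarrow> d \<in> rel_interior C"
proof -
  obtain e where e: "e > 0"
    "\<And>d l. d \<in> C \<Longrightarrow> norm (d - c) \<le> e \<Longrightarrow> l \<in> direction_space C \<Longrightarrow> norm l \<le> e \<Longrightarrow> d + l \<in> C"
    by (rule rel_interior_uniform[OF assms]) (rule that)
  then have "d \<in> rel_interior C" if "d \<in> C" "norm (d - c) \<le> e" for d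
    unfolding rel_interior_direction_space using that by blast
  with e(1) show ?thesis by (rule that)
qed

text \<open>At \<open>(z, m)\<close> with \<open>m\<close> relatively interior, every nearby point
  \<open>(y, d)\<close> of the graph has \<open>y - z\<close> orthogonal to the direction space, so
  \<open>(w, 0)\<close> is a regular normal there. A boundary element \<open>l\<close> is a limit of
  such \<open>m\<close> by convexity, which makes \<open>(w, 0)\<close> a limiting normal at
  \<open>(z, l)\<close>. This is how SOQC becomes injectivity on the direction space.\<close>

lemma direction_space_subset_coderivative:
  fixes g :: "'a::euclidean_space \<Rightarrow> ereal"
  assumes g: "polyhedral_function g" and l: "l \<in> subdifferential g z"
  shows "direction_space (subdifferential g z) \<subseteq> coderivative (subdifferential g) z l 0"
proof
  let ?C = "subdifferential g z"
  fix w assume w: "w \<in> direction_space ?C"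
  obtain \<delta> where \<delta>: "\<delta> > 0" "\<And>y. dist y z < \<delta> \<Longrightarrow> subdifferential g y \<subseteq> ?C"
    by (rule polyhedral_subdifferential_mono[OF g l]) (rule that)
  have reg: "(w, 0) \<in> regular_normal_cone (gph (subdifferential g)) (z, m)"
    if m: "m \<in> rel_interior ?C" for m
    unfolding regular_normal_cone_def polar_cone_def
  proof safe
    fix u n assume "(u, n) \<in> tangent_cone (gph (subdifferential g)) (z, m)"
    then obtain t ws where tw: "\<And>k::nat. t k > (0::real)"
      "\<And>k. (z, m) + t k *\<^sub>R ws k \<in> gph (subdifferential g)" "t \<longlonglongrightarrow> 0" "ws \<longlonglongrightarrow> (u, n)"
      unfolding tangent_cone_iff_seq by blast
    have u: "(\<lambda>k. fst (ws k)) \<longlonglongrightarrow> u" and n: "(\<lambda>k. snd (ws k)) \<longlonglongrightarrow> n"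
      using tendsto_fst[OF tw(4)] tendsto_snd[OF tw(4)] by auto
    obtain e where e: "e > 0" "\<And>d. d \<in> ?C \<Longrightarrow> norm (d - m) \<le> e \<Longrightarrow> d \<in> rel_interior ?C"
      by (rule rel_interior_near[OF m]) (rule that)
    have "(\<lambda>k. t k *\<^sub>R fst (ws k)) \<longlonglongrightarrow> 0 *\<^sub>R u" "(\<lambda>k. t k *\<^sub>R snd (ws k)) \<longlonglongrightarrow> 0 *\<^sub>R n"
      by (intro tendsto_intros tw u n)+
    then have "\<forall>\<^sub>F k in sequentially. norm (t k *\<^sub>R fst (ws k)) < \<delta>"
      "\<forall>\<^sub>F k in sequentially. norm (t k *\<^sub>R snd (ws k)) < e"
      using \<delta>(1) e(1) by (auto simp: tendsto_iff dist_norm)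
    then have "\<forall>\<^sub>F k in sequentially. w \<bullet> fst (ws k) = 0"
    proof eventually_elim
      case (elim k)
      let ?y = "z + t k *\<^sub>R fst (ws k)" and ?d = "m + t k *\<^sub>R snd (ws k)"
      have d: "?d \<in> subdifferential g ?y" using tw(2)[of k] by (cases "ws k") (auto simp: gph_def)
      then have "?d \<in> ?C" using \<delta>(2)[of ?y] elim by (auto simp: dist_norm)
      then have "?d \<in> rel_interior ?C" using elim by (intro e) auto
      from polyhedral_rel_interior_orthogonal[OF g this d w] show ?case
        using tw(1)[of k] by simp
    qed
    then have "(\<lambda>k. w \<bullet> fst (ws k)) \<longlonglongrightarrow> 0" by (rule tendsto_eventually)
    moreover have "(\<lambda>k. w \<bullet> fst (ws k)) \<longlonglongrightarrow> w \<bullet> u" by (intro tendsto_intros u)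
    ultimately have "w \<bullet> u = 0" using LIMSEQ_unique by blast
    then show "(w, 0) \<bullet> (u, n) \<le> 0" by simp
  qed
  have "l \<in> closure (rel_interior ?C)"
    using convex_closure_rel_interior[OF polyhedral_subdifferential_convex[OF g]] l closure_subset by blast
  then obtain ms where ms: "\<And>k. ms k \<in> rel_interior ?C" "ms \<longlonglongrightarrow> l"
    unfolding closure_sequential by blast
  have "(\<lambda>k. (z, ms k)) \<longlonglongrightarrow> (z, l)" by (intro tendsto_intros ms)
  moreover have "(z, ms k) \<in> gph (subdifferential g)" for k
    using ms(1)[of k] rel_interior_subset by (auto simp: gph_def)
  moreover have "(\<lambda>k::nat. (w, 0::'a)) \<longlonglongrightarrow> (w, 0)" by (rule tendsto_const)
  ultimately have "(w, 0) \<in> limiting_normal_cone (gph (subdifferential g)) (z, l)"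
    unfolding limiting_normal_cone_def using reg[OF ms(1)]
    by (intro CollectI exI[of _ "\<lambda>k. (z, ms k)"] exI[of _ "\<lambda>k. (w, 0)"]) auto
  then show "w \<in> coderivative (subdifferential g) z l 0"
    by (simp add: coderivative_def)
qed

section \<open>Orthogonal projections onto subspaces\<close>

text \<open>Encoded through the inner products with \<open>L\<close>, the form in which it is
  applied to subgradients; for a subspace \<open>L\<close> these determine \<open>p\<close>
  uniquely.\<close>

definition orth_proj :: "'a::euclidean_space set \<Rightarrow> 'a \<Rightarrow> 'a" where
  "orth_proj L x = (THE p. p \<in> L \<and> (\<forall>l\<in>L. l \<bullet> p = l \<bullet> x))"

lemma orth_proj_unique:
  assumes "subspace L" "p \<in> L" "\<And>l. l \<in> L \<Longrightarrow> l \<bullet> p = l \<bullet> x"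
  shows "orth_proj L x = p"
  unfolding orth_proj_def
proof (rule the_equality)
  fix q assume q: "q \<in> L \<and> (\<forall>l\<in>L. l \<bullet> q = l \<bullet> x)"
  then have "q - p \<in> L" using assms subspace_diff by blast
  then have "(q - p) \<bullet> (q - p) = 0" using q assms(3) by (simp add: inner_diff_right)
  then show "q = p" by simp
qed (use assms in blast)

lemma
  assumes "subspace L"
  shows orth_proj_in: "orth_proj L x \<in> L"
    and orth_proj_inner: "l \<in> L \<Longrightarrow> l \<bullet> orth_proj L x = l \<bullet> x"
proof -
  obtain y z where yz: "y \<in> span L" "\<And>w. w \<in> span L \<Longrightarrow> orthogonal z w" "x = y + z"
    by (rule orthogonal_subspace_decomp_exists[of L x]) (rule that)
  have sp: "span L = L" using assms by (simp only: span_eq_iff)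
  have "l \<bullet> y = l \<bullet> x" if "l \<in> L" for l
    using yz(2)[of l] that unfolding sp by (simp add: yz(3) orthogonal_def inner_simps inner_commute[of l z])
  with yz have y: "y \<in> L" "\<forall>l\<in>L. l \<bullet> y = l \<bullet> x" unfolding sp by auto
  then have "orth_proj L x = y" using assms by (intro orth_proj_unique) auto
  with y show "orth_proj L x \<in> L" "l \<in> L \<Longrightarrow> l \<bullet> orth_proj L x = l \<bullet> x" by auto
qed

lemma orth_proj_id: "subspace L \<Longrightarrow> x \<in> L \<Longrightarrow> orth_proj L x = x"
  by (rule orth_proj_unique) auto

lemma linear_orth_proj: "subspace L \<Longrightarrow> linear (orth_proj L)"
  by (rule linearI; rule orth_proj_unique)
     (auto simp: subspace_add subspace_scale orth_proj_in orth_proj_inner inner_simps)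

lemma orth_proj_eq_0_iff: "subspace L \<Longrightarrow> orth_proj L x = 0 \<longleftrightarrow> (\<forall>l\<in>L. l \<bullet> x = 0)"
  by (metis orth_proj_inner orth_proj_unique subspace_0 inner_zero_right)

lemma norm_orth_proj_le: "subspace L \<Longrightarrow> norm (orth_proj L x) \<le> norm x"
proof -
  assume L: "subspace L"
  let ?p = "orth_proj L x"
  have "norm ?p * norm ?p = ?p \<bullet> ?p" by (simp add: dot_square_norm power2_eq_square)
  also have "\<dots> = ?p \<bullet> x" using L by (intro orth_proj_inner orth_proj_in)
  also have "\<dots> \<le> norm ?p * norm x" by (rule norm_cauchy_schwarz)
  finally show ?thesis by (cases "norm ?p = 0") (auto simp: mult_le_cancel_left)
qed

text \<open>Injectivity of the adjoint of \<open>A\<close> on \<open>L\<close> is surjectivity of \<open>A\<close> followed by the projection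
  onto \<open>L\<close>.\<close>

lemma orth_proj_right_inverse:
  fixes A :: "'a::euclidean_space \<Rightarrow> 'b::euclidean_space"
  assumes A: "linear A" and L: "subspace L" and inj: "\<forall>l\<in>L. adjoint A l = 0 \<longrightarrow> l = 0"
  obtains B where "linear B" "\<And>y. orth_proj L (A (B y)) = orth_proj L y"
proof -
  let ?f = "\<lambda>x. orth_proj L (A x)"
  have f: "linear ?f" using linear_compose[OF A linear_orth_proj[OF L]] by (simp add: comp_def)
  have R: "subspace (range ?f)" by (rule linear_subspace_image[OF f subspace_UNIV])
  have "range ?f = L"
  proof (rule ccontr)
    assume "range ?f \<noteq> L"
    moreover have "range ?f \<subseteq> L" using orth_proj_in[OF L] by blast
    ultimately have "span (range ?f) \<subset> span L"
      unfolding span_eq_iff[THEN iffD2, OF R] span_eq_iff[THEN iffD2, OF L] by blast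
    then obtain l where l: "l \<noteq> 0" "l \<in> span L" "\<And>y. y \<in> span (range ?f) \<Longrightarrow> orthogonal l y"
      by (rule orthogonal_to_subspace_exists_gen) (rule that)
    have lL: "l \<in> L" using l(2) span_eq_iff[THEN iffD2, OF L] by simp
    have "adjoint A l = 0"
    proof (rule vector_eq_rdot[THEN iffD1], rule allI)
      fix x
      have "orthogonal l (?f x)" by (rule l(3)[OF span_base]) simp
      then have "l \<bullet> A x = 0" using orth_proj_inner[OF L lL] by (simp add: orthogonal_def)
      then show "adjoint A l \<bullet> x = 0 \<bullet> x"
        using adjoint_works[OF A, of x l] by (simp add: inner_commute)
    qed
    then show False using inj lL l(1) by blast
  qed
  obtain g where g: "linear g" "\<And>y. y \<in> range ?f \<Longrightarrow> ?f (g y) = y"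
    using real_vector.linear_exists_right_inverse_on[OF f[folded linear_def] real_vector.subspace_UNIV] 
    unfolding linear_def by blast
  show ?thesis
  \<comment> \<open>The right inverse is available only on the range, which is \<open>L\<close>;
    composing it with the projection makes the identity hold for every \<open>y\<close>.\<close>
  proof (rule that[of "\<lambda>y. g (orth_proj L y)"])
    show "linear (\<lambda>y. g (orth_proj L y))"
      using linear_compose[OF linear_orth_proj[OF L] g(1)] by (simp add: comp_def)
    show "orth_proj L (A (g (orth_proj L y))) = orth_proj L y" for y
      by (rule g(2)) (use \<open>range ?f = L\<close> orth_proj_in[OF L] in blast)
  qed
qed

section \<open>Smooth maps whose derivative is surjective onto a subspace\<close>

text \<open>With a right inverse \<open>B\<close> bounded by \<open>b\<close>, pairing
  \<open>l\<close> with \<open>D x0 (B l)\<close> reproduces the square of \<open>norm l\<close>.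
  Replacing \<open>x0\<close> by an \<open>x\<close> whose derivative differs by less than
  \<open>1 / (2 * b)\<close> loses at most half of it, and what remains is at most
  \<open>b * norm l\<close> times the norm of the adjoint image. Hence the constant
  \<open>1 / (2 * b)\<close>.\<close>

lemma adjoint_bounded_below_near:
  fixes D :: "'c::metric_space \<Rightarrow> 'a::euclidean_space \<Rightarrow>\<^sub>L 'b::euclidean_space"
  assumes D: "isCont D x0" and L: "subspace L"
    and inj: "\<forall>l\<in>L. adjoint (D x0) l = 0 \<longrightarrow> l = 0"
  obtains c \<delta> where "c > 0" "\<delta> > 0"
    "\<And>x l. dist x x0 < \<delta> \<Longrightarrow> l \<in> L \<Longrightarrow> c * norm l \<le> norm (adjoint (D x) l)"
proof -
  have lin: "linear (blinfun_apply (D x))" for x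
    by (rule bounded_linear.linear[OF blinfun.bounded_linear_right])
  obtain B where B: "linear B" "\<And>y. orth_proj L (D x0 (B y)) = orth_proj L y"
    by (rule orth_proj_right_inverse[OF lin[of x0] L inj]) (rule that)
  obtain b where b: "b > 0" "\<And>y. norm (B y) \<le> b * norm y"
    by (rule linear_bounded_pos[OF B(1)]) (rule that)
  obtain \<delta> where \<delta>: "\<delta> > 0" "\<And>x. dist x x0 < \<delta> \<Longrightarrow> dist (D x) (D x0) < 1 / (2 * b)"
    using D b(1) unfolding continuous_at_eps_delta by (metis divide_pos_pos zero_less_mult_iff zero_less_numeral zero_less_one)
  have "1 / (2 * b) * norm l \<le> norm (adjoint (D x) l)" if x: "dist x x0 < \<delta>" and l: "l \<in> L" for x l
  proof -
    let ?E = "D x0 - D x"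
    have "norm l * norm l = l \<bullet> l" by (simp add: dot_square_norm power2_eq_square)
    also have "\<dots> = l \<bullet> D x0 (B l)"
      using orth_proj_inner[OF L l] B(2)[of l] by metis
    also have "\<dots> = l \<bullet> ?E (B l) + l \<bullet> D x (B l)"
      by (simp add: blinfun.diff_left inner_diff_right)
    also have "l \<bullet> D x (B l) = B l \<bullet> adjoint (D x) l"
      using adjoint_works[OF lin] by (simp add: inner_commute)
    also have "B l \<bullet> adjoint (D x) l \<le> (b * norm l) * norm (adjoint (D x) l)"
      by (rule order_trans[OF norm_cauchy_schwarz mult_right_mono[OF b(2)]]) simp
    also have "l \<bullet> ?E (B l) \<le> norm l * (1 / (2 * b) * (b * norm l))"
    proof -
      have "norm (?E (B l)) \<le> norm ?E * norm (B l)" by (rule norm_blinfun)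
      also have "\<dots> \<le> 1 / (2 * b) * (b * norm l)"
        using \<delta>(2)[OF x] b(1) by (intro mult_mono b) (auto simp: dist_norm norm_minus_commute)
      finally show ?thesis
        by (intro order_trans[OF norm_cauchy_schwarz mult_left_mono]) auto
    qed
    finally have "norm l * norm l \<le> norm l * (1 / (2 * b) * (b * norm l)) + b * norm l * norm (adjoint (D x) l)"
      by simp
    moreover have half: "1 / (2 * b) * (b * norm l) = norm l / 2" using b(1) by simp
    ultimately have "norm l * (norm l / 2) \<le> norm l * (b * norm (adjoint (D x) l))"
      unfolding half by (simp add: algebra_simps)
    then have "l = 0 \<or> norm l / 2 \<le> b * norm (adjoint (D x) l)"
      by (cases "l = 0") auto
    then show ?thesis using b(1) by (auto simp: field_simps)
  qed
  then show ?thesis using that[of "1 / (2 * b)" \<delta>] b(1) \<delta>(1) by auto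
qed

text \<open>The contraction is the simplified Newton iteration in the preimage variable \<open>\<eta>\<close>, where
  \<open>B\<close> is a right inverse of the projected derivative at the reference point.\<close>

lemma metric_regularity:
  fixes \<Phi> :: "'a::euclidean_space \<Rightarrow> 'b::euclidean_space"
  assumes V: "open V" "x0 \<in> V" and der: "\<And>x. x \<in> V \<Longrightarrow> (\<Phi> has_derivative blinfun_apply (D x)) (at x)"
    and D: "isCont D x0" and L: "subspace L"
    and inj: "\<forall>l\<in>L. adjoint (D x0) l = 0 \<longrightarrow> l = 0"
  obtains \<kappa> \<delta> where "\<kappa> > 0" "\<delta> > 0"
    "\<And>x y. dist x x0 < \<delta> \<Longrightarrow> norm (orth_proj L (\<Phi> x - y)) < \<delta> \<Longrightarrow>
       \<exists>x'\<in>V. norm (x' - x) \<le> \<kappa> * norm (orth_proj L (\<Phi> x - y)) \<and> orth_proj L (\<Phi> x') = orth_proj L y"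
proof -
  have lin: "linear (blinfun_apply (D x))" for x
    by (rule bounded_linear.linear[OF blinfun.bounded_linear_right])
  let ?P = "orth_proj L"
  have P: "linear ?P" "bounded_linear ?P"
    using linear_orth_proj[OF L] linear_conv_bounded_linear by auto
  obtain B where B: "linear B" "\<And>y. ?P (D x0 (B y)) = ?P y"
    by (rule orth_proj_right_inverse[OF lin[of x0] L inj]) (rule that)
  have Bb: "bounded_linear B" using B(1) linear_conv_bounded_linear by blast
  obtain b where b: "b > 0" "\<And>y. norm (B y) \<le> b * norm y"
    by (rule linear_bounded_pos[OF B(1)]) (rule that)
  have "\<forall>\<^sub>F x in nhds x0. x \<in> V" using V by (rule eventually_nhds_in_open)
  moreover have "\<forall>\<^sub>F x in nhds x0. dist (D x) (D x0) < 1 / (2 * b)"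
    using D b(1) unfolding isCont_def tendsto_at_iff_tendsto_nhds by (auto intro: tendstoD)
  ultimately have "\<forall>\<^sub>F x in nhds x0. x \<in> V \<and> dist (D x) (D x0) < 1 / (2 * b)"
    by (rule eventually_conj)
  then obtain r where r: "r > 0" "\<And>x. dist x x0 < r \<Longrightarrow> x \<in> V \<and> dist (D x) (D x0) < 1 / (2 * b)"
    unfolding eventually_nhds_metric by blast
  \<comment> \<open>The iterates move \<open>x\<close> by at most \<open>b * (2 * \<rho>)\<close>,
    and \<rho> is below \<delta>; together with \<open>dist x x0 < \<delta>\<close> they stay within
    \<open>\<delta> * (1 + 2 * b) = r\<close> of \<open>x0\<close>.\<close>
  define \<delta> where "\<delta> = r / (1 + 2 * b)"
  have \<delta>: "\<delta> > 0" "\<delta> * (1 + 2 * b) = r" using r(1) b(1) by (auto simp: \<delta>_def)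
  have "\<exists>x'\<in>V. norm (x' - x) \<le> (2 * b) * norm (?P (\<Phi> x - y)) \<and> ?P (\<Phi> x') = ?P y"
    if x: "dist x x0 < \<delta>" and y: "norm (?P (\<Phi> x - y)) < \<delta>" for x y
  proof -
    define \<rho> where "\<rho> = norm (?P (\<Phi> x - y))"
    define T where "T = (\<lambda>\<eta>. ?P \<eta> - ?P (\<Phi> (x + B \<eta>) - y))"
    \<comment> \<open>The contraction factor is 1/2 and \<open>norm (T 0) = \<rho>\<close>, so the
      ball of radius \<open>2 * \<rho>\<close> is mapped into itself.\<close>
    let ?S = "cball (0::'b) (2 * \<rho>)"
    have near: "dist (x + B \<eta>) x0 < r" if "\<eta> \<in> ?S" for \<eta>
    proof -
      have "norm (B \<eta>) \<le> b * (2 * \<rho>)" using b(2)[of \<eta>] that b(1)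
        by (meson mem_cball_0 mult_left_mono order.trans less_imp_le)
      also have "\<dots> \<le> b * (2 * \<delta>)" using y b(1) unfolding \<rho>_def by (intro mult_left_mono) auto
      finally have "dist (x + B \<eta>) x0 < \<delta> + b * (2 * \<delta>)"
        using x norm_triangle_ineq[of "x - x0" "B \<eta>"] by (simp add: dist_norm algebra_simps)
      then show ?thesis using \<delta>(2) by (simp add: algebra_simps)
    qed
    have derT: "(T has_derivative (\<lambda>k. ?P k - ?P (D (x + B \<eta>) (B k)))) (at \<eta> within ?S)" if "\<eta> \<in> ?S" for \<eta>
    proof -
      have "((\<lambda>\<eta>. x + B \<eta>) has_derivative B) (at \<eta>)"
        by (auto intro!: derivative_eq_intros bounded_linear_imp_has_derivative Bb)
      moreover have "(\<Phi> has_derivative blinfun_apply (D (x + B \<eta>))) (at (x + B \<eta>))"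
        using r(2)[OF near[OF that]] by (intro der) auto
      ultimately have "((\<lambda>\<eta>. \<Phi> (x + B \<eta>)) has_derivative (\<lambda>k. D (x + B \<eta>) (B k))) (at \<eta>)"
        using has_derivative_compose by blast
      then have "((\<lambda>\<eta>. \<Phi> (x + B \<eta>) - y) has_derivative (\<lambda>k. D (x + B \<eta>) (B k))) (at \<eta>)"
        by (auto intro!: derivative_eq_intros)
      then have "((\<lambda>\<eta>. ?P (\<Phi> (x + B \<eta>) - y)) has_derivative (\<lambda>k. ?P (D (x + B \<eta>) (B k)))) (at \<eta>)"
        by (rule bounded_linear.has_derivative[OF P(2)])
      then have "(T has_derivative (\<lambda>k. ?P k - ?P (D (x + B \<eta>) (B k)))) (at \<eta>)"
        unfolding T_def
        by (intro has_derivative_diff bounded_linear_imp_has_derivative[OF P(2)])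
      then show ?thesis by (rule has_derivative_at_withinI)
    qed
    have bound: "onorm (\<lambda>k. ?P k - ?P (D (x + B \<eta>) (B k))) \<le> 1 / 2" if "\<eta> \<in> ?S" for \<eta>
    proof (rule onorm_le)
      fix k
      let ?E = "D x0 - D (x + B \<eta>)"
      have "?P k - ?P (D (x + B \<eta>) (B k)) = ?P (?E (B k))"
        unfolding B(2)[of k, symmetric] by (simp add: linear_diff[OF P(1)] blinfun.diff_left)
      also have "norm (?P (?E (B k))) \<le> norm (?E (B k))" by (rule norm_orth_proj_le[OF L])
      also have "\<dots> \<le> norm ?E * norm (B k)" by (rule norm_blinfun)
      also have "\<dots> \<le> 1 / (2 * b) * (b * norm k)"
        using r(2)[OF near[OF that]] b(1) by (intro mult_mono b) (auto simp: dist_norm norm_minus_commute)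
      also have "\<dots> = 1 / 2 * norm k" using b(1) by simp
      finally show "norm (?P k - ?P (D (x + B \<eta>) (B k))) \<le> 1 / 2 * norm k" .
    qed
    have lip: "dist (T \<eta>) (T \<zeta>) \<le> 1 / 2 * dist \<eta> \<zeta>" if "\<eta> \<in> ?S" "\<zeta> \<in> ?S" for \<eta> \<zeta>
      unfolding dist_norm using that
      by (intro differentiable_bound[OF convex_cball derT bound]) auto
    have "\<rho> \<ge> 0" by (simp add: \<rho>_def)
    have T0: "norm (T 0) = \<rho>"
      by (simp add: T_def \<rho>_def linear_0[OF P(1)] linear_0[OF B(1)])
    have self: "T ` ?S \<subseteq> ?S"
    proof safe
      fix \<eta> assume \<eta>: "\<eta> \<in> ?S"
      have "dist (T \<eta>) (T 0) \<le> 1 / 2 * dist \<eta> 0" using \<eta> \<open>\<rho> \<ge> 0\<close> by (intro lip) auto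
      then have "norm (T \<eta> - T 0) \<le> \<rho>" using \<eta> by (simp add: dist_norm)
      then have "norm (T \<eta>) \<le> 2 * \<rho>" using T0 norm_triangle_sub[of "T \<eta>" "T 0"] by simp
      then show "T \<eta> \<in> ?S" by simp
    qed
    have "\<exists>!\<eta>\<in>?S. T \<eta> = \<eta>"
      by (rule Banach_fix[where c = "1 / 2"]) (use lip self \<open>\<rho> \<ge> 0\<close> in \<open>auto simp: complete_eq_closed\<close>)
    then obtain \<eta> where \<eta>: "\<eta> \<in> ?S" "T \<eta> = \<eta>" by blast
    \<comment> \<open>The values of \<open>T\<close> lie in \<open>L\<close>, hence so does its
      fixed point; the projection then fixes \<eta>, and the fixed point equation says that the
      projected residual is zero.\<close>
    have "\<eta> \<in> L" using \<eta>(2) unfolding T_def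
      by (metis L orth_proj_in subspace_diff)
    then have "?P (\<Phi> (x + B \<eta>) - y) = 0" using \<eta>(2) orth_proj_id[OF L] by (simp add: T_def)
    then have "?P (\<Phi> (x + B \<eta>)) = ?P y" by (simp add: linear_diff[OF P(1)])
    moreover have "norm (x + B \<eta> - x) \<le> (2 * b) * \<rho>"
      using order_trans[OF b(2)[of \<eta>] mult_left_mono[of "norm \<eta>" "2 * \<rho>" b]] \<eta>(1) b(1) by (simp add: mult_ac)
    moreover have "x + B \<eta> \<in> V" using r(2)[OF near[OF \<eta>(1)]] by simp
    ultimately show ?thesis unfolding \<rho>_def by blast
  qed
  then show ?thesis using that[of "2 * b" \<delta>] b(1) \<delta>(1) by auto
qed

text \<open>The base point \<open>x\<close> moves while the quadratic form stays frozen at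
  \<open>x0\<close>, so one estimate covers a whole filter of base points. The mean value inequality
  is applied twice: to \<open>D\<close> minus the linear map \<open>D2 x0\<close>, whose derivative
  is smaller than \<epsilon> near \<open>x0\<close>, and then along the segment from
  \<open>x\<close> to \<open>x + u\<close>.\<close>

lemma uniform_second_order_taylor:
  fixes \<Phi> :: "'a::euclidean_space \<Rightarrow> 'b::euclidean_space"
    and D :: "'a \<Rightarrow> 'a \<Rightarrow>\<^sub>L 'b" and D2 :: "'a \<Rightarrow> 'a \<Rightarrow>\<^sub>L 'a \<Rightarrow>\<^sub>L 'b"
  assumes V: "open V" "x0 \<in> V" and der: "\<And>x. x \<in> V \<Longrightarrow> (\<Phi> has_derivative blinfun_apply (D x)) (at x)"
    and der2: "\<And>x. x \<in> V \<Longrightarrow> (D has_derivative blinfun_apply (D2 x)) (at x)"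
    and cont: "isCont D2 x0" and \<epsilon>: "\<epsilon> > 0"
  obtains \<delta> where "\<delta> > 0"
    "\<And>x u. dist x x0 < \<delta> \<Longrightarrow> norm u < \<delta> \<Longrightarrow>
       norm (\<Phi> (x + u) - \<Phi> x - D x u - (1 / 2) *\<^sub>R D2 x0 u u) \<le> \<epsilon> * (norm u)\<^sup>2"
proof -
  have "\<forall>\<^sub>F x in nhds x0. x \<in> V" using V by (rule eventually_nhds_in_open)
  moreover have "\<forall>\<^sub>F x in nhds x0. dist (D2 x) (D2 x0) < \<epsilon>"
    using cont \<epsilon> unfolding isCont_def tendsto_at_iff_tendsto_nhds by (auto intro: tendstoD)
  ultimately have "\<forall>\<^sub>F x in nhds x0. x \<in> V \<and> dist (D2 x) (D2 x0) < \<epsilon>"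
    by (rule eventually_conj)
  then obtain r where r: "r > 0" "\<And>x. dist x x0 < r \<Longrightarrow> x \<in> V \<and> dist (D2 x) (D2 x0) < \<epsilon>"
    unfolding eventually_nhds_metric by blast
  have "norm (\<Phi> (x + u) - \<Phi> x - D x u - (1 / 2) *\<^sub>R D2 x0 u u) \<le> \<epsilon> * (norm u)\<^sup>2"
    if x: "dist x x0 < r / 2" and u: "norm u < r / 2" for x u
  proof -
    have near: "dist (x + s *\<^sub>R u) x0 < r" if "0 \<le> s" "s \<le> 1" for s
    proof -
      have "norm (s *\<^sub>R u) \<le> norm u" using that by (simp add: mult_left_le_one_le)
      moreover have "dist (x + s *\<^sub>R u) x0 \<le> dist x x0 + norm (s *\<^sub>R u)"
        using norm_triangle_ineq[of "x - x0" "s *\<^sub>R u"] by (simp add: dist_norm algebra_simps)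
      ultimately show ?thesis using x u by linarith
    qed
    have step: "norm (D (x + s *\<^sub>R u) - D x - s *\<^sub>R D2 x0 u) \<le> \<epsilon> * norm u" if s: "0 \<le> s" "s \<le> 1" for s
    proof -
      have 1: "norm ((D (x + s *\<^sub>R u) - D2 x0 (x + s *\<^sub>R u)) - (D x - D2 x0 x)) \<le> \<epsilon> * norm (x + s *\<^sub>R u - x)"
      proof (rule differentiable_bound[of "ball x0 r" "\<lambda>x. D x - D2 x0 x" "\<lambda>x. blinfun_apply (D2 x - D2 x0)"])
        fix \<xi> assume "\<xi> \<in> ball x0 r"
        then have \<xi>: "\<xi> \<in> V" "dist (D2 \<xi>) (D2 x0) < \<epsilon>" using r(2)[of \<xi>] by (auto simp: dist_commute)
        have "((\<lambda>x. D x - D2 x0 x) has_derivative (\<lambda>h. D2 \<xi> h - D2 x0 h)) (at \<xi>)"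
          by (intro has_derivative_diff der2 \<xi> bounded_linear_imp_has_derivative blinfun.bounded_linear_right)
        then show "((\<lambda>x. D x - D2 x0 x) has_derivative blinfun_apply (D2 \<xi> - D2 x0)) (at \<xi> within ball x0 r)"
          unfolding minus_blinfun.rep_eq by (rule has_derivative_at_withinI)
        show "onorm (blinfun_apply (D2 \<xi> - D2 x0)) \<le> \<epsilon>"
          using \<xi>(2) by (simp add: norm_blinfun.rep_eq[symmetric] dist_norm)
      qed (use near[of s] near[of 0] s in \<open>auto simp: dist_commute\<close>)
      have 2: "norm (x + s *\<^sub>R u - x) \<le> norm u" using s by (simp add: mult_left_le_one_le)
      have 3: "(D (x + s *\<^sub>R u) - D2 x0 (x + s *\<^sub>R u)) - (D x - D2 x0 x) = D (x + s *\<^sub>R u) - D x - s *\<^sub>R D2 x0 u"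
        by (simp add: blinfun.add_right blinfun.scaleR_right)
      show ?thesis
        unfolding 3[symmetric] by (rule order_trans[OF 1 mult_left_mono[OF 2]]) (use \<epsilon> in simp)
    qed
    \<comment> \<open>The increment of this function over the unit interval is the Taylor remainder,
      and its derivative at \<open>s\<close> is the quantity bounded in \<open>step\<close>, applied
      to \<open>u\<close>.\<close>
    define \<psi> where "\<psi> = (\<lambda>s. \<Phi> (x + s *\<^sub>R u) - s *\<^sub>R D x u - (s\<^sup>2 / 2) *\<^sub>R D2 x0 u u)"
    have "norm (\<psi> 1 - \<psi> 0) \<le> (\<epsilon> * (norm u)\<^sup>2) * norm (1 - 0 :: real)"
    proof (rule differentiable_bound[of "{0..1}" \<psi> "\<lambda>s h. h *\<^sub>R ((D (x + s *\<^sub>R u) - D x - s *\<^sub>R D2 x0 u) u)"])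
      fix s :: real assume s: "s \<in> {0..1}"
      have "((\<lambda>s. x + s *\<^sub>R u) has_derivative (\<lambda>h. h *\<^sub>R u)) (at s)"
        by (auto intro!: derivative_eq_intros)
      moreover have "(\<Phi> has_derivative blinfun_apply (D (x + s *\<^sub>R u))) (at (x + s *\<^sub>R u))"
        using r(2)[OF near[of s]] s by (intro der) auto
      ultimately have "((\<lambda>s. \<Phi> (x + s *\<^sub>R u)) has_derivative (\<lambda>h. D (x + s *\<^sub>R u) (h *\<^sub>R u))) (at s)"
        using has_derivative_compose by blast
      moreover have "((\<lambda>s. s *\<^sub>R D x u) has_derivative (\<lambda>h. h *\<^sub>R D x u)) (at s)"
        by (auto intro!: derivative_eq_intros)
      moreover have "((\<lambda>s. (s\<^sup>2 / 2) *\<^sub>R D2 x0 u u) has_derivative (\<lambda>h. (h * s) *\<^sub>R D2 x0 u u)) (at s)"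
        by (auto intro!: derivative_eq_intros simp: mult_ac)
      ultimately have "(\<psi> has_derivative (\<lambda>h. D (x + s *\<^sub>R u) (h *\<^sub>R u) - h *\<^sub>R D x u - (h * s) *\<^sub>R D2 x0 u u)) (at s)"
        unfolding \<psi>_def by (intro has_derivative_diff)
      moreover have "(\<lambda>h. D (x + s *\<^sub>R u) (h *\<^sub>R u) - h *\<^sub>R D x u - (h * s) *\<^sub>R D2 x0 u u) =
          (\<lambda>h. h *\<^sub>R ((D (x + s *\<^sub>R u) - D x - s *\<^sub>R D2 x0 u) u))"
        by (simp add: fun_eq_iff blinfun.diff_left blinfun.add_left blinfun.scaleR_left blinfun.scaleR_right algebra_simps)
      ultimately show "(\<psi> has_derivative (\<lambda>h. h *\<^sub>R ((D (x + s *\<^sub>R u) - D x - s *\<^sub>R D2 x0 u) u))) (at s within {0..1})"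
        by (simp add: has_derivative_at_withinI)
      show "onorm (\<lambda>h. h *\<^sub>R ((D (x + s *\<^sub>R u) - D x - s *\<^sub>R D2 x0 u) u)) \<le> \<epsilon> * (norm u)\<^sup>2"
      proof (rule onorm_le)
        fix h :: real
        have "norm ((D (x + s *\<^sub>R u) - D x - s *\<^sub>R D2 x0 u) u) \<le> (\<epsilon> * norm u) * norm u"
          by (rule order_trans[OF norm_blinfun mult_right_mono[OF step]]) (use s in auto)
        then have "\<bar>h\<bar> * norm ((D (x + s *\<^sub>R u) - D x - s *\<^sub>R D2 x0 u) u) \<le> \<bar>h\<bar> * (\<epsilon> * norm u * norm u)"
          by (rule mult_left_mono) simp
        then show "norm (h *\<^sub>R ((D (x + s *\<^sub>R u) - D x - s *\<^sub>R D2 x0 u) u)) \<le> \<epsilon> * (norm u)\<^sup>2 * norm h"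
          by (simp add: power2_eq_square mult_ac)
      qed
    qed auto
    moreover have "\<psi> 1 - \<psi> 0 = \<Phi> (x + u) - \<Phi> x - D x u - (1 / 2) *\<^sub>R D2 x0 u u"
      by (simp add: \<psi>_def)
    ultimately show ?thesis by simp
  qed
  then show ?thesis using that[of "r / 2"] r(1) by auto
qed

section \<open>The subdifferential chain rule\<close>

lemma has_derivative_imp_quotient_tendsto:
  assumes f: "(f has_derivative f') (at x)"
    and t: "\<forall>\<^sub>F k in F. t k > 0" "(t \<longlongrightarrow> 0) F" and w: "(ws \<longlongrightarrow> w) F"
  shows "((\<lambda>k. (f (x + t k *\<^sub>R ws k) - f x) /\<^sub>R t k) \<longlongrightarrow> f' w) F"
proof -
  have lin: "bounded_linear f'" using f by (rule has_derivative_bounded_linear)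
  \<comment> \<open>Division by zero gives \<open>q x = 0\<close>, so \<open>q\<close> is continuous
    at \<open>x\<close> itself and may be evaluated at indices with \<open>ws k = 0\<close>.\<close>
  define q where "q = (\<lambda>y. norm (f y - f x - f' (y - x)) / norm (y - x))"
  have "(q \<longlongrightarrow> 0) (at x)"
    using f by (simp add: has_derivative_iff_norm q_def)
  then have q: "(q \<longlongrightarrow> q x) (nhds x)"
    using tendsto_at_iff_tendsto_nhds[of q x] by (simp add: q_def)
  have "((\<lambda>k. x + t k *\<^sub>R ws k) \<longlongrightarrow> x + 0 *\<^sub>R w) F" by (intro tendsto_intros t w)
  then have "((\<lambda>k. q (x + t k *\<^sub>R ws k)) \<longlongrightarrow> q x) F"
    by (intro filterlim_compose[OF q]) simp
  then have "((\<lambda>k. q (x + t k *\<^sub>R ws k) * norm (ws k)) \<longlongrightarrow> 0 * norm w) F"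
    by (intro tendsto_intros w) (simp add: q_def)
  moreover have "\<forall>\<^sub>F k in F. q (x + t k *\<^sub>R ws k) * norm (ws k) =
      norm ((f (x + t k *\<^sub>R ws k) - f x) /\<^sub>R t k - f' (ws k))"
    using t(1)
  proof eventually_elim
    case (elim k)
    let ?u = "f (x + t k *\<^sub>R ws k) - f x"
    have "?u /\<^sub>R t k - f' (ws k) = (?u - f' (t k *\<^sub>R ws k)) /\<^sub>R t k"
      using elim by (simp add: linear_simps(5)[OF lin] scaleR_right_diff_distrib)
    moreover have "norm ((?u - f' (t k *\<^sub>R ws k)) /\<^sub>R t k) = norm (?u - f' (t k *\<^sub>R ws k)) / t k"
      using elim by (simp add: divide_inverse_commute)
    ultimately show ?case
      using elim by (cases "ws k = 0") (auto simp: q_def linear_simps(3)[OF lin])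
  qed
  ultimately have "((\<lambda>k. norm ((f (x + t k *\<^sub>R ws k) - f x) /\<^sub>R t k - f' (ws k))) \<longlongrightarrow> 0) F"
    by (simp add: tendsto_cong)
  then have "((\<lambda>k. (f (x + t k *\<^sub>R ws k) - f x) /\<^sub>R t k - f' (ws k)) \<longlongrightarrow> 0) F"
    by (rule tendsto_norm_zero_cancel)
  from tendsto_add[OF this bounded_linear.tendsto[OF lin w]] show ?thesis by simp
qed

lemma norm_adjoint_blinfun_le:
  fixes A :: "'a::euclidean_space \<Rightarrow>\<^sub>L 'b::euclidean_space"
  shows "norm (adjoint A l) \<le> norm A * norm l"
proof -
  let ?v = "adjoint A l"
  have "norm ?v * norm ?v = ?v \<bullet> ?v" by (simp add: dot_square_norm power2_eq_square)
  also have "\<dots> = A ?v \<bullet> l"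
    by (rule adjoint_works[OF bounded_linear.linear[OF blinfun.bounded_linear_right]])
  also have "\<dots> \<le> norm (A ?v) * norm l" by (rule norm_cauchy_schwarz)
  also have "\<dots> \<le> (norm A * norm ?v) * norm l" by (intro mult_right_mono norm_blinfun) simp
  finally have "norm ?v * norm ?v \<le> norm ?v * (norm A * norm l)" by (simp add: mult_ac)
  then show ?thesis by (cases "?v = 0") auto
qed

section \<open>The composite near the reference point and its first-order calculus\<close>

locale smooth_composite =
  fixes \<phi> :: "'a::euclidean_space \<Rightarrow> ereal" and g :: "'b::euclidean_space \<Rightarrow> ereal"
    and \<Phi> :: "'a \<Rightarrow> 'b" and D :: "'a \<Rightarrow> 'a \<Rightarrow>\<^sub>L 'b" and D2 :: "'a \<Rightarrow> 'a \<Rightarrow>\<^sub>L 'a \<Rightarrow>\<^sub>L 'b" and V :: "'a set"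
  assumes open_V: "open V"
    and poly: "polyhedral_function g"
    and comp: "\<And>x. x \<in> V \<Longrightarrow> \<phi> x = g (\<Phi> x)"
    and der: "\<And>x. x \<in> V \<Longrightarrow> (\<Phi> has_derivative blinfun_apply (D x)) (at x)"
    and der2: "\<And>x. x \<in> V \<Longrightarrow> (D has_derivative blinfun_apply (D2 x)) (at x)"
    and cont2: "continuous_on V D2"
begin

abbreviation Dadj where "Dadj x \<equiv> adjoint (blinfun_apply (D x))"

abbreviation Lsp where "Lsp x \<equiv> direction_space (subdifferential g (\<Phi> x))"

text \<open>The form in which SOQC enters all later arguments. It is a condition on the point and
  mentions no multiplier, so it can be verified again at nearby points.\<close>

definition nondegenerate where
  "nondegenerate x \<longleftrightarrow> (\<forall>l\<in>Lsp x. Dadj x l = 0 \<longrightarrow> l = 0)"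

lemma lin_D: "linear (blinfun_apply (D x))"
  by (rule bounded_linear.linear[OF blinfun.bounded_linear_right])

lemma inner_Dadj: "Dadj x l \<bullet> w = l \<bullet> D x w"
  using adjoint_works[OF lin_D, of w x l] by (simp add: inner_commute)

lemma linear_Dadj: "linear (Dadj x)"
  by (rule adjoint_linear[OF lin_D])

lemma Dadj_eqI: "(\<And>w. v \<bullet> w = l \<bullet> D x w) \<Longrightarrow> Dadj x l = v"
  by (rule vector_eq_rdot[THEN iffD1]) (simp add: inner_Dadj)

lemma isCont_D: "x \<in> V \<Longrightarrow> isCont D x"
  by (rule has_derivative_continuous[OF der2])

lemma isCont_D2: "x \<in> V \<Longrightarrow> isCont D2 x"
  using cont2 open_V continuous_on_eq_continuous_at by blast

lemma isCont_\<Phi>: "x \<in> V \<Longrightarrow> isCont \<Phi> x"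
  by (rule has_derivative_continuous[OF der])

lemma tendsto_\<Phi>: "x \<in> V \<Longrightarrow> (\<Phi> \<longlongrightarrow> \<Phi> x) (nhds x)"
  using isCont_\<Phi> by (simp add: isCont_def tendsto_at_iff_tendsto_nhds)

lemma tendsto_D: "x \<in> V \<Longrightarrow> (D \<longlongrightarrow> D x) (nhds x)"
  using isCont_D by (simp add: isCont_def tendsto_at_iff_tendsto_nhds)

lemma eventually_V: "x \<in> V \<Longrightarrow> \<forall>\<^sub>F y in nhds x. y \<in> V"
  by (rule eventually_nhds_in_open[OF open_V])

lemma eventually_\<Phi>_ball: "x \<in> V \<Longrightarrow> e > 0 \<Longrightarrow> \<forall>\<^sub>F y in nhds x. dist (\<Phi> y) (\<Phi> x) < e"
  using tendsto_\<Phi> by (rule tendstoD)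

text \<open>The easy half of the chain rule: the subgradient inequality of \<open>g\<close>, divided
  by \<open>t k\<close> along points of the epigraph of \<phi>, passes to the limit and shows that
  \<open>(Dadj x l, - 1)\<close> is even a regular normal.\<close>

lemma adjoint_image_subset_subdifferential:
  assumes x: "x \<in> V" and l: "l \<in> subdifferential g (\<Phi> x)"
  shows "Dadj x l \<in> subdifferential \<phi> x"
proof -
  obtain a where a: "g (\<Phi> x) = ereal a" using subdifferential_imp_finite[OF l] by blast
  have "(Dadj x l, - 1) \<in> regular_normal_cone (epi \<phi>) (x, a)"
    unfolding regular_normal_cone_def polar_cone_def
  proof safe
    fix w \<rho> assume "(w, \<rho>) \<in> tangent_cone (epi \<phi>) (x, a)"
    then obtain t us where tu: "\<And>k::nat. t k > (0::real)"
      "\<And>k. (x, a) + t k *\<^sub>R us k \<in> epi \<phi>" "t \<longlonglongrightarrow> 0" "us \<longlonglongrightarrow> (w, \<rho>)"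
      unfolding tangent_cone_iff_seq by blast
    have w: "(\<lambda>k. fst (us k)) \<longlonglongrightarrow> w" and \<rho>: "(\<lambda>k. snd (us k)) \<longlonglongrightarrow> \<rho>"
      using tendsto_fst[OF tu(4)] tendsto_snd[OF tu(4)] by auto
    let ?x = "\<lambda>k. x + t k *\<^sub>R fst (us k)"
    have "?x \<longlonglongrightarrow> x + 0 *\<^sub>R w" by (intro tendsto_intros tu w)
    then have "filterlim ?x (nhds x) sequentially" by simp
    then have "\<forall>\<^sub>F k in sequentially. ?x k \<in> V"
      by (rule eventually_compose_filterlim[OF eventually_V[OF x]])
    then have ev: "\<forall>\<^sub>F k in sequentially. l \<bullet> ((\<Phi> (?x k) - \<Phi> x) /\<^sub>R t k) \<le> snd (us k)"
    proof eventually_elim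
      case (elim k)
      have "\<phi> (?x k) \<le> ereal (a + t k * snd (us k))"
        using tu(2)[of k] by (cases "us k") (simp add: epi_def)
      then have "g (\<Phi> (?x k)) \<le> ereal (a + t k * snd (us k))" using comp[OF elim] by simp
      from polyhedral_subgradientD[OF poly l a this]
      have "l \<bullet> (\<Phi> (?x k) - \<Phi> x) \<le> t k * snd (us k)" by simp
      then have "(l \<bullet> (\<Phi> (?x k) - \<Phi> x)) / t k \<le> snd (us k)"
        using tu(1)[of k] by (simp add: pos_divide_le_eq mult.commute)
      then show ?case by (simp add: divide_inverse_commute)
    qed
    have "(\<lambda>k. l \<bullet> ((\<Phi> (?x k) - \<Phi> x) /\<^sub>R t k)) \<longlonglongrightarrow> l \<bullet> D x w"
      by (intro tendsto_intros has_derivative_imp_quotient_tendsto[OF der[OF x]] tu w always_eventually allI)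
    from tendsto_le[OF _ \<rho> this ev] have "l \<bullet> D x w \<le> \<rho>" by simp
    then show "(Dadj x l, - 1) \<bullet> (w, \<rho>) \<le> 0" by (simp add: inner_Dadj)
  qed
  then show ?thesis
    using comp[OF x] a by (intro regular_normal_imp_subdifferential[of _ _ a]) auto
qed

text \<open>The line \<open>x + t *\<^sub>R w\<close> misses the prescribed projected value by o(t),
  since \<open>D x w\<close> is the derivative. Metric regularity repairs this by a displacement of
  the same order, so the curve keeps the tangent \<open>w\<close>.\<close>

lemma curve_through:
  assumes x: "x \<in> V" and L: "subspace L" and inj: "\<forall>l\<in>L. Dadj x l = 0 \<longrightarrow> l = 0"
  obtains c where "\<forall>\<^sub>F t in at_right 0. c t \<in> V \<and> orth_proj L (\<Phi> (c t)) = orth_proj L (\<Phi> x + t *\<^sub>R D x w)"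
    "((\<lambda>t. (c t - x) /\<^sub>R t) \<longlongrightarrow> w) (at_right 0)"
proof -
  let ?P = "orth_proj L"
  obtain \<kappa> \<delta> where \<kappa>: "\<kappa> > 0" and \<delta>: "\<delta> > 0" and
    reg: "\<And>x' y. dist x' x < \<delta> \<Longrightarrow> norm (?P (\<Phi> x' - y)) < \<delta> \<Longrightarrow>
       \<exists>x''\<in>V. norm (x'' - x') \<le> \<kappa> * norm (?P (\<Phi> x' - y)) \<and> ?P (\<Phi> x'') = ?P y"
    by (rule metric_regularity[OF open_V x der isCont_D[OF x] L inj]) (assumption, rule that)
  let ?y = "\<lambda>t. \<Phi> x + t *\<^sub>R D x w"
  let ?R = "\<lambda>t. ?P (\<Phi> (x + t *\<^sub>R w) - ?y t)"
  let ?Q = "\<lambda>t c. c \<in> V \<and> norm (c - (x + t *\<^sub>R w)) \<le> \<kappa> * norm (?R t) \<and> ?P (\<Phi> c) = ?P (?y t)"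
  define c where "c = (\<lambda>t. SOME c. ?Q t c)"
  have pos: "\<forall>\<^sub>F t in at_right (0::real). t > 0" by (rule eventually_at_right_less)
  have t0: "((\<lambda>t. t) \<longlongrightarrow> (0::real)) (at_right 0)" by (rule tendsto_ident_at)
  have "((\<lambda>t. (\<Phi> (x + t *\<^sub>R w) - \<Phi> x) /\<^sub>R t - D x w) \<longlongrightarrow> D x w - D x w) (at_right 0)"
    by (intro tendsto_intros has_derivative_imp_quotient_tendsto[OF der[OF x]] pos t0)
  from bounded_linear.tendsto[OF linear_conv_bounded_linear[THEN iffD1, OF linear_orth_proj[OF L]] this]
  have q: "((\<lambda>t. ?P ((\<Phi> (x + t *\<^sub>R w) - \<Phi> x) /\<^sub>R t - D x w)) \<longlongrightarrow> 0) (at_right 0)"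
    by (simp add: linear_0[OF linear_orth_proj[OF L]])
  have Rt: "?R t = t *\<^sub>R ?P ((\<Phi> (x + t *\<^sub>R w) - \<Phi> x) /\<^sub>R t - D x w)" if "t > 0" for t
  proof -
    have "\<Phi> (x + t *\<^sub>R w) - ?y t = t *\<^sub>R ((\<Phi> (x + t *\<^sub>R w) - \<Phi> x) /\<^sub>R t - D x w)"
      using that by (simp add: scaleR_right_diff_distrib)
    then show ?thesis by (simp only: linear_scale[OF linear_orth_proj[OF L]])
  qed
  have "((\<lambda>t. t *\<^sub>R ?P ((\<Phi> (x + t *\<^sub>R w) - \<Phi> x) /\<^sub>R t - D x w)) \<longlongrightarrow> 0 *\<^sub>R 0) (at_right 0)"
    by (intro tendsto_intros q t0)
  then have "\<forall>\<^sub>F t in at_right 0. norm (t *\<^sub>R ?P ((\<Phi> (x + t *\<^sub>R w) - \<Phi> x) /\<^sub>R t - D x w)) < \<delta>"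
    using tendstoD[OF _ \<delta>] by (force simp: dist_norm)
  moreover have "((\<lambda>t. x + t *\<^sub>R w) \<longlongrightarrow> x + 0 *\<^sub>R w) (at_right 0)" by (intro tendsto_intros t0)
  then have "\<forall>\<^sub>F t in at_right 0. dist (x + t *\<^sub>R w) x < \<delta>"
    using tendstoD[OF _ \<delta>] by force
  ultimately have c: "\<forall>\<^sub>F t in at_right 0. ?Q t (c t)"
    using pos
  proof eventually_elim
    case (elim t)
    then have "norm (?R t) < \<delta>" by (simp only: Rt)
    from reg[OF elim(2) this] show "?Q t (c t)"
      unfolding c_def by (intro someI_ex[of "?Q t"]) blast
  qed
  have "((\<lambda>t. (c t - x) /\<^sub>R t - w) \<longlongrightarrow> 0) (at_right 0)"
  proof (rule Lim_null_comparison)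
    show "((\<lambda>t. \<kappa> * norm (?P ((\<Phi> (x + t *\<^sub>R w) - \<Phi> x) /\<^sub>R t - D x w))) \<longlongrightarrow> 0) (at_right 0)"
      using tendsto_mult_left[OF tendsto_norm[OF q], of \<kappa>] by simp
    show "\<forall>\<^sub>F t in at_right 0. norm ((c t - x) /\<^sub>R t - w) \<le> \<kappa> * norm (?P ((\<Phi> (x + t *\<^sub>R w) - \<Phi> x) /\<^sub>R t - D x w))"
      using c pos
    proof eventually_elim
      case (elim t)
      have "(c t - x) /\<^sub>R t - w = (c t - (x + t *\<^sub>R w)) /\<^sub>R t"
        using elim by (simp add: scaleR_right_diff_distrib scaleR_right_distrib)
      then have "norm ((c t - x) /\<^sub>R t - w) = norm (c t - (x + t *\<^sub>R w)) / t"
        using elim by (simp add: divide_inverse_commute)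
      also have "\<dots> \<le> \<kappa> * norm (?R t) / t" using elim by (intro divide_right_mono) auto
      also have "\<dots> = \<kappa> * norm (?P ((\<Phi> (x + t *\<^sub>R w) - \<Phi> x) /\<^sub>R t - D x w))"
        unfolding Rt[OF elim(2)] using elim(2) by simp
      finally show ?case .
    qed
  qed
  then have "((\<lambda>t. (c t - x) /\<^sub>R t) \<longlongrightarrow> w) (at_right 0)"
    by (simp add: LIM_zero_iff)
  moreover have "\<forall>\<^sub>F t in at_right 0. c t \<in> V \<and> ?P (\<Phi> (c t)) = ?P (?y t)"
    using c by eventually_elim blast
  ultimately show ?thesis by (intro that)
qed

lemma eventually_adjoint_bounded_below:
  assumes "x0 \<in> V" "nondegenerate x0"
  obtains c where "c > 0" "\<forall>\<^sub>F x in nhds x0. \<forall>l\<in>Lsp x0. c * norm l \<le> norm (Dadj x l)"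
proof -
  obtain c \<delta> where c: "c > 0" "\<delta> > 0"
    "\<And>x l. dist x x0 < \<delta> \<Longrightarrow> l \<in> Lsp x0 \<Longrightarrow> c * norm l \<le> norm (Dadj x l)"
    by (rule adjoint_bounded_below_near[OF isCont_D[OF assms(1)] subspace_direction_space
          assms(2)[unfolded nondegenerate_def]]) (rule that)
  have "\<forall>\<^sub>F x in nhds x0. \<forall>l\<in>Lsp x0. c * norm l \<le> norm (Dadj x l)"
    unfolding eventually_nhds_metric using c by blast
  with c(1) show ?thesis by (rule that)
qed

lemma eventually_subdifferential_subset:
  assumes "x0 \<in> V" "l0 \<in> subdifferential g (\<Phi> x0)"
  shows "\<forall>\<^sub>F x in nhds x0. subdifferential g (\<Phi> x) \<subseteq> subdifferential g (\<Phi> x0)"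
proof -
  obtain \<delta> where \<delta>: "\<delta> > 0"
    "\<And>y. dist y (\<Phi> x0) < \<delta> \<Longrightarrow> subdifferential g y \<subseteq> subdifferential g (\<Phi> x0)"
    by (rule polyhedral_subdifferential_mono[OF poly assms(2)]) (rule that)
  show ?thesis
    using eventually_\<Phi>_ball[OF assms(1) \<delta>(1)] by eventually_elim (rule \<delta>(2))
qed

text \<open>The scale \<open>s\<close> stays free because limiting normals arise from regular ones
  whose last coordinate merely tends to -1. If \<open>r\<close> exceeded the value of \<phi>, the
  downward direction would be tangent, contradicting \<open>s > 0\<close>. Every epigraph point
  \<open>(y, b)\<close> of \<open>g\<close> then yields a tangent to the epigraph of \<phi>, and the
  polar inequalities for all these tangents together say that a suitable \<open>l\<close> is a
  subgradient of \<open>g\<close>.\<close>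

lemma eventually_regular_normal:
  assumes x0: "x0 \<in> V" and l0: "l0 \<in> subdifferential g (\<Phi> x0)" and nd: "nondegenerate x0"
  shows "\<forall>\<^sub>F x in nhds x0. \<forall>r v s. (x, r) \<in> epi \<phi> \<longrightarrow> (v, - s) \<in> regular_normal_cone (epi \<phi>) (x, r) \<longrightarrow>
    s > 0 \<longrightarrow> \<phi> x = ereal r \<and> (\<exists>l\<in>subdifferential g (\<Phi> x). Dadj x l = v /\<^sub>R s)"
proof -
  let ?L = "Lsp x0" and ?P = "orth_proj (Lsp x0)"
  have Pl: "linear ?P" by (rule linear_orth_proj) simp
  obtain a0 where a0: "g (\<Phi> x0) = ereal a0" using subdifferential_imp_finite[OF l0] by blast
  obtain \<delta> where \<delta>: "\<delta> > 0"
    and inv: "\<And>y n r. \<forall>m\<in>?L. m \<bullet> n = 0 \<Longrightarrow>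
       norm (y + n - \<Phi> x0) < \<delta> \<Longrightarrow> g y \<le> ereal r \<Longrightarrow> g (y + n) \<le> ereal (r + l0 \<bullet> n)"
    by (rule polyhedral_local_structure[OF poly a0 l0]) (rule that)
  obtain c where c: "c > 0" "\<forall>\<^sub>F x in nhds x0. \<forall>l\<in>?L. c * norm l \<le> norm (Dadj x l)"
    by (rule eventually_adjoint_bounded_below[OF x0 nd])
  show ?thesis
    using c(2) eventually_V[OF x0] eventually_\<Phi>_ball[OF x0 \<delta>]
  proof eventually_elim
    case (elim x)
    have inj: "\<forall>l\<in>?L. Dadj x l = 0 \<longrightarrow> l = 0"
    proof safe
      fix l assume "l \<in> ?L" "Dadj x l = 0"
      with elim(1) have "c * norm l \<le> 0" by fastforce
      then show "l = 0" using c(1) by (simp add: mult_le_0_iff)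
    qed
    show ?case
    proof (intro allI impI)
      fix r v s assume xr: "(x, r) \<in> epi \<phi>" and reg: "(v, - s) \<in> regular_normal_cone (epi \<phi>) (x, r)"
        and s: "s > (0::real)"
      have polar: "v \<bullet> w \<le> s * \<rho>" if "(w, \<rho>) \<in> tangent_cone (epi \<phi>) (x, r)" for w \<rho>
        using reg that unfolding regular_normal_cone_def polar_cone_def by force
      have "g (\<Phi> x) \<le> ereal r" using xr comp[OF elim(2)] by (simp add: epi_def)
      moreover have "g (\<Phi> x) \<noteq> - \<infinity>" using poly by (simp add: polyhedral_function_def)
      ultimately obtain a where a: "g (\<Phi> x) = ereal a" "a \<le> r"
        by (cases "g (\<Phi> x)") auto
      have "a = r"
      proof (rule ccontr)
        assume "a \<noteq> r"
        then have ar: "a < r" using a(2) by simp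
        have "(0, - 1) \<in> tangent_cone (epi \<phi>) (x, r)"
        proof (rule tangent_cone_curveI[where c = "\<lambda>t. (x, r - t)"])
          have "\<forall>\<^sub>F t in at_right (0::real). 0 < t \<and> t < r - a"
            by (rule eventually_at_rightI[of 0 "r - a"]) (use ar in auto)
          then show "\<forall>\<^sub>F t in at_right 0. (x, r - t) \<in> epi \<phi>"
            by eventually_elim (use a comp[OF elim(2)] in \<open>auto simp: epi_def\<close>)
          have "\<forall>\<^sub>F t in at_right (0::real). (0, - 1) = ((x, r - t) - (x, r)) /\<^sub>R t"
            by (rule eventually_at_rightI[of 0 1]) (auto simp: zero_prod_def)
          then show "((\<lambda>t. ((x, r - t) - (x, r)) /\<^sub>R t) \<longlongrightarrow> (0, - 1)) (at_right 0)"
            by (rule Lim_transform_eventually[OF tendsto_const])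
        qed
        from polar[OF this] s show False by simp
      qed
      note a = a(1)[unfolded this]
      have \<phi>x: "\<phi> x = ereal r" using a comp[OF elim(2)] by simp
      let ?z = "\<Phi> x"
      \<comment> \<open>The segment from \<open>(?z, r)\<close> to \<open>(y, b)\<close> stays in
        the epigraph of \<open>g\<close>, and the curve follows it exactly in the
        \<open>?L\<close>-component. The mismatch \<open>n t\<close> is orthogonal to
        \<open>?L\<close>, so the bound on \<open>g\<close> changes by just
        \<open>l0 \<bullet> n t\<close>.\<close>
      have tang: "(w, b - r + l0 \<bullet> (D x w - (y - ?z))) \<in> tangent_cone (epi \<phi>) (x, r)"
        if y: "g y \<le> ereal b" and w: "?P (D x w) = ?P (y - ?z)" for y b w
      proof -
        obtain c where c: "\<forall>\<^sub>F t in at_right 0. c t \<in> V \<and> ?P (\<Phi> (c t)) = ?P (?z + t *\<^sub>R D x w)"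
          and clim: "((\<lambda>t. (c t - x) /\<^sub>R t) \<longlongrightarrow> w) (at_right 0)"
          by (rule curve_through[OF elim(2) subspace_direction_space inj])
        have pos: "\<forall>\<^sub>F t in at_right (0::real). 0 < t \<and> t < 1"
          by (rule eventually_at_rightI[of 0 1]) auto
        have t0: "((\<lambda>t. t) \<longlongrightarrow> (0::real)) (at_right 0)" by (rule tendsto_ident_at)
        have ceq: "\<forall>\<^sub>F t in at_right 0. x + t *\<^sub>R ((c t - x) /\<^sub>R t) = c t"
          using pos by eventually_elim simp
        have "((\<lambda>t. x + t *\<^sub>R ((c t - x) /\<^sub>R t)) \<longlongrightarrow> x + 0 *\<^sub>R w) (at_right 0)"
          by (intro tendsto_intros t0 clim)
        then have cx: "(c \<longlongrightarrow> x) (at_right 0)"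
          using tendsto_cong[OF ceq] by simp
        have "((\<lambda>t. \<Phi> (c t)) \<longlongrightarrow> ?z) (at_right 0)"
          by (rule filterlim_compose[OF tendsto_\<Phi>[OF elim(2)] cx])
        then have near: "\<forall>\<^sub>F t in at_right 0. dist (\<Phi> (c t)) (\<Phi> x0) < \<delta>"
          by (rule order_tendstoD(2)[OF tendsto_dist[OF _ tendsto_const] elim(3)])
        have "((\<lambda>t. (\<Phi> (x + t *\<^sub>R ((c t - x) /\<^sub>R t)) - \<Phi> x) /\<^sub>R t) \<longlongrightarrow> D x w) (at_right 0)"
          by (intro has_derivative_imp_quotient_tendsto[OF der[OF elim(2)]] t0 clim)
             (rule eventually_at_right_less)
        moreover have "\<forall>\<^sub>F t in at_right 0. (\<Phi> (x + t *\<^sub>R ((c t - x) /\<^sub>R t)) - \<Phi> x) /\<^sub>R t = (\<Phi> (c t) - ?z) /\<^sub>R t"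
          using ceq by eventually_elim simp
        ultimately have \<Phi>lim: "((\<lambda>t. (\<Phi> (c t) - ?z) /\<^sub>R t) \<longlongrightarrow> D x w) (at_right 0)"
          by (rule Lim_transform_eventually)
        define n where "n = (\<lambda>t. \<Phi> (c t) - (?z + t *\<^sub>R (y - ?z)))"
        define \<rho> where "\<rho> = (\<lambda>t. r + t * (b - r) + l0 \<bullet> n t)"
        show ?thesis
        proof (rule tangent_cone_curveI[where c = "\<lambda>t. (c t, \<rho> t)"])
          show "\<forall>\<^sub>F t in at_right 0. (c t, \<rho> t) \<in> epi \<phi>"
            using c near pos
          proof eventually_elim
            case (elim t)
            have "?P (n t) = ?P (\<Phi> (c t)) - (?P ?z + t *\<^sub>R ?P (y - ?z))"
              unfolding n_def by (simp only: linear_diff[OF Pl] linear_add[OF Pl] linear_scale[OF Pl])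
            also have "\<dots> = 0" using elim(1) unfolding w[symmetric]
              by (simp only: linear_add[OF Pl] linear_scale[OF Pl]) simp
            finally have n0: "\<forall>m\<in>?L. m \<bullet> n t = 0"
              by (simp add: orth_proj_eq_0_iff)
            have "convex (epi g)"
              using poly by (simp add: polyhedral_function_def polyhedron_imp_convex)
            moreover have "(?z, r) \<in> epi g" "(y, b) \<in> epi g" using a y by (auto simp: epi_def)
            ultimately have "(1 - t) *\<^sub>R (?z, r) + t *\<^sub>R (y, b) \<in> epi g"
              using elim(3) by (intro convexD_alt) auto
            moreover have "(1 - t) *\<^sub>R (?z, r) + t *\<^sub>R (y, b) = (?z + t *\<^sub>R (y - ?z), r + t * (b - r))"
              by (simp add: algebra_simps)
            ultimately have "g (?z + t *\<^sub>R (y - ?z)) \<le> ereal (r + t * (b - r))"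
              by (simp add: epi_def)
            then have "g (?z + t *\<^sub>R (y - ?z) + n t) \<le> ereal (\<rho> t)"
              unfolding \<rho>_def by (rule inv[OF n0, rotated]) (use elim(2) in \<open>auto simp: n_def dist_norm\<close>)
            then show ?case using comp elim(1) by (simp add: epi_def n_def)
          qed
          have "((\<lambda>t. ((c t - x) /\<^sub>R t, (b - r) + l0 \<bullet> ((\<Phi> (c t) - ?z) /\<^sub>R t - (y - ?z)))) \<longlongrightarrow>
              (w, (b - r) + l0 \<bullet> (D x w - (y - ?z)))) (at_right 0)"
            by (intro tendsto_intros clim \<Phi>lim)
          moreover have "\<forall>\<^sub>F t in at_right 0. ((c t - x) /\<^sub>R t, (b - r) + l0 \<bullet> ((\<Phi> (c t) - ?z) /\<^sub>R t - (y - ?z))) =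
              ((c t, \<rho> t) - (x, r)) /\<^sub>R t"
            using pos
          proof eventually_elim
            case (elim t)
            have "n t = t *\<^sub>R ((\<Phi> (c t) - ?z) /\<^sub>R t - (y - ?z))"
              using elim by (simp add: n_def scaleR_right_diff_distrib)
            then show ?case using elim by (simp add: \<rho>_def inverse_eq_divide add_divide_distrib)
          qed
          ultimately show "((\<lambda>t. ((c t, \<rho> t) - (x, r)) /\<^sub>R t) \<longlongrightarrow> (w, b - r + l0 \<bullet> (D x w - (y - ?z)))) (at_right 0)"
            by (rule Lim_transform_eventually)
        qed
      qed
      obtain B where B: "linear B" "\<And>y. ?P (D x (B y)) = ?P y"
        by (rule orth_proj_right_inverse[OF lin_D subspace_direction_space inj]) (rule that)
      have ker: "v \<bullet> w = s * (l0 \<bullet> D x w)" if w: "?P (D x w) = 0" for w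
      proof -
        have *: "v \<bullet> w \<le> s * (l0 \<bullet> D x w)" if "?P (D x w) = 0" for w
          using polar[OF tang[of ?z r w]] a that by (simp add: linear_0[OF Pl])
        have "?P (D x (- w)) = 0" using w by (simp add: blinfun.minus_right linear_neg[OF Pl])
        from *[OF this] *[OF w] show ?thesis by (simp add: blinfun.minus_right)
      qed
      \<comment> \<open>By \<open>ker\<close> this functional vanishes on the kernel of the
        projected derivative. It therefore factors through \<open>D x\<close> by means of
        \<open>B\<close>, and \<open>adjoint B \<eta>\<close> is the correction that turns
        \<open>l0\<close> into the multiplier of \<open>v /\<^sub>R s\<close>.\<close>
      define \<eta> where "\<eta> = v /\<^sub>R s - Dadj x l0"
      have \<eta>: "\<eta> \<bullet> w = (v \<bullet> w) / s - l0 \<bullet> D x w" for w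
        by (simp add: \<eta>_def inner_diff_left inner_Dadj divide_inverse_commute)
      define l where "l = l0 + adjoint B \<eta>"
      have adjB: "adjoint B \<eta> \<bullet> u = \<eta> \<bullet> B u" for u
        using adjoint_works[OF B(1), of u \<eta>] by (simp add: inner_commute)
      have "Dadj x l = v /\<^sub>R s"
      proof (rule Dadj_eqI)
        fix w
        have "?P (D x (w - B (D x w))) = 0"
          by (simp add: blinfun.diff_right linear_diff[OF Pl] B(2))
        from ker[OF this] have "\<eta> \<bullet> (w - B (D x w)) = 0" unfolding \<eta> using s by simp
        then have "\<eta> \<bullet> w = \<eta> \<bullet> B (D x w)" by (simp add: inner_diff_right)
        then have "\<eta> \<bullet> w = adjoint B \<eta> \<bullet> D x w" by (simp add: adjB)
        then show "(v /\<^sub>R s) \<bullet> w = l \<bullet> D x w"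
          by (simp add: \<eta> l_def inner_add_left divide_inverse_commute)
      qed
      moreover have "l \<in> subdifferential g ?z"
      proof (rule polyhedral_subgradientI[OF poly a])
        fix y b assume y: "g y \<le> ereal b"
        let ?u = "y - ?z"
        have "v \<bullet> B ?u \<le> s * (b - r + l0 \<bullet> (D x (B ?u) - ?u))"
          by (rule polar[OF tang[OF y B(2)]])
        then have "(v \<bullet> B ?u) / s \<le> b - r + l0 \<bullet> (D x (B ?u) - ?u)"
          using s by (simp add: pos_divide_le_eq mult.commute)
        then have "\<eta> \<bullet> B ?u \<le> b - r - l0 \<bullet> ?u" by (simp add: \<eta> inner_diff_right)
        then show "r + l \<bullet> ?u \<le> b" by (simp add: l_def inner_add_left adjB)
      qed
      ultimately show "\<phi> x = ereal r \<and> (\<exists>l\<in>subdifferential g (\<Phi> x). Dadj x l = v /\<^sub>R s)"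
        using \<phi>x by blast
    qed
  qed
qed

text \<open>A limiting normal is approximated by regular ones, each with a multiplier. These
  multipliers differ from \<open>l0\<close> by elements of the direction space at \<open>x0\<close>,
  on which the adjoint is uniformly bounded below, so they are bounded and a subsequence converges;
  its limit is a multiplier because the subgradient inequality is closed.\<close>

lemma eventually_subdifferential_chain_rule:
  assumes x0: "x0 \<in> V" and l0: "l0 \<in> subdifferential g (\<Phi> x0)" and nd: "nondegenerate x0"
  shows "\<forall>\<^sub>F x in nhds x0. subdifferential \<phi> x = Dadj x ` subdifferential g (\<Phi> x)"
proof -
  obtain c where c: "c > 0" "\<forall>\<^sub>F x in nhds x0. \<forall>l\<in>Lsp x0. c * norm l \<le> norm (Dadj x l)"
    by (rule eventually_adjoint_bounded_below[OF x0 nd])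
  let ?Q = "\<lambda>x. (\<forall>r v s. (x, r) \<in> epi \<phi> \<longrightarrow> (v, - s) \<in> regular_normal_cone (epi \<phi>) (x, r) \<longrightarrow>
      s > 0 \<longrightarrow> \<phi> x = ereal r \<and> (\<exists>l\<in>subdifferential g (\<Phi> x). Dadj x l = v /\<^sub>R s)) \<and> x \<in> V \<and>
      subdifferential g (\<Phi> x) \<subseteq> subdifferential g (\<Phi> x0) \<and> (\<forall>l\<in>Lsp x0. c * norm l \<le> norm (Dadj x l))"
  have "\<forall>\<^sub>F x in nhds x0. ?Q x"
    by (intro eventually_conj eventually_regular_normal[OF assms] eventually_V[OF x0]
        eventually_subdifferential_subset[OF x0 l0] c(2))
  \<comment> \<open>Limiting normals at \<open>x\<close> come from base points near
    \<open>x\<close>, so the properties are required on a neighbourhood of each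
    \<open>x\<close>.\<close>
  then have "\<forall>\<^sub>F x in nhds x0. \<forall>\<^sub>F x' in nhds x. ?Q x'"
    unfolding eventually_eventually .
  then show ?thesis
  proof eventually_elim
    case (elim x)
    have xV: "x \<in> V" using eventually_nhds_x_imp_x[OF elim] by blast
    show ?case
    proof (intro equalityI subsetI)
      fix v assume v: "v \<in> subdifferential \<phi> x"
      obtain a where a: "\<phi> x = ereal a" using subdifferential_imp_finite[OF v] by blast
      then have "(v, - 1) \<in> limiting_normal_cone (epi \<phi>) (x, a)"
        using v by (simp add: subdifferential_def)
      then obtain ps vs where ps: "\<And>k::nat. ps k \<in> epi \<phi>"
        "\<And>k. vs k \<in> regular_normal_cone (epi \<phi>) (ps k)"
        "ps \<longlonglongrightarrow> (x, a)" "vs \<longlonglongrightarrow> (v, - 1)"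
        unfolding limiting_normal_cone_def by blast
      have px: "(\<lambda>k. fst (ps k)) \<longlonglongrightarrow> x" and pa: "(\<lambda>k. snd (ps k)) \<longlonglongrightarrow> a"
        using tendsto_fst[OF ps(3)] tendsto_snd[OF ps(3)] by auto
      have vv: "(\<lambda>k. fst (vs k)) \<longlonglongrightarrow> v" and "(\<lambda>k. snd (vs k)) \<longlonglongrightarrow> - 1"
        using tendsto_fst[OF ps(4)] tendsto_snd[OF ps(4)] by auto
      then have s1: "(\<lambda>k. - snd (vs k)) \<longlonglongrightarrow> 1" using tendsto_minus by fastforce
      define u where "u = (\<lambda>k. fst (vs k) /\<^sub>R (- snd (vs k)))"
      have "u \<longlonglongrightarrow> v /\<^sub>R 1" unfolding u_def by (intro tendsto_intros vv s1) simp
      then have u: "u \<longlonglongrightarrow> v" by simp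
      let ?x = "\<lambda>k. fst (ps k)"
      let ?W = "\<lambda>k l. l \<in> subdifferential g (\<Phi> (?x k)) \<and> Dadj (?x k) l = u k"
      have "\<forall>\<^sub>F k in sequentially. ?Q (?x k)"
        by (rule eventually_compose_filterlim[OF elim px])
      moreover have "\<forall>\<^sub>F k in sequentially. - snd (vs k) > 0"
        by (rule order_tendstoD(1)[OF s1]) simp
      ultimately have "\<forall>\<^sub>F k in sequentially. ?Q (?x k) \<and> \<phi> (?x k) = ereal (snd (ps k)) \<and> (\<exists>l. ?W k l)"
      proof eventually_elim
        case (elim k)
        have "(?x k, snd (ps k)) \<in> epi \<phi>" "(fst (vs k), - (- snd (vs k))) \<in> regular_normal_cone (epi \<phi>) (?x k, snd (ps k))"
          using ps(1,2)[of k] by simp_all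
        with elim have "\<phi> (?x k) = ereal (snd (ps k)) \<and> (\<exists>l\<in>subdifferential g (\<Phi> (?x k)). Dadj (?x k) l = u k)"
          unfolding u_def by blast
        with elim(1) show ?case by blast
      qed
      then obtain N where N: "\<And>k. k \<ge> N \<Longrightarrow> ?Q (?x k) \<and> \<phi> (?x k) = ereal (snd (ps k)) \<and> (\<exists>l. ?W k l)"
        unfolding eventually_sequentially by blast
      define ls where "ls = (\<lambda>k. SOME l. ?W k l)"
      have ls: "?W k (ls k)" if "k \<ge> N" for k
        unfolding ls_def using N[OF that] by (intro someI_ex[of "?W k"]) blast
      have Dlim: "(\<lambda>k. D (?x k)) \<longlonglongrightarrow> D x" by (rule filterlim_compose[OF tendsto_D[OF xV] px])
      have "(\<lambda>k. norm (u k) + norm (D (?x k)) * norm l0) \<longlonglongrightarrow> norm v + norm (D x) * norm l0"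
        by (intro tendsto_intros u Dlim)
      then have "Bseq (\<lambda>k. norm (u k) + norm (D (?x k)) * norm l0)"
        by (intro convergent_imp_Bseq convergentI)
      then obtain K where K: "\<And>k. norm (u k) + norm (D (?x k)) * norm l0 \<le> K"
        unfolding Bseq_def by (metis abs_le_D1 real_norm_def)
      have bd: "norm (ls k - l0) \<le> K / c" if "k \<ge> N" for k
      proof -
        have "ls k \<in> subdifferential g (\<Phi> x0)" using ls[OF that] N[OF that] by blast
        then have "ls k - l0 \<in> Lsp x0" using l0 by (rule diff_in_direction_space)
        then have "c * norm (ls k - l0) \<le> norm (Dadj (?x k) (ls k - l0))" using N[OF that] by blast
        also have "Dadj (?x k) (ls k - l0) = u k - Dadj (?x k) l0"
          using ls[OF that] by (simp add: linear_diff[OF linear_Dadj])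
        also have "norm \<dots> \<le> norm (u k) + norm (Dadj (?x k) l0)" by (rule norm_triangle_ineq4)
        also have "\<dots> \<le> norm (u k) + norm (D (?x k)) * norm l0"
          by (intro add_left_mono norm_adjoint_blinfun_le)
        also have "\<dots> \<le> K" by (rule K)
        finally show ?thesis using c(1) by (simp add: pos_le_divide_eq mult.commute)
      qed
      have "bounded (range (\<lambda>k. ls (k + N)))"
        by (rule bounded_subset[OF bounded_cball[of l0 "K / c"]]) (use bd in \<open>auto simp: dist_norm norm_minus_commute\<close>)
      then obtain l r where lr: "strict_mono r" "((\<lambda>k. ls (k + N)) \<circ> r) \<longlonglongrightarrow> l"
        using bounded_imp_convergent_subsequence by blast
      define q where "q = (\<lambda>k. r k + N)"
      have qN: "q k \<ge> N" for k by (simp add: q_def)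
      have "strict_mono q" using lr(1) by (auto simp: q_def strict_mono_def)
      then have q: "filterlim q sequentially sequentially" by (rule filterlim_subseq)
      have l: "(\<lambda>k. ls (q k)) \<longlonglongrightarrow> l" using lr(2) by (simp add: comp_def q_def)
      have "Dadj x l = v"
      proof (rule Dadj_eqI)
        fix w
        have "(\<lambda>k. ls (q k) \<bullet> D (?x (q k)) w) \<longlonglongrightarrow> l \<bullet> D x w"
          by (intro tendsto_intros l filterlim_compose[OF Dlim q])
        moreover have "(\<lambda>k. u (q k) \<bullet> w) \<longlonglongrightarrow> v \<bullet> w"
          by (intro tendsto_intros filterlim_compose[OF u q])
        moreover have "u (q k) \<bullet> w = ls (q k) \<bullet> D (?x (q k)) w" for k
          using ls[OF qN[of k]] inner_Dadj by metis
        ultimately show "v \<bullet> w = l \<bullet> D x w" using LIMSEQ_unique by fastforce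
      qed
      moreover have "l \<in> subdifferential g (\<Phi> x)"
      proof (rule polyhedral_subgradientI[OF poly])
        show "g (\<Phi> x) = ereal a" using a comp[OF xV] by simp
        fix y b assume y: "g y \<le> ereal b"
        have "snd (ps (q k)) + ls (q k) \<bullet> (y - \<Phi> (?x (q k))) \<le> b" for k
        proof (rule polyhedral_subgradientD[OF poly _ _ y])
          show "ls (q k) \<in> subdifferential g (\<Phi> (?x (q k)))" using ls[OF qN] by blast
          show "g (\<Phi> (?x (q k))) = ereal (snd (ps (q k)))"
            using N[OF qN[of k]] comp by metis
        qed
        moreover have "(\<lambda>k. snd (ps (q k)) + ls (q k) \<bullet> (y - \<Phi> (?x (q k)))) \<longlonglongrightarrow> a + l \<bullet> (y - \<Phi> x)"
          by (intro tendsto_intros l filterlim_compose[OF pa q]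
              filterlim_compose[OF tendsto_\<Phi>[OF xV] filterlim_compose[OF px q]])
        ultimately show "a + l \<bullet> (y - \<Phi> x) \<le> b" by (meson LIMSEQ_le_const2)
      qed
      ultimately show "v \<in> Dadj x ` subdifferential g (\<Phi> x)" by blast
    next
      fix v assume "v \<in> Dadj x ` subdifferential g (\<Phi> x)"
      then show "v \<in> subdifferential \<phi> x"
        using adjoint_image_subset_subdifferential[OF xV] by blast
    qed
  qed
qed

end

section \<open>Second-order quotients and their limits\<close>

lemma second_order_quotient_le_iff:
  assumes "f x = ereal a" "t > 0"
  shows "second_order_quotient f t x v w \<le> ereal r \<longleftrightarrow>
    f (x + t *\<^sub>R w) \<le> ereal (a + t * (v \<bullet> w) + t\<^sup>2 / 2 * r)"
proof (cases "f (x + t *\<^sub>R w)")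
  case (real b)
  have "t\<^sup>2 / 2 > 0" using assms(2) by simp
  then have "(b - a - t * (v \<bullet> w)) / (t\<^sup>2 / 2) \<le> r \<longleftrightarrow> b - a - t * (v \<bullet> w) \<le> r * (t\<^sup>2 / 2)"
    by (rule pos_divide_le_eq)
  then show ?thesis using real assms by (auto simp: second_order_quotient_def algebra_simps)
qed (use assms in \<open>auto simp: second_order_quotient_def\<close>)

text \<open>Making the neighbourhoods of \<open>p\<close> a further factor of the filter turns a
  varying epigraph point into a convergent function of the index, so no sequences have to be
  extracted.\<close>

lemma not_in_outer_limit:
  assumes "\<forall>\<^sub>F (i, q) in F \<times>\<^sub>F nhds p. q \<notin> C i"
  shows "p \<notin> outer_limit F C"
proof
  assume p: "p \<in> outer_limit F C"
  obtain P Q where PQ: "eventually P F" "eventually Q (nhds p)" "\<And>i q. P i \<Longrightarrow> Q q \<Longrightarrow> q \<notin> C i"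
    using assms unfolding eventually_prod_filter by auto
  obtain S where S: "open S" "p \<in> S" "\<And>q. q \<in> S \<Longrightarrow> Q q"
    using PQ(2) unfolding eventually_nhds by blast
  have "\<forall>\<^sub>F i in F. C i \<inter> S = {}"
    using PQ(1) by eventually_elim (use PQ(3) S(3) in blast)
  moreover have "\<exists>\<^sub>F i in F. C i \<inter> S \<noteq> {}" using p S unfolding outer_limit_def by blast
  ultimately show False unfolding frequently_def by simp
qed

lemma in_inner_limit:
  assumes "\<forall>\<^sub>F i in F. f i \<in> C i" "(f \<longlongrightarrow> p) F"
  shows "p \<in> inner_limit F C"
  unfolding inner_limit_def
proof safe
  fix S assume "open S" "p \<in> S"
  with assms(2) have "\<forall>\<^sub>F i in F. f i \<in> S" by (rule topological_tendstoD)
  with assms(1) show "\<forall>\<^sub>F i in F. C i \<inter> S \<noteq> {}" by eventually_elim blast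
qed

lemma inner_limit_subset_outer_limit: "F \<noteq> bot \<Longrightarrow> inner_limit F C \<subseteq> outer_limit F C"
  unfolding inner_limit_def outer_limit_def by (auto intro: eventually_frequently)

lemma outer_limit_filtermap_subset:
  assumes "filterlim c F G" "p \<in> outer_limit G (\<lambda>i. C (c i))"
  shows "p \<in> outer_limit F C"
  unfolding outer_limit_def
proof safe
  fix S assume "open S" "p \<in> S"
  then have "\<exists>\<^sub>F i in G. C (c i) \<inter> S \<noteq> {}" using assms(2) by (simp add: outer_limit_def)
  then show "\<exists>\<^sub>F i in F. C i \<inter> S \<noteq> {}"
    using assms(1) unfolding frequently_def filterlim_iff by blast
qed

lemma filterlim_subgradient_filter:
  assumes "(c \<longlongrightarrow> (x0, v0)) F" "\<forall>\<^sub>F i in F. c i \<in> gph (subdifferential f)"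
    "((\<lambda>i. f (fst (c i))) \<longlongrightarrow> f x0) F"
  shows "filterlim c (subgradient_filter f x0 v0) F"
  unfolding subgradient_filter_def
  by (intro filterlim_inf[THEN iffD2] conjI)
     (use assms in \<open>simp_all add: filterlim_principal filterlim_filtercomap_iff case_prod_unfold comp_def\<close>)

lemma subgradient_filter_neq_bot:
  assumes "v0 \<in> subdifferential f x0"
  shows "subgradient_filter f x0 v0 \<noteq> bot"
proof -
  have "filterlim (\<lambda>_::nat. (x0, v0)) (subgradient_filter f x0 v0) sequentially"
    using assms by (intro filterlim_subgradient_filter) (auto simp: gph_def)
  then show ?thesis
    unfolding filterlim_def by (metis bot.extremum_uniqueI filtermap_bot_iff sequentially_bot)
qed

text \<open>A common subgradient \<open>l\<close> fixes the difference of the values at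
  \<open>y\<close> and \<open>z\<close>. By orthogonality every \<open>m\<close> has the same slope
  as \<open>l\<close> along \<open>y - z\<close>, so its affine minorant touches \<open>g\<close> at
  \<open>y\<close> too.\<close>

lemma polyhedral_subdifferential_subset_of_orthogonal:
  assumes g: "polyhedral_function g" and l: "l \<in> subdifferential g z" "l \<in> subdifferential g y"
    and orth: "\<forall>k\<in>direction_space (subdifferential g z). k \<bullet> (y - z) = 0"
  shows "subdifferential g z \<subseteq> subdifferential g y"
proof
  fix m assume m: "m \<in> subdifferential g z"
  obtain a where a: "g z = ereal a" using subdifferential_imp_finite[OF l(1)] by blast
  obtain b where b: "g y = ereal b" using subdifferential_imp_finite[OF l(2)] by blast
  have "a + l \<bullet> (y - z) \<le> b" by (rule polyhedral_subgradientD[OF g l(1) a]) (simp add: b)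
  moreover have "b + l \<bullet> (z - y) \<le> a" by (rule polyhedral_subgradientD[OF g l(2) b]) (simp add: a)
  ultimately have ab: "b = a + l \<bullet> (y - z)" by (simp add: inner_diff_right)
  have lm: "(l - m) \<bullet> (y - z) = 0" using orth diff_in_direction_space[OF l(1) m] by blast
  show "m \<in> subdifferential g y"
  proof (rule polyhedral_subgradientI[OF g b])
    fix u r assume "g u \<le> ereal r"
    then have "a + m \<bullet> (u - z) \<le> r" by (rule polyhedral_subgradientD[OF g m a])
    moreover have "b + m \<bullet> (u - y) = a + m \<bullet> (u - z) + (l - m) \<bullet> (y - z)"
      unfolding ab by (simp add: inner_diff_left inner_diff_right)
    ultimately show "b + m \<bullet> (u - y) \<le> r" using lm by simp
  qed
qed

section \<open>Bounds and limits for the quotients of the composite\<close>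

context smooth_composite
begin

lemma second_order_quotient_tendsto:
  assumes x0: "x0 \<in> V" and t: "\<forall>\<^sub>F i in F. t i > 0" "(t \<longlongrightarrow> 0) F"
    and x: "(xs \<longlongrightarrow> x0) F" and w: "(ws \<longlongrightarrow> w0) F"
  shows "((\<lambda>i. (2 / (t i)\<^sup>2) *\<^sub>R (\<Phi> (xs i + t i *\<^sub>R ws i) - \<Phi> (xs i) - t i *\<^sub>R D (xs i) (ws i)))
    \<longlongrightarrow> D2 x0 w0 w0) F" (is "(?R \<longlongrightarrow> _) F")
proof -
  have "((\<lambda>i. ?R i - D2 x0 (ws i) (ws i)) \<longlongrightarrow> 0) F"
  proof (rule tendstoI)
    fix e :: real assume e: "e > 0"
    define K where "K = (norm w0 + 1)\<^sup>2"
    have "norm w0 + 1 > 0" by (simp add: add_nonneg_pos)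
    then have K: "K > 0" by (simp add: K_def)
    \<comment> \<open>\<open>K\<close> eventually bounds the squared norm of \<open>ws i\<close>;
      the factor 2 of the quotient turns the Taylor error into at most
      \<open>2 * \<epsilon> * K = e / 2\<close>.\<close>
    define \<epsilon> where "\<epsilon> = e / (4 * K)"
    have \<epsilon>: "\<epsilon> > 0" using e K by (simp add: \<epsilon>_def)
    obtain \<delta> where \<delta>: "\<delta> > 0" and taylor: "\<And>x u. dist x x0 < \<delta> \<Longrightarrow> norm u < \<delta> \<Longrightarrow>
       norm (\<Phi> (x + u) - \<Phi> x - D x u - (1 / 2) *\<^sub>R D2 x0 u u) \<le> \<epsilon> * (norm u)\<^sup>2"
      by (rule uniform_second_order_taylor[OF open_V x0 der der2 isCont_D2[OF x0] \<epsilon>]) (assumption, assumption, rule that)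
    have "((\<lambda>i. t i *\<^sub>R ws i) \<longlongrightarrow> 0 *\<^sub>R w0) F" by (intro tendsto_intros t w)
    then have "\<forall>\<^sub>F i in F. dist (t i *\<^sub>R ws i) 0 < \<delta>" using \<delta> by (auto dest: tendstoD)
    moreover have "\<forall>\<^sub>F i in F. dist (xs i) x0 < \<delta>" using x \<delta> by (rule tendstoD)
    moreover have "\<forall>\<^sub>F i in F. norm (ws i) < norm w0 + 1"
      by (rule order_tendstoD(2)[OF tendsto_norm[OF w]]) simp
    ultimately show "\<forall>\<^sub>F i in F. dist (?R i - D2 x0 (ws i) (ws i)) 0 < e"
      using t(1)
    proof eventually_elim
      case (elim i)
      let ?u = "t i *\<^sub>R ws i"
      let ?E = "\<Phi> (xs i + ?u) - \<Phi> (xs i) - D (xs i) ?u - (1 / 2) *\<^sub>R D2 x0 ?u ?u"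
      have "norm ?E \<le> \<epsilon> * (norm ?u)\<^sup>2" using elim by (intro taylor) auto
      then have "(2 / (t i)\<^sup>2) * norm ?E \<le> (2 / (t i)\<^sup>2) * (\<epsilon> * (norm ?u)\<^sup>2)"
        by (rule mult_left_mono) simp
      also have "\<dots> = 2 * \<epsilon> * (norm (ws i))\<^sup>2" using elim by (simp add: power_mult_distrib)
      also have "\<dots> \<le> 2 * \<epsilon> * K"
        unfolding K_def using elim \<epsilon> by (intro mult_left_mono power_mono) auto
      also have "\<dots> < e" using e K by (simp add: \<epsilon>_def)
      finally have "norm ((2 / (t i)\<^sup>2) *\<^sub>R ?E) < e" by simp
      moreover have "(2 / (t i)\<^sup>2) *\<^sub>R ?E = ?R i - D2 x0 (ws i) (ws i)"
        using elim by (simp add: blinfun.scaleR_right blinfun.scaleR_left scaleR_right_diff_distrib power2_eq_square)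
      ultimately show ?case by simp
    qed
  qed
  moreover have "((\<lambda>i. D2 x0 (ws i) (ws i)) \<longlongrightarrow> D2 x0 w0 w0) F" by (intro tendsto_intros w)
  ultimately have "((\<lambda>i. (?R i - D2 x0 (ws i) (ws i)) + D2 x0 (ws i) (ws i)) \<longlongrightarrow> 0 + D2 x0 w0 w0) F"
    by (rule tendsto_add)
  then show ?thesis by simp
qed

text \<open>Differentiability at \<open>x0\<close> alone does not control quotients with moving base
  points. Here the quotient is \<open>D (xs i) (ws i)\<close> plus \<open>t i / 2\<close> times the
  second-order quotient, which converges.\<close>

lemma first_order_quotient_tendsto:
  assumes x0: "x0 \<in> V" and t: "\<forall>\<^sub>F i in F. t i > 0" "(t \<longlongrightarrow> 0) F"
    and x: "(xs \<longlongrightarrow> x0) F" and w: "(ws \<longlongrightarrow> w0) F"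
  shows "((\<lambda>i. (\<Phi> (xs i + t i *\<^sub>R ws i) - \<Phi> (xs i)) /\<^sub>R t i) \<longlongrightarrow> D x0 w0) F"
proof -
  let ?R = "\<lambda>i. (2 / (t i)\<^sup>2) *\<^sub>R (\<Phi> (xs i + t i *\<^sub>R ws i) - \<Phi> (xs i) - t i *\<^sub>R D (xs i) (ws i))"
  have 1: "((\<lambda>i. D (xs i) (ws i)) \<longlongrightarrow> D x0 w0) F"
    by (rule bounded_bilinear.tendsto[OF bounded_bilinear_blinfun_apply
          filterlim_compose[OF tendsto_D[OF x0] x] w])
  have 2: "((\<lambda>i. t i / 2) \<longlongrightarrow> 0 / 2) F"
    by (rule tendsto_divide[OF t(2) tendsto_const]) simp
  have 3: "(?R \<longlongrightarrow> D2 x0 w0 w0) F" by (rule second_order_quotient_tendsto[OF assms])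
  have "((\<lambda>i. D (xs i) (ws i) + (t i / 2) *\<^sub>R ?R i) \<longlongrightarrow> D x0 w0 + (0 / 2) *\<^sub>R D2 x0 w0 w0) F"
    by (rule tendsto_add[OF 1 tendsto_scaleR[OF 2 3]])
  moreover have "\<forall>\<^sub>F i in F. D (xs i) (ws i) + (t i / 2) *\<^sub>R ?R i = (\<Phi> (xs i + t i *\<^sub>R ws i) - \<Phi> (xs i)) /\<^sub>R t i"
    using t(1)
  proof eventually_elim
    case (elim i)
    have *: "(t i / 2) * (2 / (t i)\<^sup>2) = inverse (t i)" using elim by (simp add: field_simps power2_eq_square)
    have "inverse (t i) *\<^sub>R (t i *\<^sub>R D (xs i) (ws i)) = D (xs i) (ws i)" using elim by simp
    then show ?case by (simp only: scaleR_scaleR[of "t i / 2"] * scaleR_right_diff_distrib[of "inverse (t i)"]) simp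
  qed
  ultimately have "((\<lambda>i. (\<Phi> (xs i + t i *\<^sub>R ws i) - \<Phi> (xs i)) /\<^sub>R t i) \<longlongrightarrow>
      D x0 w0 + (0 / 2) *\<^sub>R D2 x0 w0 w0) F"
    by (rule Lim_transform_eventually)
  then show ?thesis by simp
qed

text \<open>Among the subgradients \<open>l + k\<close> the best \<open>k\<close> has norm
  \<open>e\<close> and points along the projected displacement; its inequality adds \<open>e\<close>
  times the norm of that displacement to the one of \<open>l\<close>.\<close>

lemma second_order_quotient_lower_bound:
  assumes x: "x \<in> V" "x + t *\<^sub>R w \<in> V" "t > 0" and L: "subspace L"
    and l: "\<forall>k\<in>L. norm k \<le> e \<longrightarrow> l + k \<in> subdifferential g (\<Phi> x)" and e: "e \<ge> 0"
    and q: "second_order_quotient \<phi> t x (Dadj x l) w \<le> ereal r"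
  shows "l \<bullet> (\<Phi> (x + t *\<^sub>R w) - \<Phi> x - t *\<^sub>R D x w) +
    e * norm (orth_proj L (\<Phi> (x + t *\<^sub>R w) - \<Phi> x)) \<le> t\<^sup>2 / 2 * r"
proof -
  let ?d = "\<Phi> (x + t *\<^sub>R w) - \<Phi> x"
  let ?p = "orth_proj L ?d"
  have pL: "?p \<in> L" by (rule orth_proj_in[OF L])
  define k where "k = (if ?p = 0 then 0 else (e / norm ?p) *\<^sub>R ?p)"
  have k: "k \<in> L" "norm k \<le> e" using pL L e by (auto simp: k_def subspace_scale subspace_0)
  have "?p \<bullet> ?d = ?p \<bullet> ?p" using orth_proj_inner[OF L pL] by simp
  then have kd: "k \<bullet> ?d = e * norm ?p"
    by (auto simp: k_def dot_square_norm power2_eq_square)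
  have lk: "l + k \<in> subdifferential g (\<Phi> x)" using l k by blast
  obtain a where a: "g (\<Phi> x) = ereal a" using subdifferential_imp_finite[OF lk] by blast
  have "\<phi> x = ereal a" using a comp[OF x(1)] by simp
  then have "\<phi> (x + t *\<^sub>R w) \<le> ereal (a + t * (Dadj x l \<bullet> w) + t\<^sup>2 / 2 * r)"
    using q x(3) second_order_quotient_le_iff by blast
  then have "g (\<Phi> (x + t *\<^sub>R w)) \<le> ereal (a + t * (l \<bullet> D x w) + t\<^sup>2 / 2 * r)"
    using comp[OF x(2)] by (simp add: inner_Dadj)
  from polyhedral_subgradientD[OF poly lk a this] kd show ?thesis
    by (simp add: inner_add_left inner_diff_right)
qed

lemma second_order_quotient_upper_bound:
  assumes x: "x \<in> V" "x + t *\<^sub>R w \<in> V" "t > 0" and a: "g (\<Phi> x) = ereal a"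
    and g: "g (\<Phi> (x + t *\<^sub>R w)) \<le> ereal (a + l \<bullet> (\<Phi> (x + t *\<^sub>R w) - \<Phi> x))"
    and r: "l \<bullet> ((2 / t\<^sup>2) *\<^sub>R (\<Phi> (x + t *\<^sub>R w) - \<Phi> x - t *\<^sub>R D x w)) \<le> r"
  shows "second_order_quotient \<phi> t x (Dadj x l) w \<le> ereal r"
proof -
  let ?d = "\<Phi> (x + t *\<^sub>R w) - \<Phi> x"
  have "t\<^sup>2 / 2 * (l \<bullet> ((2 / t\<^sup>2) *\<^sub>R (?d - t *\<^sub>R D x w))) \<le> t\<^sup>2 / 2 * r"
    using r by (rule mult_left_mono) simp
  then have "l \<bullet> (?d - t *\<^sub>R D x w) \<le> t\<^sup>2 / 2 * r" using x(3) by simp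
  then have "a + l \<bullet> ?d \<le> a + t * (Dadj x l \<bullet> w) + t\<^sup>2 / 2 * r"
    by (simp add: inner_Dadj inner_diff_right)
  then have "\<phi> (x + t *\<^sub>R w) \<le> ereal (a + t * (Dadj x l \<bullet> w) + t\<^sup>2 / 2 * r)"
    using g comp[OF x(2)] by (metis ereal_less_eq(3) order.trans)
  moreover have "\<phi> x = ereal a" using a comp[OF x(1)] by simp
  ultimately show ?thesis using x(3) second_order_quotient_le_iff by blast
qed

text \<open>After division by \<open>(t i)\<^sup>2 / 2\<close> the first summand converges, and the second one explodes unless
  \<open>w0\<close> is tangent to the fibre of the projected map.\<close>

lemma eventually_lower_bound_exceeds:
  assumes x0: "x0 \<in> V" and t: "\<forall>\<^sub>F i in F. t i > 0" "(t \<longlongrightarrow> 0) F"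
    and x: "(xs \<longlongrightarrow> x0) F" and w: "(ws \<longlongrightarrow> w0) F"
    and l: "(ls \<longlongrightarrow> l0) F" and r: "(rs \<longlongrightarrow> r0) F" and L: "subspace L" and e: "e > 0"
    and cases: "orth_proj L (D x0 w0) \<noteq> 0 \<or> r0 < l0 \<bullet> D2 x0 w0 w0"
  shows "\<forall>\<^sub>F i in F. (t i)\<^sup>2 / 2 * rs i < ls i \<bullet> (\<Phi> (xs i + t i *\<^sub>R ws i) - \<Phi> (xs i) - t i *\<^sub>R D (xs i) (ws i)) +
    e * norm (orth_proj L (\<Phi> (xs i + t i *\<^sub>R ws i) - \<Phi> (xs i)))"
proof -
  let ?d = "\<lambda>i. \<Phi> (xs i + t i *\<^sub>R ws i) - \<Phi> (xs i)"
  let ?R = "\<lambda>i. (2 / (t i)\<^sup>2) *\<^sub>R (?d i - t i *\<^sub>R D (xs i) (ws i))"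
  let ?N = "\<lambda>i. norm (orth_proj L (?d i /\<^sub>R t i))"
  have lP: "linear (orth_proj L)" by (rule linear_orth_proj[OF L])
  have R: "((\<lambda>i. ls i \<bullet> ?R i) \<longlongrightarrow> l0 \<bullet> D2 x0 w0 w0) F"
    by (intro tendsto_intros l second_order_quotient_tendsto[OF x0 t x w])
  have N: "(?N \<longlongrightarrow> norm (orth_proj L (D x0 w0))) F"
    by (intro tendsto_norm bounded_linear.tendsto[OF linear_conv_bounded_linear[THEN iffD1, OF lP]]
        first_order_quotient_tendsto[OF x0 t x w])
  have eq: "ls i \<bullet> (?d i - t i *\<^sub>R D (xs i) (ws i)) = (t i)\<^sup>2 / 2 * (ls i \<bullet> ?R i)"
    "e * norm (orth_proj L (?d i)) = t i * (e * ?N i)" if "t i > 0" for i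
    using that by (simp_all add: linear_scale[OF lP])
  show ?thesis
    using cases
  proof
    assume "r0 < l0 \<bullet> D2 x0 w0 w0"
    then have "0 < l0 \<bullet> D2 x0 w0 w0 - r0" by simp
    then have "\<forall>\<^sub>F i in F. 0 < ls i \<bullet> ?R i - rs i"
      by (rule order_tendstoD(1)[OF tendsto_diff[OF R r]])
    with t(1) show ?thesis
    proof eventually_elim
      case (elim i)
      have "(t i)\<^sup>2 / 2 * rs i < (t i)\<^sup>2 / 2 * (ls i \<bullet> ?R i)"
        using elim by (intro mult_strict_left_mono) auto
      moreover have "0 \<le> t i * (e * ?N i)" using elim e by (intro mult_nonneg_nonneg) auto
      ultimately show ?case unfolding eq[OF elim(1)] by linarith
    qed
  next
    assume "orth_proj L (D x0 w0) \<noteq> 0"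
    then have "0 < e * norm (orth_proj L (D x0 w0)) - 0 / 2 * (r0 - l0 \<bullet> D2 x0 w0 w0)" using e by simp
    moreover have "((\<lambda>i. e * ?N i - t i / 2 * (rs i - ls i \<bullet> ?R i)) \<longlongrightarrow>
        e * norm (orth_proj L (D x0 w0)) - 0 / 2 * (r0 - l0 \<bullet> D2 x0 w0 w0)) F"
      by (intro tendsto_intros N R r t) simp
    ultimately have "\<forall>\<^sub>F i in F. 0 < e * ?N i - t i / 2 * (rs i - ls i \<bullet> ?R i)"
      by (rule order_tendstoD(1)[rotated])
    with t(1) show ?thesis
    proof eventually_elim
      case (elim i)
      have "0 < t i * (e * ?N i - t i / 2 * (rs i - ls i \<bullet> ?R i))" using elim by (intro mult_pos_pos)
      also have "\<dots> = t i * (e * ?N i) - ((t i)\<^sup>2 / 2 * rs i - (t i)\<^sup>2 / 2 * (ls i \<bullet> ?R i))"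
        by (simp add: right_diff_distrib power2_eq_square)
      finally show ?case unfolding eq[OF elim(1)] by linarith
    qed
  qed
qed

text \<open>A choice that is meaningful where the chain rule provides a multiplier, hence eventually
  along \<open>graph_filter\<close>.\<close>

definition multiplier :: "'a \<Rightarrow> 'a \<Rightarrow> 'b" where
  "multiplier x v = (SOME l. l \<in> subdifferential g (\<Phi> x) \<and> Dadj x l = v)"

text \<open>Coarser than \<open>subgradient_filter\<close>, as convergence of the values is not
  imposed: what holds eventually here holds eventually there, and it also yields the plain
  neighbourhood \<open>U\<close> of the theorem.\<close>

abbreviation graph_filter :: "'a \<Rightarrow> 'a \<Rightarrow> ('a \<times> 'a) filter" where
  "graph_filter x v \<equiv> inf (nhds (x, v)) (principal (gph (subdifferential \<phi>)))"

text \<open>Convergence holds because the multiplier minus \<open>l0\<close> lies in the direction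
  space at \<open>x0\<close>, where \<open>c\<close> times its norm is at most
  \<open>norm (v - Dadj x l0)\<close>, and this tends to 0 along the graph.\<close>

lemma
  assumes x0: "x0 \<in> V" and l0: "l0 \<in> subdifferential g (\<Phi> x0)" and nd: "nondegenerate x0"
  shows eventually_multiplier: "\<forall>\<^sub>F (x, v) in graph_filter x0 (Dadj x0 l0).
      multiplier x v \<in> subdifferential g (\<Phi> x) \<and> Dadj x (multiplier x v) = v"
    and multiplier_tendsto: "((\<lambda>(x, v). multiplier x v) \<longlongrightarrow> l0) (graph_filter x0 (Dadj x0 l0))"
proof -
  let ?F = "graph_filter x0 (Dadj x0 l0)"
  have id: "((\<lambda>p. p) \<longlongrightarrow> (x0, Dadj x0 l0)) ?F"
    unfolding filterlim_def by simp
  have fx: "(fst \<longlongrightarrow> x0) ?F" and sv: "(snd \<longlongrightarrow> Dadj x0 l0) ?F"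
    using tendsto_fst[OF id] tendsto_snd[OF id] by simp_all
  have gph: "\<forall>\<^sub>F p in ?F. p \<in> gph (subdifferential \<phi>)"
    by (simp add: eventually_inf_principal)
  have "\<forall>\<^sub>F p in ?F. subdifferential \<phi> (fst p) = Dadj (fst p) ` subdifferential g (\<Phi> (fst p))"
    by (rule eventually_compose_filterlim[OF eventually_subdifferential_chain_rule[OF assms] fx])
  with gph have ev: "\<forall>\<^sub>F p in ?F. multiplier (fst p) (snd p) \<in> subdifferential g (\<Phi> (fst p)) \<and>
      Dadj (fst p) (multiplier (fst p) (snd p)) = snd p"
  proof eventually_elim
    case (elim p)
    have "snd p \<in> Dadj (fst p) ` subdifferential g (\<Phi> (fst p))"
      using elim(1) unfolding elim(2)[symmetric] gph_def case_prod_unfold by (rule CollectD)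
    then obtain l where "snd p = Dadj (fst p) l" "l \<in> subdifferential g (\<Phi> (fst p))"
      by (rule imageE)
    then have "\<exists>l. l \<in> subdifferential g (\<Phi> (fst p)) \<and> Dadj (fst p) l = snd p"
      by (intro exI[of _ l] conjI) (simp_all only:)
    then show ?case unfolding multiplier_def by (rule someI_ex)
  qed
  then show "\<forall>\<^sub>F (x, v) in ?F. multiplier x v \<in> subdifferential g (\<Phi> x) \<and> Dadj x (multiplier x v) = v"
    by (simp add: case_prod_unfold)
  obtain c where c: "c > 0" "\<forall>\<^sub>F x in nhds x0. \<forall>l\<in>Lsp x0. c * norm l \<le> norm (Dadj x l)"
    by (rule eventually_adjoint_bounded_below[OF x0 nd])
  have "((\<lambda>p. multiplier (fst p) (snd p) - l0) \<longlongrightarrow> 0) ?F"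
  proof (rule Lim_null_comparison)
    have Dl: "((\<lambda>p. Dadj (fst p) l0) \<longlongrightarrow> Dadj x0 l0) ?F"
    proof -
      have "((\<lambda>p. D (fst p)) \<longlongrightarrow> D x0) ?F" by (rule filterlim_compose[OF tendsto_D[OF x0] fx])
      then have "((\<lambda>p. norm (D (fst p) - D x0) * norm l0) \<longlongrightarrow> norm (D x0 - D x0) * norm l0) ?F"
        by (intro tendsto_mult tendsto_norm tendsto_diff tendsto_const)
      then have n0: "((\<lambda>p. norm (D (fst p) - D x0) * norm l0) \<longlongrightarrow> 0) ?F" by simp
      have bnd: "norm (Dadj x l0 - Dadj x0 l0) \<le> norm (D x - D x0) * norm l0" for x
      proof -
        have "Dadj x l0 - Dadj x0 l0 = adjoint (blinfun_apply (D x - D x0)) l0"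
        proof (rule vector_eq_rdot[THEN iffD1], rule allI)
          fix w
          have "adjoint (blinfun_apply (D x - D x0)) l0 \<bullet> w = l0 \<bullet> (D x - D x0) w"
            using adjoint_works[OF bounded_linear.linear[OF blinfun.bounded_linear_right], of w "D x - D x0" l0]
            by (simp add: inner_commute)
          then show "(Dadj x l0 - Dadj x0 l0) \<bullet> w = adjoint (blinfun_apply (D x - D x0)) l0 \<bullet> w"
            by (simp add: inner_diff_left inner_diff_right inner_Dadj blinfun.diff_left)
        qed
        then show ?thesis using norm_adjoint_blinfun_le by metis
      qed
      have "((\<lambda>p. Dadj (fst p) l0 - Dadj x0 l0) \<longlongrightarrow> 0) ?F"
        by (rule Lim_null_comparison[OF always_eventually[OF allI[OF bnd]] n0])
      then show ?thesis by (simp add: LIM_zero_iff)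
    qed
    have "((\<lambda>p. norm (snd p - Dadj (fst p) l0) / c) \<longlongrightarrow> norm (Dadj x0 l0 - Dadj x0 l0) / c) ?F"
      by (intro tendsto_intros sv Dl) (use c(1) in simp)
    then show "((\<lambda>p. norm (snd p - Dadj (fst p) l0) / c) \<longlongrightarrow> 0) ?F" by simp
    show "\<forall>\<^sub>F p in ?F. norm (multiplier (fst p) (snd p) - l0) \<le> norm (snd p - Dadj (fst p) l0) / c"
      using ev eventually_compose_filterlim[OF c(2) fx]
        eventually_compose_filterlim[OF eventually_subdifferential_subset[OF x0 l0] fx]
    proof eventually_elim
      case (elim p)
      have "multiplier (fst p) (snd p) \<in> subdifferential g (\<Phi> x0)" using elim by blast
      then have "multiplier (fst p) (snd p) - l0 \<in> Lsp x0" using l0 by (rule diff_in_direction_space)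
      then have "c * norm (multiplier (fst p) (snd p) - l0) \<le> norm (Dadj (fst p) (multiplier (fst p) (snd p) - l0))"
        using elim by blast
      also have "\<dots> = norm (snd p - Dadj (fst p) l0)" using elim by (simp add: linear_diff[OF linear_Dadj])
      finally show ?case using c(1) by (simp add: pos_le_divide_eq mult.commute)
    qed
  qed
  then show "((\<lambda>(x, v). multiplier x v) \<longlongrightarrow> l0) ?F" by (simp add: LIM_zero_iff case_prod_unfold)
qed

text \<open>Multipliers near \<open>l0\<close> remain relatively interior, so \<Phi> can move only
  orthogonally to the direction space, and along such moves the subdifferential of \<open>g\<close>
  can neither grow nor shrink. Nearby pairs thus inherit the hypotheses imposed at the reference
  pair.\<close>

lemma eventually_same_structure:
  assumes x0: "x0 \<in> V" and l0: "l0 \<in> rel_interior (subdifferential g (\<Phi> x0))" and nd: "nondegenerate x0"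
  shows "\<forall>\<^sub>F (x, v) in graph_filter x0 (Dadj x0 l0). x \<in> V \<and>
    subdifferential g (\<Phi> x) = subdifferential g (\<Phi> x0) \<and> nondegenerate x \<and>
    multiplier x v \<in> rel_interior (subdifferential g (\<Phi> x)) \<and> Dadj x (multiplier x v) = v \<and>
    (\<forall>k\<in>Lsp x0. k \<bullet> (\<Phi> x - \<Phi> x0) = 0)"
proof -
  let ?F = "graph_filter x0 (Dadj x0 l0)" and ?C = "subdifferential g (\<Phi> x0)"
  have l0C: "l0 \<in> ?C" using l0 rel_interior_subset by blast
  have id: "((\<lambda>p. p) \<longlongrightarrow> (x0, Dadj x0 l0)) ?F"
    unfolding filterlim_def by simp
  have fx: "(fst \<longlongrightarrow> x0) ?F" using tendsto_fst[OF id] by simp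
  obtain c where c: "c > 0" "\<forall>\<^sub>F x in nhds x0. \<forall>l\<in>Lsp x0. c * norm l \<le> norm (Dadj x l)"
    by (rule eventually_adjoint_bounded_below[OF x0 nd])
  obtain e where e: "e > 0" "\<And>d. d \<in> ?C \<Longrightarrow> norm (d - l0) \<le> e \<Longrightarrow> d \<in> rel_interior ?C"
    by (rule rel_interior_near[OF l0]) (rule that)
  have "\<forall>\<^sub>F p in ?F. dist ((\<lambda>(x, v). multiplier x v) p) l0 < e"
    using multiplier_tendsto[OF x0 l0C nd] e(1) by (rule tendstoD)
  then show ?thesis
    using eventually_multiplier[OF x0 l0C nd]
      eventually_compose_filterlim[OF eventually_V[OF x0] fx] eventually_compose_filterlim[OF c(2) fx]
      eventually_compose_filterlim[OF eventually_subdifferential_subset[OF x0 l0C] fx]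
  proof eventually_elim
    case (elim p)
    obtain x v where p: "p = (x, v)" by (cases p)
    let ?l = "multiplier x v"
    have l: "?l \<in> subdifferential g (\<Phi> x)" "Dadj x ?l = v" and xV: "x \<in> V"
      and sub: "subdifferential g (\<Phi> x) \<subseteq> ?C" and cx: "\<forall>l\<in>Lsp x0. c * norm l \<le> norm (Dadj x l)"
      and near: "norm (?l - l0) \<le> e"
      using elim unfolding p by (auto simp: dist_norm)
    have lC: "?l \<in> ?C" using l sub by blast
    have ri: "?l \<in> rel_interior ?C" by (rule e(2)[OF lC near])
    have orth: "\<forall>k\<in>Lsp x0. k \<bullet> (\<Phi> x - \<Phi> x0) = 0"
      using polyhedral_rel_interior_orthogonal[OF poly ri l(1)] by blast
    have eq: "subdifferential g (\<Phi> x) = ?C"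
      using polyhedral_subdifferential_subset_of_orthogonal[OF poly lC l(1) orth] sub by blast
    have "nondegenerate x"
      unfolding nondegenerate_def eq
    proof safe
      fix k assume "k \<in> Lsp x0" "Dadj x k = 0"
      with cx have "c * norm k \<le> 0" by fastforce
      then show "k = 0" using c(1) by (simp add: mult_le_0_iff)
    qed
    then show ?case using xV eq ri l orth unfolding p by simp
  qed
qed

lemma strictly_twice_epi_differentiable_if_rel_interior:
  assumes x0: "x0 \<in> V" and l0: "l0 \<in> rel_interior (subdifferential g (\<Phi> x0))" and nd: "nondegenerate x0"
  shows "strictly_twice_epi_differentiable \<phi> x0 (Dadj x0 l0)"
proof -
  let ?C = "subdifferential g (\<Phi> x0)" and ?L = "Lsp x0" and ?P = "orth_proj (Lsp x0)"
  let ?vb = "Dadj x0 l0"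
  define G where "G = subgradient_filter \<phi> x0 ?vb"
  define F where "F = at_right (0::real) \<times>\<^sub>F G"
  define \<Delta> where "\<Delta> = (\<lambda>(t, x, v). second_order_quotient \<phi> t x v)"
  define h where "h = (\<lambda>w. if ?P (D x0 w) = 0 then ereal (l0 \<bullet> D2 x0 w w) else \<infinity>)"
  have lP: "linear ?P" by (rule linear_orth_proj) simp
  have l0C: "l0 \<in> ?C" using l0 rel_interior_subset by blast
  obtain a0 where a0: "g (\<Phi> x0) = ereal a0" using subdifferential_imp_finite[OF l0C] by blast
  have v0: "?vb \<in> subdifferential \<phi> x0"
    by (rule adjoint_image_subset_subdifferential[OF x0 l0C])
  have "G \<noteq> bot" unfolding G_def by (rule subgradient_filter_neq_bot[OF v0])
  then have Fbot: "F \<noteq> bot" by (simp add: F_def prod_filter_eq_bot)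
  have G: "G \<le> graph_filter x0 ?vb" unfolding G_def subgradient_filter_def by (rule inf_le1)
  have sndF: "filterlim snd G F" unfolding F_def by (rule filterlim_snd)
  have t0: "(fst \<longlongrightarrow> 0) F" and tpos: "\<forall>\<^sub>F i in F. fst i > 0"
  proof -
    have "filterlim fst (at_right 0) F" unfolding F_def by (rule filterlim_fst)
    then show "(fst \<longlongrightarrow> 0) F" "\<forall>\<^sub>F i in F. fst i > 0"
      by (auto simp: filterlim_at elim: eventually_mono)
  qed
  let ?x = "\<lambda>i::real \<times> 'a \<times> 'a. fst (snd i)" and ?v = "\<lambda>i::real \<times> 'a \<times> 'a. snd (snd i)"
  let ?l = "\<lambda>i. multiplier (?x i) (?v i)"
  have gF: "filterlim snd (graph_filter x0 ?vb) F"
    using sndF G by (rule filterlim_mono) simp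
  have "filterlim snd (nhds (x0, ?vb)) F"
    by (rule filterlim_mono[OF gF inf_le1 order_refl])
  from tendsto_fst[OF this] have xlim: "(?x \<longlongrightarrow> x0) F" by simp
  have llim: "(?l \<longlongrightarrow> l0) F"
    using filterlim_compose[OF multiplier_tendsto[OF x0 l0C nd] gF] by (simp add: case_prod_unfold)
  have str: "\<forall>\<^sub>F i in F. ?x i \<in> V \<and> subdifferential g (\<Phi> (?x i)) = ?C \<and>
    ?l i \<in> rel_interior ?C \<and> Dadj (?x i) (?l i) = ?v i \<and> (\<forall>k\<in>?L. k \<bullet> (\<Phi> (?x i) - \<Phi> x0) = 0)"
    using eventually_compose_filterlim[OF eventually_same_structure[OF assms] gF]
    by eventually_elim (auto simp: case_prod_unfold)
  have "outer_limit F (\<lambda>i. epi (\<Delta> i)) \<subseteq> epi h"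
  proof
    fix p assume outer: "p \<in> outer_limit F (\<lambda>i. epi (\<Delta> i))"
    show "p \<in> epi h"
    proof (rule ccontr)
      assume "p \<notin> epi h"
      obtain w r where p: "p = (w, r)" by (cases p)
      with \<open>p \<notin> epi h\<close> have cases: "?P (D x0 w) \<noteq> 0 \<or> r < l0 \<bullet> D2 x0 w w"
        by (auto simp: epi_def h_def split: if_splits)
      obtain e where e: "e > 0"
        "\<And>d k. d \<in> ?C \<Longrightarrow> norm (d - l0) \<le> e \<Longrightarrow> k \<in> ?L \<Longrightarrow> norm k \<le> e \<Longrightarrow> d + k \<in> ?C"
        by (rule rel_interior_uniform[OF l0]) (rule that)
      let ?H = "F \<times>\<^sub>F nhds (w, r)"
      have 1: "filterlim fst F ?H" by (rule filterlim_fst)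
      have 2: "(snd \<longlongrightarrow> (w, r)) ?H" by (rule filterlim_snd)
      note comp1 = filterlim_compose[OF _ 1]
      have W: "((\<lambda>j. fst (snd j)) \<longlongrightarrow> w) ?H" and R: "((\<lambda>j. snd (snd j)) \<longlongrightarrow> r) ?H"
        using tendsto_fst[OF 2] tendsto_snd[OF 2] by simp_all
      have X: "((\<lambda>j. ?x (fst j)) \<longlongrightarrow> x0) ?H" by (rule comp1[OF xlim])
      have T: "((\<lambda>j. fst (fst j)) \<longlongrightarrow> 0) ?H" by (rule comp1[OF t0])
      have T': "\<forall>\<^sub>F j in ?H. 0 < fst (fst j)" by (rule eventually_compose_filterlim[OF tpos 1])
      have LL: "((\<lambda>j. ?l (fst j)) \<longlongrightarrow> l0) ?H" by (rule comp1[OF llim])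
      have "((\<lambda>j. ?x (fst j) + fst (fst j) *\<^sub>R fst (snd j)) \<longlongrightarrow> x0 + 0 *\<^sub>R w) ?H"
        by (intro tendsto_intros X T W)
      then have "((\<lambda>j. ?x (fst j) + fst (fst j) *\<^sub>R fst (snd j)) \<longlongrightarrow> x0) ?H" by simp
      then have "\<forall>\<^sub>F j in ?H. ?x (fst j) + fst (fst j) *\<^sub>R fst (snd j) \<in> V"
        by (rule eventually_compose_filterlim[OF eventually_V[OF x0]])
      moreover have "\<forall>\<^sub>F j in ?H. dist (?l (fst j)) l0 < e" using LL e(1) by (rule tendstoD)
      ultimately have "\<forall>\<^sub>F j in ?H. snd j \<notin> epi (\<Delta> (fst j))"
        using eventually_lower_bound_exceeds[OF x0 T' T X W LL R subspace_direction_space e(1) cases]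
          T' eventually_compose_filterlim[OF str 1]
      proof eventually_elim
        case (elim j)
        obtain t x v w' r' where j: "j = ((t, x, v), (w', r'))" by (cases j) auto
        let ?m = "multiplier x v"
        have mC: "?m \<in> ?C" using elim rel_interior_subset[of ?C] unfolding j by auto
        show ?case
        proof
          assume "snd j \<in> epi (\<Delta> (fst j))"
          then have q: "second_order_quotient \<phi> t x (Dadj x ?m) w' \<le> ereal r'"
            using elim unfolding j by (simp add: epi_def \<Delta>_def)
          have "\<forall>k\<in>?L. norm k \<le> e \<longrightarrow> ?m + k \<in> subdifferential g (\<Phi> x)"
            using e(2)[OF mC] elim unfolding j by (simp add: dist_norm)
          from second_order_quotient_lower_bound[OF _ _ _ subspace_direction_space this _ q] e(1) elim
          show False unfolding j by simp
        qed
      qed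
      then have "p \<notin> outer_limit F (\<lambda>i. epi (\<Delta> i))"
        unfolding p by (intro not_in_outer_limit) (simp add: case_prod_unfold)
      with outer show False by blast
    qed
  qed
  moreover have "epi h \<subseteq> inner_limit F (\<lambda>i. epi (\<Delta> i))"
  proof
    fix p assume "p \<in> epi h"
    obtain w r where p: "p = (w, r)" by (cases p)
    with \<open>p \<in> epi h\<close> have w: "?P (D x0 w) = 0" and r: "l0 \<bullet> D2 x0 w w \<le> r"
      by (auto simp: epi_def h_def split: if_splits)
    obtain \<delta> where \<delta>: "\<delta> > 0"
      and aff: "\<And>u. \<forall>m\<in>?C. m \<bullet> u \<le> l0 \<bullet> u \<Longrightarrow> norm u < \<delta> \<Longrightarrow> g (\<Phi> x0 + u) \<le> ereal (a0 + l0 \<bullet> u)"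
      by (rule polyhedral_local_structure[OF poly a0 l0C]) (rule that)
    obtain \<kappa> \<rho> where \<kappa>: "\<kappa> > 0" and \<rho>: "\<rho> > 0" and
      reg: "\<And>x y. dist x x0 < \<rho> \<Longrightarrow> norm (?P (\<Phi> x - y)) < \<rho> \<Longrightarrow>
       \<exists>x'\<in>V. norm (x' - x) \<le> \<kappa> * norm (?P (\<Phi> x - y)) \<and> ?P (\<Phi> x') = ?P y"
      by (rule metric_regularity[OF open_V x0 der isCont_D[OF x0] subspace_direction_space
            nd[unfolded nondegenerate_def]]) (assumption, rule that)
    let ?t = "fst :: real \<times> 'a \<times> 'a \<Rightarrow> real"
    let ?d = "\<lambda>i. \<Phi> (?x i + ?t i *\<^sub>R w) - \<Phi> (?x i)"
    \<comment> \<open>The projected displacement along \<open>w\<close> is o(t) because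
      \<open>w\<close> lies in the kernel, so restoring the projected value of the moving base point
      changes the direction by o(1).\<close>
    let ?Q = "\<lambda>i x'. x' \<in> V \<and> norm (x' - (?x i + ?t i *\<^sub>R w)) \<le> \<kappa> * norm (?P (?d i)) \<and> ?P (\<Phi> x') = ?P (\<Phi> (?x i))"
    define c where "c = (\<lambda>i. SOME x'. ?Q i x')"
    have dlim: "((\<lambda>i. ?P (?d i /\<^sub>R ?t i)) \<longlongrightarrow> ?P (D x0 w)) F"
      by (intro bounded_linear.tendsto[OF linear_conv_bounded_linear[THEN iffD1, OF lP]]
          first_order_quotient_tendsto[OF x0 tpos t0 xlim tendsto_const])
    have Pd: "?P (?d i) = ?t i *\<^sub>R ?P (?d i /\<^sub>R ?t i)" if "?t i > 0" for i
      using that by (simp add: linear_scale[OF lP])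
    have "((\<lambda>i. ?t i *\<^sub>R ?P (?d i /\<^sub>R ?t i)) \<longlongrightarrow> 0 *\<^sub>R ?P (D x0 w)) F"
      by (intro tendsto_intros t0 dlim)
    then have "\<forall>\<^sub>F i in F. norm (?t i *\<^sub>R ?P (?d i /\<^sub>R ?t i)) < \<rho>"
      using tendstoD[OF _ \<rho>] by (force simp: dist_norm)
    moreover have "((\<lambda>i. ?x i + ?t i *\<^sub>R w) \<longlongrightarrow> x0 + 0 *\<^sub>R w) F" by (intro tendsto_intros xlim t0)
    then have "\<forall>\<^sub>F i in F. dist (?x i + ?t i *\<^sub>R w) x0 < \<rho>" using tendstoD[OF _ \<rho>] by force
    ultimately have c: "\<forall>\<^sub>F i in F. ?Q i (c i)"
      using tpos
    proof eventually_elim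
      case (elim i)
      then have "norm (?P (?d i)) < \<rho>" by (simp only: Pd)
      from reg[OF elim(2) this] show ?case unfolding c_def by (intro someI_ex[of "?Q i"]) blast
    qed
    define ws where "ws = (\<lambda>i. (c i - ?x i) /\<^sub>R ?t i)"
    have "((\<lambda>i. ws i - w) \<longlongrightarrow> 0) F"
    proof (rule Lim_null_comparison)
      show "((\<lambda>i. \<kappa> * norm (?P (?d i /\<^sub>R ?t i))) \<longlongrightarrow> 0) F"
        using tendsto_mult_left[OF tendsto_norm[OF dlim], of \<kappa>] w by simp
      show "\<forall>\<^sub>F i in F. norm (ws i - w) \<le> \<kappa> * norm (?P (?d i /\<^sub>R ?t i))"
        using c tpos
      proof eventually_elim
        case (elim i)
        have "ws i - w = (c i - (?x i + ?t i *\<^sub>R w)) /\<^sub>R ?t i"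
          using elim by (simp add: ws_def scaleR_right_diff_distrib scaleR_right_distrib)
        then have "norm (ws i - w) = norm (c i - (?x i + ?t i *\<^sub>R w)) / ?t i"
          using elim by (simp add: divide_inverse_commute)
        also have "\<dots> \<le> \<kappa> * norm (?P (?d i)) / ?t i" using elim by (intro divide_right_mono) auto
        also have "\<dots> = \<kappa> * norm (?P (?d i /\<^sub>R ?t i))" unfolding Pd[OF elim(2)] using elim(2) by simp
        finally show ?case .
      qed
    qed
    then have wlim: "(ws \<longlongrightarrow> w) F" by (simp add: LIM_zero_iff)
    let ?R = "\<lambda>i. ?l i \<bullet> ((2 / (?t i)\<^sup>2) *\<^sub>R (\<Phi> (?x i + ?t i *\<^sub>R ws i) - \<Phi> (?x i) - ?t i *\<^sub>R D (?x i) (ws i)))"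
    \<comment> \<open>The height must dominate the quotient and still tend to \<open>r\<close>; the
      limit of \<open>?R\<close> is at most \<open>r\<close>, so the maximum does both.\<close>
    define rs where "rs = (\<lambda>i. max r (?R i))"
    have "(rs \<longlongrightarrow> max r (l0 \<bullet> D2 x0 w w)) F"
      unfolding rs_def by (intro tendsto_intros llim second_order_quotient_tendsto[OF x0 tpos t0 xlim wlim])
    then have rlim: "(rs \<longlongrightarrow> r) F" using r by (simp add: max_def split: if_splits)
    have "((\<lambda>i. ?x i + ?t i *\<^sub>R ws i) \<longlongrightarrow> x0 + 0 *\<^sub>R w) F" by (intro tendsto_intros xlim t0 wlim)
    then have "((\<lambda>i. ?x i + ?t i *\<^sub>R ws i) \<longlongrightarrow> x0) F" by simp
    then have "\<forall>\<^sub>F i in F. dist (\<Phi> (?x i + ?t i *\<^sub>R ws i)) (\<Phi> x0) < \<delta>"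
      by (rule eventually_compose_filterlim[OF eventually_\<Phi>_ball[OF x0 \<delta>]])
    then have "\<forall>\<^sub>F i in F. (ws i, rs i) \<in> epi (\<Delta> i)"
      using c tpos str
    proof eventually_elim
      case (elim i)
      obtain t x v where i: "i = (t, x, v)" by (cases i)
      let ?m = "multiplier x v" and ?y = "x + t *\<^sub>R ws i"
      have t: "t > 0" and xV: "x \<in> V" and mC: "?m \<in> ?C" and xC: "subdifferential g (\<Phi> x) = ?C"
        and orth: "\<And>k. k \<in> ?L \<Longrightarrow> k \<bullet> (\<Phi> x - \<Phi> x0) = 0" and mv: "Dadj x ?m = v"
        using elim rel_interior_subset[of ?C] unfolding i by auto
      have y: "?y = c i" using t by (simp add: ws_def i)
      have yV: "?y \<in> V" using elim unfolding y by blast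
      have Py: "?P (\<Phi> ?y - \<Phi> x) = 0" using elim unfolding y by (simp add: linear_diff[OF lP] i)
      have orth': "k \<bullet> (\<Phi> ?y - \<Phi> x) = 0" if "k \<in> ?L" for k
        using Py that by (simp add: orth_proj_eq_0_iff)
      have "\<forall>m\<in>?C. m \<bullet> (\<Phi> ?y - \<Phi> x0) \<le> l0 \<bullet> (\<Phi> ?y - \<Phi> x0)"
      proof
        fix m assume "m \<in> ?C"
        then have "m - l0 \<in> ?L" using l0C by (rule diff_in_direction_space)
        from orth[OF this] orth'[OF this] show "m \<bullet> (\<Phi> ?y - \<Phi> x0) \<le> l0 \<bullet> (\<Phi> ?y - \<Phi> x0)"
          by (simp add: inner_diff_left inner_diff_right)
      qed
      from aff[OF this] have gy: "g (\<Phi> ?y) \<le> ereal (a0 + l0 \<bullet> (\<Phi> ?y - \<Phi> x0))"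
        using elim unfolding i by (simp add: dist_norm)
      have "?m \<in> subdifferential g (\<Phi> x)" using mC xC by simp
      then obtain a where a: "g (\<Phi> x) = ereal a" using subdifferential_imp_finite by blast
      \<comment> \<open>Rebasing the affine bound from \<Phi> \<open>x0\<close> with slope
        \<open>l0\<close> to \<Phi> \<open>x\<close> with slope \<open>?m\<close>: both slopes agree
        on the displacement, which is orthogonal to \<open>?L\<close>.\<close>
      have "a0 + l0 \<bullet> (\<Phi> x - \<Phi> x0) \<le> a"
        by (rule polyhedral_subgradientD[OF poly l0C a0]) (simp add: a)
      moreover have "(?m - l0) \<bullet> (\<Phi> ?y - \<Phi> x) = 0"
        by (rule orth'[OF diff_in_direction_space[OF mC l0C]])
      ultimately have "a0 + l0 \<bullet> (\<Phi> ?y - \<Phi> x0) \<le> a + ?m \<bullet> (\<Phi> ?y - \<Phi> x)"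
        by (simp add: inner_diff_left inner_diff_right)
      with gy have gy': "g (\<Phi> ?y) \<le> ereal (a + ?m \<bullet> (\<Phi> ?y - \<Phi> x))"
        by (metis ereal_less_eq(3) order.trans)
      have "second_order_quotient \<phi> t x (Dadj x ?m) (ws i) \<le> ereal (rs i)"
        by (rule second_order_quotient_upper_bound[OF xV yV t a gy']) (simp add: rs_def i)
      then show ?case unfolding mv by (simp add: epi_def \<Delta>_def i)
    qed
    moreover have "((\<lambda>i. (ws i, rs i)) \<longlongrightarrow> p) F" unfolding p by (intro tendsto_intros wlim rlim)
    ultimately show "p \<in> inner_limit F (\<lambda>i. epi (\<Delta> i))" by (rule in_inner_limit)
  qed
  moreover have "inner_limit F (\<lambda>i. epi (\<Delta> i)) \<subseteq> outer_limit F (\<lambda>i. epi (\<Delta> i))"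
    by (rule inner_limit_subset_outer_limit[OF Fbot])
  ultimately have "epi_converges F \<Delta> h"
    unfolding epi_converges_def set_converges_def by blast
  then show ?thesis
    using v0 unfolding strictly_twice_epi_differentiable_def F_def G_def \<Delta>_def by blast
qed

text \<open>The direction outside the kernel in which the limit is finite comes from a hyperplane supporting
  the subdifferential of \<open>g\<close> at \<open>l0\<close>.\<close>

lemma rel_interior_if_strictly_twice_epi_differentiable:
  assumes x0: "x0 \<in> V" and l0C: "l0 \<in> subdifferential g (\<Phi> x0)" and nd: "nondegenerate x0"
    and strict: "strictly_twice_epi_differentiable \<phi> x0 (Dadj x0 l0)"
  shows "l0 \<in> rel_interior (subdifferential g (\<Phi> x0))"
proof (rule ccontr)
  let ?C = "subdifferential g (\<Phi> x0)" and ?L = "Lsp x0" and ?P = "orth_proj (Lsp x0)"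
  let ?vb = "Dadj x0 l0"
  assume nri: "l0 \<notin> rel_interior ?C"
  have lP: "linear ?P" by (rule linear_orth_proj) simp
  have conv: "convex ?C" by (rule polyhedral_subdifferential_convex[OF poly])
  obtain a0 where a0: "g (\<Phi> x0) = ereal a0" using subdifferential_imp_finite[OF l0C] by blast
  obtain n where n: "\<And>y. y \<in> ?C \<Longrightarrow> n \<bullet> l0 \<le> n \<bullet> y" "\<And>y. y \<in> rel_interior ?C \<Longrightarrow> n \<bullet> l0 < n \<bullet> y"
    using supporting_hyperplane_rel_boundary[OF conv l0C nri] by metis
  have "l0 \<in> closure (rel_interior ?C)"
    using convex_closure_rel_interior[OF conv] l0C closure_subset by blast
  then obtain ms where ms: "\<And>k. ms k \<in> rel_interior ?C" "ms \<longlonglongrightarrow> l0"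
    unfolding closure_sequential by blast
  have msC: "ms k \<in> ?C" for k using ms(1) rel_interior_subset by blast
  \<comment> \<open>The hyperplane theorem makes \<open>l0\<close> a minimizer of \<open>n\<close>;
    the sign change makes it a maximizer, as the affine upper bound on \<open>g\<close> requires.
    Strictness at a relatively interior point shows that \<open>u\<close> is not orthogonal to
    \<open>?L\<close>.\<close>
  define u where "u = - n"
  have u: "(m - l0) \<bullet> u \<le> 0" if "m \<in> ?C" for m
    using n(1)[OF that] by (simp add: u_def inner_diff_left inner_commute[of n])
  have "(ms 0 - l0) \<bullet> u \<noteq> 0"
    using n(2)[OF ms(1)[of 0]] by (simp add: u_def inner_diff_left inner_commute[of n])
  then have Pu: "?P u \<noteq> 0"
    using diff_in_direction_space[OF msC l0C] by (auto simp: orth_proj_eq_0_iff)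
  obtain B where B: "linear B" "\<And>y. ?P (D x0 (B y)) = ?P y"
    by (rule orth_proj_right_inverse[OF lin_D subspace_direction_space nd[unfolded nondegenerate_def]]) (rule that)
  define w where "w = B u"
  have Pw: "?P (D x0 w) = ?P u" by (simp add: w_def B(2))
  define G where "G = subgradient_filter \<phi> x0 ?vb"
  define F where "F = at_right (0::real) \<times>\<^sub>F G"
  define \<Delta> where "\<Delta> = (\<lambda>(t, x, v). second_order_quotient \<phi> t x v)"
  define p where "p = (w, l0 \<bullet> D2 x0 w w)"
  have v0: "?vb \<in> subdifferential \<phi> x0"
    by (rule adjoint_image_subset_subdifferential[OF x0 l0C])
  have limits: "outer_limit F (\<lambda>i. epi (\<Delta> i)) = inner_limit F (\<lambda>i. epi (\<Delta> i))"
    using strict unfolding strictly_twice_epi_differentiable_def epi_converges_def set_converges_def F_def G_def \<Delta>_def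
    by auto
  have tpos: "\<forall>\<^sub>F t in at_right (0::real). t > 0" by (rule eventually_at_right_less)
  have t0: "((\<lambda>t. t) \<longlongrightarrow> (0::real)) (at_right 0)" by (rule tendsto_ident_at)
  have "p \<in> inner_limit (at_right 0) (\<lambda>t. epi (\<Delta> (t, x0, ?vb)))"
  proof -
    obtain \<delta> where \<delta>: "\<delta> > 0"
      and aff: "\<And>u. \<forall>m\<in>?C. m \<bullet> u \<le> l0 \<bullet> u \<Longrightarrow> norm u < \<delta> \<Longrightarrow> g (\<Phi> x0 + u) \<le> ereal (a0 + l0 \<bullet> u)"
      by (rule polyhedral_local_structure[OF poly a0 l0C]) (rule that)
    obtain c where c: "\<forall>\<^sub>F t in at_right 0. c t \<in> V \<and> ?P (\<Phi> (c t)) = ?P (\<Phi> x0 + t *\<^sub>R D x0 w)"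
      and clim: "((\<lambda>t. (c t - x0) /\<^sub>R t) \<longlongrightarrow> w) (at_right 0)"
      by (rule curve_through[OF x0 subspace_direction_space nd[unfolded nondegenerate_def]])
    define ws where "ws = (\<lambda>t. (c t - x0) /\<^sub>R t)"
    have wlim: "(ws \<longlongrightarrow> w) (at_right 0)" using clim by (simp add: ws_def)
    define rs where "rs = (\<lambda>t. l0 \<bullet> ((2 / t\<^sup>2) *\<^sub>R (\<Phi> (x0 + t *\<^sub>R ws t) - \<Phi> x0 - t *\<^sub>R D x0 (ws t))))"
    have rlim: "(rs \<longlongrightarrow> l0 \<bullet> D2 x0 w w) (at_right 0)"
      unfolding rs_def
      by (intro tendsto_intros second_order_quotient_tendsto[OF x0 tpos t0 tendsto_const wlim])
    have "((\<lambda>t. x0 + t *\<^sub>R ws t) \<longlongrightarrow> x0 + 0 *\<^sub>R w) (at_right 0)" by (intro tendsto_intros t0 wlim)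
    then have "((\<lambda>t. x0 + t *\<^sub>R ws t) \<longlongrightarrow> x0) (at_right 0)" by simp
    then have "\<forall>\<^sub>F t in at_right 0. dist (\<Phi> (x0 + t *\<^sub>R ws t)) (\<Phi> x0) < \<delta>"
      by (rule eventually_compose_filterlim[OF eventually_\<Phi>_ball[OF x0 \<delta>]])
    then have "\<forall>\<^sub>F t in at_right 0. (ws t, rs t) \<in> epi (\<Delta> (t, x0, ?vb))"
      using c tpos
    proof eventually_elim
      case (elim t)
      let ?y = "x0 + t *\<^sub>R ws t"
      have y: "?y = c t" using elim by (simp add: ws_def)
      have "?P (\<Phi> ?y - \<Phi> x0) = t *\<^sub>R ?P u"
        using elim unfolding y Pw[symmetric]
        by (simp add: linear_diff[OF lP] linear_add[OF lP] linear_scale[OF lP])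
      then have Pd: "k \<bullet> (\<Phi> ?y - \<Phi> x0) = t * (k \<bullet> u)" if "k \<in> ?L" for k
        using orth_proj_inner[OF subspace_direction_space that] by (metis inner_scaleR_right)
      have "\<forall>m\<in>?C. m \<bullet> (\<Phi> ?y - \<Phi> x0) \<le> l0 \<bullet> (\<Phi> ?y - \<Phi> x0)"
      proof
        fix m assume m: "m \<in> ?C"
        have "(m - l0) \<bullet> (\<Phi> ?y - \<Phi> x0) \<le> 0"
          unfolding Pd[OF diff_in_direction_space[OF m l0C]]
          using u[OF m] elim by (simp add: mult_nonneg_nonpos)
        then show "m \<bullet> (\<Phi> ?y - \<Phi> x0) \<le> l0 \<bullet> (\<Phi> ?y - \<Phi> x0)" by (simp add: inner_diff_left)
      qed
      from aff[OF this] have gy: "g (\<Phi> ?y) \<le> ereal (a0 + l0 \<bullet> (\<Phi> ?y - \<Phi> x0))"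
        using elim by (simp add: dist_norm)
      have "second_order_quotient \<phi> t x0 ?vb (ws t) \<le> ereal (rs t)"
        by (rule second_order_quotient_upper_bound[OF x0 _ _ a0 gy]) (use elim y in \<open>auto simp: rs_def\<close>)
      then show ?case by (simp add: epi_def \<Delta>_def)
    qed
    moreover have "((\<lambda>t. (ws t, rs t)) \<longlongrightarrow> p) (at_right 0)" unfolding p_def by (intro tendsto_intros wlim rlim)
    ultimately show ?thesis by (rule in_inner_limit)
  qed
  \<comment> \<open>Hits at the fixed pair alone place \<open>p\<close> only in the outer limit
    along \<open>F\<close>. Strictness identifies it with the inner limit, so the quotients at all
    nearby pairs must come close to \<open>p\<close>.\<close>
  then have "p \<in> outer_limit (at_right 0) (\<lambda>t. epi (\<Delta> (t, x0, ?vb)))"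
    using inner_limit_subset_outer_limit[of "at_right (0::real)"] by auto
  moreover have "filterlim (\<lambda>t. (t, x0, ?vb)) F (at_right 0)"
    unfolding F_def G_def
    by (intro filterlim_Pair filterlim_ident filterlim_subgradient_filter)
       (use v0 in \<open>auto simp: gph_def\<close>)
  ultimately have "p \<in> inner_limit F (\<lambda>i. epi (\<Delta> i))"
    unfolding limits[symmetric] by (rule outer_limit_filtermap_subset[rotated])
  moreover
  have "open {q :: 'a \<times> real. ?P (D x0 (fst q)) \<noteq> 0}"
    by (intro open_Collect_neq continuous_intros
        bounded_linear.continuous_on[OF linear_conv_bounded_linear[THEN iffD1, OF lP]])
  \<comment> \<open>A closed ball, so that limits of points in it still project to a nonzero
    vector.\<close>
  then obtain \<epsilon> where \<epsilon>: "\<epsilon> > 0" "cball p \<epsilon> \<subseteq> {q. ?P (D x0 (fst q)) \<noteq> 0}"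
    using Pu Pw unfolding open_contains_cball p_def by (metis (mono_tags, lifting) fst_conv mem_Collect_eq)
  ultimately have "\<forall>\<^sub>F i in F. epi (\<Delta> i) \<inter> ball p \<epsilon> \<noteq> {}"
    unfolding inner_limit_def by simp
  then obtain P Q where PQ: "eventually P (at_right (0::real))" "eventually Q G"
    "\<And>t q. P t \<Longrightarrow> Q q \<Longrightarrow> epi (\<Delta> (t, q)) \<inter> ball p \<epsilon> \<noteq> {}"
    unfolding F_def eventually_prod_filter by auto
  have "filterlim (\<lambda>k. (x0, Dadj x0 (ms k))) G sequentially"
    unfolding G_def
  proof (intro filterlim_subgradient_filter)
    show "(\<lambda>k. (x0, Dadj x0 (ms k))) \<longlonglongrightarrow> (x0, ?vb)"
      by (rule tendsto_Pair[OF tendsto_const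
            bounded_linear.tendsto[OF linear_conv_bounded_linear[THEN iffD1, OF linear_Dadj] ms(2)]])
    show "\<forall>\<^sub>F k in sequentially. (x0, Dadj x0 (ms k)) \<in> gph (subdifferential \<phi>)"
      using adjoint_image_subset_subdifferential[OF x0 msC] by (simp add: gph_def)
  qed simp
  from eventually_compose_filterlim[OF PQ(2) this]
  obtain k where k: "Q (x0, Dadj x0 (ms k))" using eventually_happens' sequentially_bot by blast
  \<comment> \<open>The multiplier is fixed before \<open>t\<close> tends to 0, so a single radius
    \<open>e\<close> of relative interiority is available for the lower bound.\<close>
  let ?m = "ms k"
  obtain e where e: "e > 0" "\<forall>k\<in>?L. norm k \<le> e \<longrightarrow> ?m + k \<in> ?C"
    using ms(1)[of k] unfolding rel_interior_direction_space by blast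
  obtain b where b: "b > 0" "\<And>t. 0 < t \<Longrightarrow> t < b \<Longrightarrow> P t"
    using PQ(1) unfolding eventually_at_right_field by blast
  \<comment> \<open>The offset 2 keeps even the first term strictly below \<open>b\<close>.\<close>
  define t where "t = (\<lambda>j::nat. b / (real j + 2))"
  have tp: "0 < t j" "t j < b" for j using b(1) by (auto simp: t_def divide_simps)
  have tlim: "t \<longlonglongrightarrow> 0" unfolding t_def by real_asymp
  have "\<forall>j. \<exists>q. q \<in> epi (\<Delta> (t j, x0, Dadj x0 ?m)) \<and> q \<in> ball p \<epsilon>"
    using PQ(3)[OF b(2) k] tp by blast
  then obtain q where q: "\<And>j. q j \<in> epi (\<Delta> (t j, x0, Dadj x0 ?m))" "\<And>j. q j \<in> ball p \<epsilon>" by metis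
  have "\<exists>q0\<in>cball p \<epsilon>. \<exists>r. strict_mono r \<and> (q \<circ> r) \<longlonglongrightarrow> q0"
    using compact_cball[of p \<epsilon>] q(2) unfolding compact_def by (meson ball_subset_cball subset_iff)
  then obtain q0 r where q0: "q0 \<in> cball p \<epsilon>" and r: "strict_mono r" and qr: "(q \<circ> r) \<longlonglongrightarrow> q0" by blast
  have fl: "filterlim r sequentially sequentially" using r by (rule filterlim_subseq)
  have tr: "(\<lambda>j. t (r j)) \<longlonglongrightarrow> 0" by (rule filterlim_compose[OF tlim fl])
  have W: "(\<lambda>j. fst (q (r j))) \<longlonglongrightarrow> fst q0" and R: "(\<lambda>j. snd (q (r j))) \<longlonglongrightarrow> snd q0"
    using tendsto_fst[OF qr] tendsto_snd[OF qr] by (simp_all add: comp_def)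
  have tpr: "\<forall>\<^sub>F j in sequentially. 0 < t (r j)" using tp by simp
  have "(\<lambda>j. x0 + t (r j) *\<^sub>R fst (q (r j))) \<longlonglongrightarrow> x0 + 0 *\<^sub>R fst q0" by (intro tendsto_intros tr W)
  then have "(\<lambda>j. x0 + t (r j) *\<^sub>R fst (q (r j))) \<longlonglongrightarrow> x0" by simp
  then have "\<forall>\<^sub>F j in sequentially. x0 + t (r j) *\<^sub>R fst (q (r j)) \<in> V"
    by (rule eventually_compose_filterlim[OF eventually_V[OF x0]])
  moreover have "?P (D x0 (fst q0)) \<noteq> 0 \<or> snd q0 < ?m \<bullet> D2 x0 (fst q0) (fst q0)" using q0 \<epsilon>(2) by blast
  note eventually_lower_bound_exceeds[OF x0 tpr tr tendsto_const W tendsto_const R subspace_direction_space e(1) this]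
  ultimately have "\<forall>\<^sub>F j in sequentially. False"
  proof eventually_elim
    case (elim j)
    have qq: "second_order_quotient \<phi> (t (r j)) x0 (Dadj x0 ?m) (fst (q (r j))) \<le> ereal (snd (q (r j)))"
      using q(1)[of "r j"] by (simp add: epi_def \<Delta>_def case_prod_unfold)
    from second_order_quotient_lower_bound[OF x0 elim(1) tp(1) subspace_direction_space e(2) _ qq] elim(2) e(1)
    show False by simp
  qed
  then show False by simp
qed

end

section \<open>From the matrix formulation to the composite setting\<close>

theorem theorem3p9:
  fixes \<phi> :: "real^'n \<Rightarrow> ereal"
    and g :: "real^'m \<Rightarrow> ereal"
    and \<Phi> :: "real^'n \<Rightarrow> real^'m"
    and xbar vbar :: "real^'n"
    and lbar :: "real^'m"
  assumes "\<bar>\<phi> xbar\<bar> \<noteq> \<infinity>"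
    and "composite_representation \<phi> g \<Phi> xbar"
    and "vbar \<in> subdifferential \<phi> xbar"
    and "lbar \<in> multipliers g \<Phi> xbar vbar"
    and "SOQC g \<Phi> xbar lbar"
  shows "(\<exists>U. open U \<and> (xbar, vbar) \<in> U \<and>
            (\<forall>(x, v) \<in> U \<inter> gph (subdifferential \<phi>). strictly_twice_epi_differentiable \<phi> x v))
         \<longleftrightarrow> vbar \<in> rel_interior (subdifferential \<phi> xbar)"
proof -
  obtain W D and D2 :: "(real^'n) \<Rightarrow> (real^'n) \<Rightarrow>\<^sub>L (real^'n) \<Rightarrow>\<^sub>L (real^'m)" where W: "open W" "xbar \<in> W"
    "\<forall>x\<in>W. (\<Phi> has_derivative blinfun_apply (D x)) (at x) \<and> (D has_derivative blinfun_apply (D2 x)) (at x)"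
    "continuous_on W D2"
    using assms(2) unfolding composite_representation_def twice_cont_differentiable_around_def by blast
  have "\<forall>\<^sub>F x in nhds xbar. \<phi> x = g (\<Phi> x)" using assms(2) by (simp add: composite_representation_def)
  then obtain N where N: "open N" "xbar \<in> N" "\<forall>x\<in>N. \<phi> x = g (\<Phi> x)" unfolding eventually_nhds by blast
  define V where "V = W \<inter> N"
  interpret smooth_composite \<phi> g \<Phi> D D2 V
    using assms(2) W N unfolding composite_representation_def V_def
    by unfold_locales (auto intro: continuous_on_subset)
  have xV: "xbar \<in> V" using W(2) N(2) by (simp add: V_def)
  let ?C = "subdifferential g (\<Phi> xbar)"
  have jac: "transpose (jacobian \<Phi> (at xbar)) *v l = Dadj xbar l" for l
  proof -
    have "frechet_derivative \<Phi> (at xbar) = blinfun_apply (D xbar)"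
      using frechet_derivative_at[OF der[OF xV]] by simp
    then have "jacobian \<Phi> (at xbar) = matrix (blinfun_apply (D xbar))" by (simp add: jacobian_def)
    moreover have "blinfun_apply (D xbar) = (\<lambda>x. matrix (blinfun_apply (D xbar)) *v x)"
      using matrix_vector_mul(2)[OF lin_D] by auto
    ultimately show ?thesis by (metis adjoint_matrix)
  qed
  have l: "Dadj xbar lbar = vbar" "lbar \<in> ?C"
    using assms(4) unfolding multipliers_def jac by auto
  have nd: "nondegenerate xbar"
    unfolding nondegenerate_def
    using assms(5) direction_space_subset_coderivative[OF poly l(2)] unfolding SOQC_def jac by auto
  have ri: "vbar \<in> rel_interior (subdifferential \<phi> xbar) \<longleftrightarrow> lbar \<in> rel_interior ?C"
  proof -
    have "subdifferential \<phi> xbar = Dadj xbar ` ?C"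
      by (rule eventually_nhds_x_imp_x[OF eventually_subdifferential_chain_rule[OF xV l(2) nd]])
    then have eq: "rel_interior (subdifferential \<phi> xbar) = Dadj xbar ` rel_interior ?C"
      using rel_interior_convex_linear_image[OF linear_Dadj polyhedral_subdifferential_convex[OF poly]] by simp
    \<comment> \<open>The relative interior commutes with the linear image, but membership of
      \<open>vbar\<close> concerns \<open>lbar\<close> itself only because the adjoint is injective
      on differences of multipliers.\<close>
    have "m = lbar" if m: "m \<in> rel_interior ?C" "Dadj xbar m = vbar" for m
    proof -
      have "m - lbar \<in> Lsp xbar"
        using m(1) rel_interior_subset l(2) by (intro diff_in_direction_space) auto
      moreover have "Dadj xbar (m - lbar) = 0" using m(2) l(1) by (simp add: linear_diff[OF linear_Dadj])
      ultimately show ?thesis using nd unfolding nondegenerate_def by auto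
    qed
    then show ?thesis unfolding eq using l(1) by blast
  qed
  show ?thesis
  proof
    assume "\<exists>U. open U \<and> (xbar, vbar) \<in> U \<and>
      (\<forall>(x, v) \<in> U \<inter> gph (subdifferential \<phi>). strictly_twice_epi_differentiable \<phi> x v)"
    then have "strictly_twice_epi_differentiable \<phi> xbar vbar"
      using assms(3) by (auto simp: gph_def)
    then show "vbar \<in> rel_interior (subdifferential \<phi> xbar)"
      unfolding ri using rel_interior_if_strictly_twice_epi_differentiable[OF xV l(2) nd] l(1) by simp
  next
    assume "vbar \<in> rel_interior (subdifferential \<phi> xbar)"
    then have "lbar \<in> rel_interior ?C" by (simp add: ri)
    \<comment> \<open>Every graph point near the reference pair satisfies the hypotheses with its
      own multiplier, which provides \<open>U\<close>.\<close>
    from eventually_same_structure[OF xV this nd]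
    have "\<forall>\<^sub>F p in nhds (xbar, vbar). p \<in> gph (subdifferential \<phi>) \<longrightarrow> (case p of (x, v) \<Rightarrow> x \<in> V \<and> nondegenerate x \<and>
      multiplier x v \<in> rel_interior (subdifferential g (\<Phi> x)) \<and> Dadj x (multiplier x v) = v)"
      unfolding l(1) eventually_inf_principal by eventually_elim auto
    then obtain U where U: "open U" "(xbar, vbar) \<in> U"
      "\<And>x v. (x, v) \<in> U \<Longrightarrow> (x, v) \<in> gph (subdifferential \<phi>) \<Longrightarrow> x \<in> V \<and> nondegenerate x \<and>
      multiplier x v \<in> rel_interior (subdifferential g (\<Phi> x)) \<and> Dadj x (multiplier x v) = v"
      unfolding eventually_nhds by fast
    have "strictly_twice_epi_differentiable \<phi> x v" if "(x, v) \<in> U" "(x, v) \<in> gph (subdifferential \<phi>)" for x v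
      using strictly_twice_epi_differentiable_if_rel_interior[of x "multiplier x v"] U(3)[OF that] by simp
    with U(1,2) show "\<exists>U. open U \<and> (xbar, vbar) \<in> U \<and>
      (\<forall>(x, v) \<in> U \<inter> gph (subdifferential \<phi>). strictly_twice_epi_differentiable \<phi> x v)" by blast
  qed
qed

end
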